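(* Let $n\ge 1$ and consider the abelian Lie group $\mathbb{R}^n$ with Lie algebra $\mathfrak{g}_{\mathbb{R}^n}$. Let $\{e_1,\dots,e_n\}$ be the standard basis of $\mathfrak{g}_{\mathbb{R}^n}$, $\{x_1,\dots,x_n\}$ its dual basis, and $g$ the left-invariant Riemannian metric on $\mathbb{R}^n$ for which $\{e_1,\dots,e_n\}$ is orthonormal. Then: (1) All left-invariant statistical structures on $\mathbb{R}^n$ are conjugate symmetric. (2) The set $V^+ := \{\sum_{i=1}^n \lambda_i x_i^3 \mid \lambda_1\ge\dots\ge\lambda_n\ge 0\}\subset S^3(\mathfrak{g}_{\mathbb{R}^n}^* )$ is a set of representatives for $\mathcal{ML}\mathrm{Stat}^{\mathrm{DF}}(\mathbb{R}^n)$. The moduli space $\mathcal{ML}\mathrm{Stat}^{\mathrm{DF}}(\mathbb{R}^n)$ is homeomorphic to the orbit space $\mathbb{R}_{>0}\backslash V^+$ of the action of $\mathbb{R}_{>0}$ on $V^+$ by scalar multiplication (with the quotient topology), which implies the existence of an $(n-1)$-dimensional family of left-invariant dually flat structures on $\mathbb{R}^n$.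
   Context: A statistical structure on a manifold $M$ is a pair $(g,\nabla)$ of a Riemannian metric $g$ and a torsion-free affine connection $\nabla$ such that the $(0,3)$-tensor field $C:=\nabla g$, $C(X,Y,Z)=(\nabla_X g)(Y,Z)$ (the cubic form), is totally symmetric. For fixed $g$, $\nabla\mapsto\nabla g$ is a bijection onto the symmetric $(0,3)$-tensor fields; $\nabla^{(g,C)}$ denotes the connection with $\nabla g=C$. The dual connection $\overline\nabla$ is defined by $Xg(Y,Z)=g(\nabla_XY,Z)+g(Y,\overline\nabla_XZ)$. With $R^\nabla$ the curvature tensor, $(g,\nabla)$ is conjugate symmetric if $R^\nabla=R^{\overline\nabla}$, and dually flat if $R^\nabla=0$. For a Lie group $G$ with Lie algebra $\mathfrak g$, a statistical structure $(g,\nabla)$ on $G$ is left-invariant if both $g$ and $\nabla$ are invariant under left translations. $\mathcal{L}\mathrm{Stat}(G)$ is the set of these; it is identified via $(g,\nabla)\mapsto(g,\nabla g)$ with $\widetilde{\mathfrak M}(G)\times S^3(\mathfrak g^* )$, where $\widetilde{\mathfrak M}(G)$ is the space of left-invariant Riemannian metrics (= inner products on $\mathfrak g$), and carries the corresponding topology. $\mathbb{R}_{>0}\times\mathrm{Aut}(G)$ acts on it by $(r,\varphi).(g,\nabla)=(r\,(\varphi^{-1})^*g,(\varphi^{-1})^*\nabla)$. The orbit space with the quotient topology is the moduli space $\mathcal{ML}\mathrm{Stat}(G)$; $\mathcal{ML}\mathrm{Stat}^{\mathrm{DF}}(G)$ is the orbit space (with the quotient topology) of the invariant subset of dually flat structures.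 $S^k(\mathfrak g^* )$ denotes symmetric $k$-tensors, with products $(x_1\cdots x_k)(X_1,\dots,X_k)=\frac1{k!}\sum_{\sigma\in\mathfrak S_k}\prod_i x_{\sigma(i)}(X_i)$. A subset $A\subset S^3(\mathfrak g^* )$ is a set of representatives for $\mathcal{ML}\mathrm{Stat}^{\mathrm{DF}}(G)$ (with respect to the fixed $g$) if $C\mapsto[(g,\nabla^{(g,C)})]$ maps $A$ onto $\mathcal{ML}\mathrm{Stat}^{\mathrm{DF}}(G)$. *)

theory Defs
  imports "HOL-Analysis.Analysis"
begin

text \<open>The Lie group is \<open>real^'n\<close> under addition. All tangent spaces are identified with
  \<open>real^'n\<close> by the global chart, so the Lie algebra, as the tangent space at \<open>0\<close>,
  is \<open>real^'n\<close> as well. In this chart the differential of a translation is the identity;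
  thus the left-invariant extension of a vector (or of a tensor) at \<open>0\<close> is the constant field.\<close>

section \<open>Smooth maps and vector fields\<close>

primrec C_k :: "nat \<Rightarrow> ('a::euclidean_space \<Rightarrow> 'b::real_normed_vector) \<Rightarrow> bool" where
  "C_k 0 f \<longleftrightarrow> continuous_on UNIV f"
| "C_k (Suc k) f \<longleftrightarrow> (\<forall>x. f differentiable (at x)) \<and>
     (\<forall>v. C_k k (\<lambda>x. frechet_derivative f (at x) v))"

definition smooth :: "('a::euclidean_space \<Rightarrow> 'b::real_normed_vector) \<Rightarrow> bool" where
  "smooth f \<longleftrightarrow> (\<forall>k. C_k k f)"

type_synonym 'n vfield = "real^'n \<Rightarrow> real^'n"

definition dir_deriv :: "('n::finite) vfield \<Rightarrow> (real^'n \<Rightarrow> 'b::real_normed_vector) \<Rightarrow> real^'n \<Rightarrow> 'b" where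
  "dir_deriv X f = (\<lambda>p. frechet_derivative f (at p) (X p))"

definition lie_bracket :: "('n::finite) vfield \<Rightarrow> 'n vfield \<Rightarrow> 'n vfield" where
  "lie_bracket X Y = (\<lambda>p. dir_deriv X Y p - dir_deriv Y X p)"

definition pushforward :: "('n::finite) vfield \<Rightarrow> 'n vfield \<Rightarrow> 'n vfield" where
  "pushforward \<phi> X = (\<lambda>q. frechet_derivative \<phi> (at (inv \<phi> q)) (X (inv \<phi> q)))"

section \<open>Riemannian metrics and affine connections\<close>

type_synonym 'n metric = "real^'n \<Rightarrow> real^'n \<Rightarrow> real^'n \<Rightarrow> real"
type_synonym 'n connection = "'n vfield \<Rightarrow> 'n vfield \<Rightarrow> 'n vfield"

definition inner_product :: "(real^('n::finite) \<Rightarrow> real^'n \<Rightarrow> real) \<Rightarrow> bool" where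
  "inner_product b \<longleftrightarrow> bilinear b \<and> (\<forall>u v. b u v = b v u) \<and> (\<forall>u. u \<noteq> 0 \<longrightarrow> b u u > 0)"

definition riemannian_metric :: "('n::finite) metric \<Rightarrow> bool" where
  "riemannian_metric g \<longleftrightarrow> (\<forall>p. inner_product (g p)) \<and> (\<forall>u v. smooth (\<lambda>p. g p u v))"

text \<open>A connection acts on smooth vector fields only. As HOL functions are total, we require the
  value \<open>0\<close> whenever an argument is not smooth, so that equality of functions
  is equality of connections.\<close>

definition affine_connection :: "('n::finite) connection \<Rightarrow> bool" where
  "affine_connection nab \<longleftrightarrow>
     (\<forall>X Y. smooth X \<and> smooth Y \<longrightarrow> smooth (nab X Y)) \<and>
     (\<forall>X X' Y. smooth X \<and> smooth X' \<and> smooth Y \<longrightarrow>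
        nab (\<lambda>p. X p + X' p) Y = (\<lambda>p. nab X Y p + nab X' Y p)) \<and>
     (\<forall>f X Y. smooth f \<and> smooth X \<and> smooth Y \<longrightarrow>
        nab (\<lambda>p. f p *\<^sub>R X p) Y = (\<lambda>p. f p *\<^sub>R nab X Y p)) \<and>
     (\<forall>X Y Y'. smooth X \<and> smooth Y \<and> smooth Y' \<longrightarrow>
        nab X (\<lambda>p. Y p + Y' p) = (\<lambda>p. nab X Y p + nab X Y' p)) \<and>
     (\<forall>f X Y. smooth f \<and> smooth X \<and> smooth Y \<longrightarrow>
        nab X (\<lambda>p. f p *\<^sub>R Y p) = (\<lambda>p. dir_deriv X f p *\<^sub>R Y p + f p *\<^sub>R nab X Y p)) \<and>
     (\<forall>X Y. \<not> (smooth X \<and> smooth Y) \<longrightarrow> nab X Y = (\<lambda>p. 0))"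

definition torsion_free :: "('n::finite) connection \<Rightarrow> bool" where
  "torsion_free nab \<longleftrightarrow> (\<forall>X Y. smooth X \<and> smooth Y \<longrightarrow>
     (\<forall>p. nab X Y p - nab Y X p = lie_bracket X Y p))"

definition curvature :: "('n::finite) connection \<Rightarrow> 'n vfield \<Rightarrow> 'n vfield \<Rightarrow> 'n vfield \<Rightarrow> 'n vfield" where
  "curvature nab X Y Z =
     (\<lambda>p. nab X (nab Y Z) p - nab Y (nab X Z) p - nab (lie_bracket X Y) Z p)"

definition metric_apply :: "('n::finite) metric \<Rightarrow> 'n vfield \<Rightarrow> 'n vfield \<Rightarrow> real^'n \<Rightarrow> real" where
  "metric_apply g X Y = (\<lambda>p. g p (X p) (Y p))"

definition cubic_form :: "('n::finite) metric \<Rightarrow> 'n connection \<Rightarrow>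
    'n vfield \<Rightarrow> 'n vfield \<Rightarrow> 'n vfield \<Rightarrow> real^'n \<Rightarrow> real" where
  "cubic_form g nab X Y Z = (\<lambda>p. dir_deriv X (metric_apply g Y Z) p
     - metric_apply g (nab X Y) Z p - metric_apply g Y (nab X Z) p)"

section \<open>Statistical structures\<close>

definition statistical_structure :: "('n::finite) metric \<Rightarrow> 'n connection \<Rightarrow> bool" where
  "statistical_structure g nab \<longleftrightarrow>
     riemannian_metric g \<and> affine_connection nab \<and> torsion_free nab \<and>
     (\<forall>X Y Z. smooth X \<and> smooth Y \<and> smooth Z \<longrightarrow>
        cubic_form g nab X Y Z = cubic_form g nab Y X Z \<and>
        cubic_form g nab X Y Z = cubic_form g nab X Z Y)"

definition dual_connection :: "('n::finite) metric \<Rightarrow> 'n connection \<Rightarrow> 'n connection" where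
  "dual_connection g nab = (THE nab'. affine_connection nab' \<and>
     (\<forall>X Y Z. smooth X \<and> smooth Y \<and> smooth Z \<longrightarrow>
        (\<forall>p. dir_deriv X (metric_apply g Y Z) p =
           metric_apply g (nab X Y) Z p + metric_apply g Y (nab' X Z) p)))"

definition conjugate_symmetric :: "('n::finite) metric \<Rightarrow> 'n connection \<Rightarrow> bool" where
  "conjugate_symmetric g nab \<longleftrightarrow> (\<forall>X Y Z. smooth X \<and> smooth Y \<and> smooth Z \<longrightarrow>
     curvature nab X Y Z = curvature (dual_connection g nab) X Y Z)"

definition dually_flat :: "('n::finite) metric \<Rightarrow> 'n connection \<Rightarrow> bool" where
  "dually_flat g nab \<longleftrightarrow> (\<forall>X Y Z. smooth X \<and> smooth Y \<and> smooth Z \<longrightarrow>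
     curvature nab X Y Z = (\<lambda>p. 0))"

section \<open>Left-invariant statistical structures and their moduli spaces\<close>

definition pullback_metric :: "('n::finite) vfield \<Rightarrow> 'n metric \<Rightarrow> 'n metric" where
  "pullback_metric \<phi> g = (\<lambda>p u v. g (\<phi> p) (frechet_derivative \<phi> (at p) u) (frechet_derivative \<phi> (at p) v))"

definition pullback_connection :: "('n::finite) vfield \<Rightarrow> 'n connection \<Rightarrow> 'n connection" where
  "pullback_connection \<phi> nab =
     (\<lambda>X Y. pushforward (inv \<phi>) (nab (pushforward \<phi> X) (pushforward \<phi> Y)))"

definition left_invariant_metric :: "('n::finite) metric \<Rightarrow> bool" where
  "left_invariant_metric g \<longleftrightarrow> (\<forall>a. pullback_metric (\<lambda>p. a + p) g = g)"

definition left_invariant_connection :: "('n::finite) connection \<Rightarrow> bool" where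
  "left_invariant_connection nab \<longleftrightarrow> (\<forall>a. pullback_connection (\<lambda>p. a + p) nab = nab)"

definition LStat :: "(('n::finite) metric \<times> 'n connection) set" where
  "LStat = {(g, nab). statistical_structure g nab \<and>
     left_invariant_metric g \<and> left_invariant_connection nab}"

type_synonym 'n tensor2 = "real^'n \<Rightarrow> real^'n \<Rightarrow> real"
type_synonym 'n tensor3 = "real^'n \<Rightarrow> real^'n \<Rightarrow> real^'n \<Rightarrow> real"

definition lstat_coords :: "('n::finite) metric \<times> 'n connection \<Rightarrow> 'n tensor2 \<times> 'n tensor3" where
  "lstat_coords = (\<lambda>(g, nab).
     (g 0, \<lambda>u v w. cubic_form g nab (\<lambda>_. u) (\<lambda>_. v) (\<lambda>_. w) 0))"

text \<open>The function types \<open>tensor2\<close> and \<open>tensor3\<close> carry the topology of pointwise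
  convergence. On the finite-dimensional spaces of bilinear and trilinear maps it induces the
  usual vector space topology.\<close>

definition LStat_topology :: "(('n::finite) metric \<times> 'n connection) topology" where
  "LStat_topology = pullback_topology LStat lstat_coords euclidean"

text \<open>The finest topology on the image of \<open>X\<close> under \<open>f\<close> that makes \<open>f\<close> continuous.\<close>

definition quotient_topology :: "'a topology \<Rightarrow> ('a \<Rightarrow> 'b) \<Rightarrow> 'b topology" where
  "quotient_topology X f =
     topology (\<lambda>U. U \<subseteq> f ` topspace X \<and> openin X {x \<in> topspace X. f x \<in> U})"

lemma openin_quotient_topology:
  "openin (quotient_topology X f) U \<longleftrightarrow>
     U \<subseteq> f ` topspace X \<and> openin X {x \<in> topspace X. f x \<in> U}"
proof -
  have "istopology (\<lambda>U. U \<subseteq> f ` topspace X \<and> openin X {x \<in> topspace X. f x \<in> U})"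
    unfolding istopology_def
  proof (intro conjI allI impI)
    fix S T
    assume "S \<subseteq> f ` topspace X \<and> openin X {x \<in> topspace X. f x \<in> S}"
      and "T \<subseteq> f ` topspace X \<and> openin X {x \<in> topspace X. f x \<in> T}"
    moreover have "{x \<in> topspace X. f x \<in> S \<inter> T} =
        {x \<in> topspace X. f x \<in> S} \<inter> {x \<in> topspace X. f x \<in> T}" by auto
    ultimately show "S \<inter> T \<subseteq> f ` topspace X" "openin X {x \<in> topspace X. f x \<in> S \<inter> T}"
      by auto
  next
    fix K
    assume K: "\<forall>S\<in>K. S \<subseteq> f ` topspace X \<and> openin X {x \<in> topspace X. f x \<in> S}"
    then show "\<Union> K \<subseteq> f ` topspace X" by auto
    have "{x \<in> topspace X. f x \<in> \<Union> K} = (\<Union>S\<in>K. {x \<in> topspace X. f x \<in> S})" by auto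
    with K show "openin X {x \<in> topspace X. f x \<in> \<Union> K}" by auto
  qed
  then show ?thesis by (simp add: quotient_topology_def)
qed

lemma topspace_quotient_topology: "topspace (quotient_topology X f) = f ` topspace X"
proof -
  have "{x \<in> topspace X. f x \<in> f ` topspace X} = topspace X" by auto
  then have "openin (quotient_topology X f) (f ` topspace X)"
    by (simp add: openin_quotient_topology)
  then show ?thesis
    using openin_subset openin_topspace openin_quotient_topology by (metis subset_antisym)
qed

lemma quotient_map_quotient_topology: "quotient_map X (quotient_topology X f) f"
  by (auto simp: quotient_map_def topspace_quotient_topology openin_quotient_topology)

definition Aut :: "('n::finite) vfield set" where
  "Aut = {\<phi>. bij \<phi> \<and> smooth \<phi> \<and> smooth (inv \<phi>) \<and> (\<forall>p q. \<phi> (p + q) = \<phi> p + \<phi> q)}"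

definition act :: "real \<Rightarrow> ('n::finite) vfield \<Rightarrow>
    'n metric \<times> 'n connection \<Rightarrow> 'n metric \<times> 'n connection" where
  "act r \<phi> = (\<lambda>(g, nab). ((\<lambda>p u v. r * pullback_metric (inv \<phi>) g p u v),
     pullback_connection (inv \<phi>) nab))"

definition lstat_orbit :: "('n::finite) metric \<times> 'n connection \<Rightarrow> ('n metric \<times> 'n connection) set" where
  "lstat_orbit s = {act r \<phi> s |r \<phi>. r > 0 \<and> \<phi> \<in> Aut}"

definition LStat_DF :: "(('n::finite) metric \<times> 'n connection) set" where
  "LStat_DF = {(g, nab) \<in> LStat. dually_flat g nab}"

definition LStat_DF_topology :: "(('n::finite) metric \<times> 'n connection) topology" where
  "LStat_DF_topology = subtopology LStat_topology LStat_DF"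

definition MLStat_DF :: "(('n::finite) metric \<times> 'n connection) set topology" where
  "MLStat_DF = quotient_topology LStat_DF_topology lstat_orbit"

section \<open>Symmetric 3-tensors and sets of representatives\<close>

definition Sym3 :: "('n::finite) tensor3 set" where
  "Sym3 = {C. (\<forall>v w. linear (\<lambda>u. C u v w)) \<and>
     (\<forall>u v w. C u v w = C v u w \<and> C u v w = C u w v)}"

definition sym_product :: "('v \<Rightarrow> real) list \<Rightarrow> 'v list \<Rightarrow> real" where
  "sym_product xs vs = (1 / fact (length xs)) *
     (\<Sum>\<sigma> | \<sigma> permutes {..<length xs}. \<Prod>i<length xs. (xs ! \<sigma> i) (vs ! i))"

definition cube :: "(real^('n::finite) \<Rightarrow> real) \<Rightarrow> 'n tensor3" where
  "cube x = (\<lambda>u v w. sym_product [x, x, x] [u, v, w])"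

definition std_basis :: "'n \<Rightarrow> real^('n::finite)" where
  "std_basis i = axis i 1"

definition dual_basis :: "'n \<Rightarrow> real^('n::finite) \<Rightarrow> real" where
  "dual_basis i = (\<lambda>v. v $ i)"

text \<open>The index type \<open>'n\<close>, of cardinality \<open>n\<close>, is linearly ordered, so it is
  isomorphic to \<open>{1,\<dots>,n}\<close>.\<close>

definition V_plus :: "('n::{finite,linorder}) tensor3 set" where
  "V_plus = {(\<lambda>u v w. \<Sum>i\<in>UNIV. l i * cube (dual_basis i) u v w) |l.
     (\<forall>i j. i \<le> j \<longrightarrow> l i \<ge> l j) \<and> (\<forall>i. l i \<ge> 0)}"

text \<open>The connection with cubic form the left-invariant tensor field that is \<open>C\<close> at \<open>0\<close>.\<close>

definition connection_of :: "('n::finite) metric \<Rightarrow> 'n tensor3 \<Rightarrow> 'n connection" where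
  "connection_of g C = (THE nab. statistical_structure g nab \<and>
     (\<forall>X Y Z. smooth X \<and> smooth Y \<and> smooth Z \<longrightarrow>
        cubic_form g nab X Y Z = (\<lambda>p. C (X p) (Y p) (Z p))))"

definition set_of_representatives_DF :: "('n::finite) metric \<Rightarrow> 'n tensor3 set \<Rightarrow> bool" where
  "set_of_representatives_DF g A \<longleftrightarrow> A \<subseteq> Sym3 \<and>
     (\<lambda>C. lstat_orbit (g, connection_of g C)) ` A = lstat_orbit ` LStat_DF"

definition scaling_orbit :: "('n::finite) tensor3 \<Rightarrow> 'n tensor3 set" where
  "scaling_orbit C = {(\<lambda>u v w. r * C u v w) |r. r > 0}"

end

theory Submission
  imports Defs
begin

text \<open>
  An invariant metric on \<open>\<real>\<^sup>n\<close> is constant, and an invariant torsion-free connection is the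
  directional derivative plus a constant symmetric bilinear product \<open>G\<close>. Total symmetry of the cubic
  form says that every multiplication \<open>G u\<close> is self-adjoint for the inner product \<open>b\<close>, and the cubic
  form is then \<open>C(u, v, w) = -2 b(G(u, v), w)\<close>; so invariant statistical structures are pairs \<open>(b, G)\<close>
  (\<open>LStat_eq\<close>). As second derivatives are symmetric, the curvature is the commutator
  \<open>[G u, G v]\<close> (\<open>curvature_const\<close>). It is quadratic in \<open>G\<close>, and the dual connection belongs to \<open>-G\<close>,
  so every such structure is conjugate symmetric. Dual flatness means that the self-adjoint
  operators \<open>G u\<close> commute.

  For commuting operators there is a simultaneous orthonormal eigenframe in which \<open>C\<close> is the diagonal form
  \<open>\<Sum>i. l\<^sub>i x\<^sub>i\<^sup>3\<close> with \<open>l\<^sub>1 \<ge> ... \<ge> l\<^sub>n \<ge> 0\<close> (\<open>normal_form_exists\<close>). The frame is built by maximising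
  \<open>C(u, u, u)\<close> over unit vectors, splitting off the maximum point, and repeating in its orthogonal complement
  (\<open>maximum_splits_off\<close>); this yields the order and the signs of the coefficients directly.
  The coefficients depend only on \<open>(b, C)\<close> (\<open>normal_form_unique\<close>). An automorphism transports frames and
  so preserves the coefficients, and rescaling the metric by \<open>r\<close> multiplies all of them by \<open>1 / sqrt r\<close>. Hence
  two dually flat structures are equivalent exactly if their coefficient vectors are positive multiples of each
  other (\<open>lstat_orbit_eq_iff\<close>), which shows that \<open>V_plus\<close> is a set of representatives.

  For the homeomorphism it remains to see that the coefficients are continuous in \<open>(b, C)\<close>
  (\<open>cubic_coeffs_continuous\<close>): normalising frames stay bounded, and uniqueness identifies the
  limit of every convergent subsequence. The coefficient map and the map from \<open>V_plus\<close> to standard structures then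
  descend to mutually inverse maps of the orbit spaces. Strictly decreasing positive coefficients with
  fixed largest one form an \<open>(n - 1)\<close>-parameter family, whose parameters are recovered continuously from the
  ratios of the coefficients, so it embeds in the moduli space.
\<close>

section \<open>Calculus of smooth maps\<close>

lemma frechet_derivativeI:
  "(f has_derivative f') (at x) \<Longrightarrow> frechet_derivative f (at x) = f'"
  using frechet_derivative_at by metis

lemma C_k_Suc_imp: "C_k (Suc k) f \<Longrightarrow> C_k k f"
proof (induction k arbitrary: f)
  case 0
  then show ?case
    by (auto intro!: continuous_at_imp_continuous_on simp: differentiable_imp_continuous_within)
next
  case (Suc k)
  then show ?case by auto
qed

lemma C_k_const: "C_k k (\<lambda>x. c)"
proof (induction k arbitrary: c)
  case (Suc k)
  then show ?case by simp
qed simp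

lemma C_k_add:
  assumes "C_k k f" "C_k k g" shows "C_k k (\<lambda>x. f x + g x)"
  using assms
proof (induction k arbitrary: f g)
  case 0
  then show ?case by (auto intro!: continuous_intros)
next
  case (Suc k)
  have "frechet_derivative (\<lambda>x. f x + g x) (at x) =
      (\<lambda>v. frechet_derivative f (at x) v + frechet_derivative g (at x) v)" for x
    using Suc.prems by (intro frechet_derivativeI has_derivative_add) (auto simp: frechet_derivative_works)
  with Suc show ?case by auto
qed

lemma C_k_bilinear:
  assumes h: "bounded_bilinear h" and "C_k k f" "C_k k g"
  shows "C_k k (\<lambda>x. h (f x) (g x))"
  using assms(2,3)
proof (induction k arbitrary: f g)
  case 0
  then show ?case by (auto intro!: bounded_bilinear.continuous_on[OF h])
next
  case (Suc k)
  have D: "((\<lambda>x. h (f x) (g x)) has_derivative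
      (\<lambda>v. h (f x) (frechet_derivative g (at x) v) + h (frechet_derivative f (at x) v) (g x))) (at x)" for x
    using Suc.prems by (intro bounded_bilinear.FDERIV[OF h]) (auto simp: frechet_derivative_works)
  have "C_k k f" "C_k k g" using Suc.prems by (auto intro: C_k_Suc_imp)
  then show ?case
    using Suc by (auto simp: frechet_derivativeI[OF D] intro: differentiableI[OF D] intro!: C_k_add)
qed

lemma C_k_linear:
  assumes h: "bounded_linear h" and "C_k k f" shows "C_k k (\<lambda>x. h (f x))"
  using assms(2)
proof (induction k arbitrary: f)
  case 0
  then show ?case by (auto intro!: bounded_linear.continuous_on[OF h])
next
  case (Suc k)
  have D: "((\<lambda>x. h (f x)) has_derivative (\<lambda>v. h (frechet_derivative f (at x) v))) (at x)" for x
    using Suc.prems by (intro bounded_linear.has_derivative[OF h]) (auto simp: frechet_derivative_works)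
  show ?case using Suc by (auto simp: frechet_derivativeI[OF D] intro: differentiableI[OF D])
qed

lemma has_derivative_affine_precompose:
  assumes L: "linear L" and f: "f differentiable (at (L x + a))"
  shows "((\<lambda>x. f (L x + a)) has_derivative (\<lambda>v. frechet_derivative f (at (L x + a)) (L v))) (at (x::'a::euclidean_space))"
proof -
  have "((\<lambda>x. L x + a) has_derivative L) (at x)"
    using L by (auto intro!: derivative_eq_intros linear_imp_has_derivative)
  from has_derivative_compose[OF this f[unfolded frechet_derivative_works]] show ?thesis .
qed

lemma C_k_affine_precompose:
  fixes f :: "'b::euclidean_space \<Rightarrow> 'c::real_normed_vector" and L :: "'a::euclidean_space \<Rightarrow> 'b"
  assumes L: "linear L" and "C_k k f" shows "C_k k (\<lambda>x. f (L x + a))"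
  using assms(2)
proof (induction k arbitrary: f)
  case 0
  have "continuous_on UNIV (\<lambda>x. L x + a)"
    using L linear_continuous_on[of L UNIV] continuous_on_add[OF _ continuous_on_const]
    by (auto simp: linear_conv_bounded_linear)
  with 0 show ?case by (auto intro: continuous_on_compose2)
next
  case (Suc k)
  have D: "((\<lambda>x. f (L x + a)) has_derivative (\<lambda>v. frechet_derivative f (at (L x + a)) (L v))) (at x)" for x
    using Suc.prems by (intro has_derivative_affine_precompose L) auto
  show ?case
    using Suc.prems Suc.IH[of "\<lambda>y. frechet_derivative f (at y) (L v)" for v]
    by (auto simp: frechet_derivativeI[OF D] intro: differentiableI[OF D])
qed

lemma smooth_const [simp]: "smooth (\<lambda>x. c)"
  by (simp add: smooth_def C_k_const)

lemma smooth_add: "smooth f \<Longrightarrow> smooth g \<Longrightarrow> smooth (\<lambda>x. f x + g x)"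
  by (simp add: smooth_def C_k_add)

lemma smooth_sum: "(\<And>i. i \<in> I \<Longrightarrow> smooth (f i)) \<Longrightarrow> smooth (\<lambda>x. \<Sum>i\<in>I. f i x)"
  by (induction I rule: infinite_finite_induct) (simp_all add: smooth_add)

lemma smooth_bilinear: "bounded_bilinear h \<Longrightarrow> smooth f \<Longrightarrow> smooth g \<Longrightarrow> smooth (\<lambda>x. h (f x) (g x))"
  by (simp add: smooth_def C_k_bilinear)

lemma smooth_linear: "bounded_linear h \<Longrightarrow> smooth f \<Longrightarrow> smooth (\<lambda>x. h (f x))"
  by (simp add: smooth_def C_k_linear)

lemma smooth_scaleR: "smooth f \<Longrightarrow> smooth g \<Longrightarrow> smooth (\<lambda>x. f x *\<^sub>R g x)"
  by (rule smooth_bilinear[OF bounded_bilinear_scaleR])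

lemma smooth_diff: "smooth f \<Longrightarrow> smooth g \<Longrightarrow> smooth (\<lambda>x. f x - g x)"
  using smooth_add[of f "\<lambda>x. - g x"] smooth_linear[OF bounded_linear_minus[OF bounded_linear_ident], of g]
  by simp

lemma smooth_affine_precompose: "linear L \<Longrightarrow> smooth f \<Longrightarrow> smooth (\<lambda>x. f (L x + a))"
  by (simp add: smooth_def C_k_affine_precompose)

lemma smooth_component: "smooth X \<Longrightarrow> smooth (\<lambda>x. (X x :: real^'n::finite) $ i)"
  by (rule smooth_linear[OF bounded_linear_vec_nth])

lemma smooth_differentiable: "smooth f \<Longrightarrow> f differentiable (at x)"
  unfolding smooth_def by (metis C_k.simps(2))

lemma smooth_has_derivative: "smooth f \<Longrightarrow> (f has_derivative frechet_derivative f (at x)) (at x)"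
  using smooth_differentiable frechet_derivative_works by blast

lemma smooth_frechet_derivative: "smooth f \<Longrightarrow> smooth (\<lambda>x. frechet_derivative f (at x) v)"
  unfolding smooth_def by (metis C_k.simps(2))

lemma linear_smooth_derivative: "smooth f \<Longrightarrow> linear (frechet_derivative f (at x))"
  by (simp add: linear_frechet_derivative smooth_differentiable)

lemma smooth_of_linear: "linear L \<Longrightarrow> smooth (L :: 'a::euclidean_space \<Rightarrow> 'b::euclidean_space)"
proof -
  assume L: "linear L"
  have "C_k k L" for k
  proof (cases k)
    case 0
    then show ?thesis using L by (simp add: linear_continuous_on linear_conv_bounded_linear)
  next
    case (Suc m)
    have D: "(L has_derivative L) (at x)" for x by (rule linear_imp_has_derivative[OF L])
    show ?thesis using Suc differentiableI[OF D] by (simp add: frechet_derivativeI[OF D] C_k_const)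
  qed
  then show ?thesis by (simp add: smooth_def)
qed

lemma vec_expansion: "(v :: real^'n::finite) = (\<Sum>i\<in>UNIV. (v $ i) *\<^sub>R axis i 1)"
  using basis_expansion[of v] by (simp add: scalar_mult_eq_scaleR)

lemma smooth_dir_deriv:
  assumes X: "smooth X" and f: "smooth f" shows "smooth (dir_deriv X f)"
proof -
  have "dir_deriv X f = (\<lambda>p. \<Sum>i\<in>UNIV. (X p $ i) *\<^sub>R frechet_derivative f (at p) (axis i 1))"
  proof
    fix p
    have "frechet_derivative f (at p) (X p) =
        frechet_derivative f (at p) (\<Sum>i\<in>UNIV. (X p $ i) *\<^sub>R axis i 1)"
      by (metis vec_expansion)
    then show "dir_deriv X f p = (\<Sum>i\<in>UNIV. (X p $ i) *\<^sub>R frechet_derivative f (at p) (axis i 1))"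
      using linear_smooth_derivative[OF f] by (simp add: dir_deriv_def linear_sum linear_cmul)
  qed
  then show ?thesis
    using assms by (auto intro!: smooth_sum smooth_scaleR smooth_component smooth_frechet_derivative)
qed

lemma dir_deriv_const [simp]: "dir_deriv X (\<lambda>p. c) = (\<lambda>p. 0)"
  by (simp add: dir_deriv_def)

lemma dir_deriv_add:
  "smooth f \<Longrightarrow> smooth g \<Longrightarrow> dir_deriv X (\<lambda>p. f p + g p) p = dir_deriv X f p + dir_deriv X g p"
  unfolding dir_deriv_def
  by (subst frechet_derivativeI[OF has_derivative_add[OF smooth_has_derivative smooth_has_derivative]]) auto

lemma dir_deriv_bilinear:
  assumes h: "bounded_bilinear h" and "smooth f" "smooth g"
  shows "dir_deriv X (\<lambda>p. h (f p) (g p)) p = h (f p) (dir_deriv X g p) + h (dir_deriv X f p) (g p)"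
  unfolding dir_deriv_def
  by (subst frechet_derivativeI[OF bounded_bilinear.FDERIV[OF h smooth_has_derivative smooth_has_derivative]])
    (use assms in auto)

lemma dir_deriv_linear:
  assumes h: "bounded_linear h" and "smooth f"
  shows "dir_deriv X (\<lambda>p. h (f p)) p = h (dir_deriv X f p)"
  unfolding dir_deriv_def
  by (subst frechet_derivativeI[OF bounded_linear.has_derivative[OF h smooth_has_derivative]])
    (use assms in auto)

lemma dir_deriv_scaleR:
  "smooth f \<Longrightarrow> smooth Y \<Longrightarrow>
    dir_deriv X (\<lambda>p. f p *\<^sub>R Y p) p = dir_deriv X f p *\<^sub>R Y p + f p *\<^sub>R dir_deriv X Y p"
  using dir_deriv_bilinear[OF bounded_bilinear_scaleR, of f Y X p] by simp

lemma dir_deriv_add_left: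
  "smooth f \<Longrightarrow> dir_deriv (\<lambda>p. X p + Y p) f p = dir_deriv X f p + dir_deriv Y f p"
  by (simp add: dir_deriv_def linear_add[OF linear_smooth_derivative])

lemma dir_deriv_scale_left:
  "smooth f \<Longrightarrow> dir_deriv (\<lambda>p. c p *\<^sub>R X p) f p = c p *\<^sub>R dir_deriv X f p"
  by (simp add: dir_deriv_def linear_cmul[OF linear_smooth_derivative])

lemma bilinear_bounded:
  "bilinear h \<Longrightarrow> bounded_bilinear (h :: 'a::euclidean_space \<Rightarrow> 'b::euclidean_space \<Rightarrow> 'c::real_normed_vector)"
  by (simp add: bilinear_conv_bounded_bilinear)

lemma line_derivative:
  fixes f :: "'a::euclidean_space \<Rightarrow> real"
  assumes "smooth f"
  shows "((\<lambda>r. f (q + r *\<^sub>R u)) has_real_derivative frechet_derivative f (at (q + r *\<^sub>R u)) u) (at r)"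
proof -
  have L: "linear (\<lambda>r::real. r *\<^sub>R u)" by (auto intro!: linearI simp: algebra_simps)
  have "((\<lambda>r. f (r *\<^sub>R u + q)) has_derivative
      (\<lambda>v. frechet_derivative f (at (r *\<^sub>R u + q)) (v *\<^sub>R u))) (at r)"
    by (rule has_derivative_affine_precompose[OF L smooth_differentiable[OF assms]])
  moreover have "frechet_derivative f (at (r *\<^sub>R u + q)) (v *\<^sub>R u) = frechet_derivative f (at (q + r *\<^sub>R u)) u * v" for v
    by (simp add: linear_cmul[OF linear_smooth_derivative[OF assms]] add.commute)
  ultimately show ?thesis by (simp add: has_field_derivative_def add.commute)
qed

text \<open>Two applications of the mean value theorem write the second difference as \<open>h\<^sup>2\<close> times the mixed second
  derivative, in one order, at a point near \<open>p\<close>. The difference itself is symmetric in \<open>u\<close> and \<open>v\<close>, so its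
  limit does not depend on the order of differentiation.\<close>

lemma second_difference_tendsto:
  fixes f :: "'a::euclidean_space \<Rightarrow> real"
  assumes f: "smooth f"
  shows "((\<lambda>h. (f (p + h *\<^sub>R u + h *\<^sub>R v) - f (p + h *\<^sub>R u) - f (p + h *\<^sub>R v) + f p) / h\<^sup>2) \<longlongrightarrow>
    frechet_derivative (\<lambda>x. frechet_derivative f (at x) u) (at p) v) (at_right 0)"
proof -
  define Fu where "Fu = (\<lambda>x. frechet_derivative f (at x) u)"
  define Fuv where "Fuv = (\<lambda>x. frechet_derivative Fu (at x) v)"
  have sFu: "smooth Fu" unfolding Fu_def by (rule smooth_frechet_derivative[OF f])
  have "smooth Fuv" unfolding Fuv_def by (rule smooth_frechet_derivative[OF sFu])
  then have cont: "isCont Fuv p" using differentiable_imp_continuous_within smooth_differentiable by blast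
  have mvt: "\<exists>a b. 0 < a \<and> a < h \<and> 0 < b \<and> b < h \<and>
      f (p + h *\<^sub>R u + h *\<^sub>R v) - f (p + h *\<^sub>R u) - f (p + h *\<^sub>R v) + f p =
      h\<^sup>2 * Fuv (p + a *\<^sub>R u + b *\<^sub>R v)" if h: "h > 0" for h
  proof -
    have D: "((\<lambda>r. f ((p + h *\<^sub>R v) + r *\<^sub>R u) - f (p + r *\<^sub>R u)) has_real_derivative
        Fu ((p + h *\<^sub>R v) + r *\<^sub>R u) - Fu (p + r *\<^sub>R u)) (at r)" for r
      unfolding Fu_def by (intro DERIV_diff line_derivative f)
    obtain a where a: "0 < a" "a < h" "(f ((p + h *\<^sub>R v) + h *\<^sub>R u) - f (p + h *\<^sub>R u))
       - (f ((p + h *\<^sub>R v) + 0 *\<^sub>R u) - f (p + 0 *\<^sub>R u)) =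
        (h - 0) * (Fu ((p + h *\<^sub>R v) + a *\<^sub>R u) - Fu (p + a *\<^sub>R u))"
      using MVT2[OF h D] by blast
    have D2: "((\<lambda>r. Fu ((p + a *\<^sub>R u) + r *\<^sub>R v)) has_real_derivative Fuv ((p + a *\<^sub>R u) + r *\<^sub>R v)) (at r)" for r
      unfolding Fuv_def by (intro line_derivative sFu)
    obtain b where b: "0 < b" "b < h" "Fu ((p + a *\<^sub>R u) + h *\<^sub>R v) - Fu ((p + a *\<^sub>R u) + 0 *\<^sub>R v) =
        (h - 0) * Fuv ((p + a *\<^sub>R u) + b *\<^sub>R v)"
      using MVT2[OF h D2] by blast
    have "f (p + h *\<^sub>R u + h *\<^sub>R v) - f (p + h *\<^sub>R u) - f (p + h *\<^sub>R v) + f p =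
       h * (Fu ((p + a *\<^sub>R u) + h *\<^sub>R v) - Fu (p + a *\<^sub>R u))"
      using a(3) by (simp add: add_ac)
    also have "\<dots> = h\<^sup>2 * Fuv (p + a *\<^sub>R u + b *\<^sub>R v)" using b(3) by (simp add: power2_eq_square)
    finally show ?thesis using a b by blast
  qed
  have "((\<lambda>h. (f (p + h *\<^sub>R u + h *\<^sub>R v) - f (p + h *\<^sub>R u) - f (p + h *\<^sub>R v) + f p) / h\<^sup>2) \<longlongrightarrow> Fuv p) (at_right 0)"
  proof (rule tendstoI)
    fix e :: real assume "e > 0"
    then obtain d where d: "d > 0" "\<And>x. dist x p < d \<Longrightarrow> dist (Fuv x) (Fuv p) < e"
      using cont unfolding continuous_at_eps_delta by blast
    define N where "N = norm u + norm v + 1"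
    have N: "N > 0" unfolding N_def by (simp add: add_nonneg_pos)
    have "eventually (\<lambda>h. h \<in> {0<..<d / N}) (at_right 0)"
      by (rule eventually_at_right_real) (use d N in auto)
    then show "\<forall>\<^sub>F h in at_right 0. dist ((f (p + h *\<^sub>R u + h *\<^sub>R v) - f (p + h *\<^sub>R u) - f (p + h *\<^sub>R v) + f p) / h\<^sup>2) (Fuv p) < e"
    proof (rule eventually_mono)
      fix h assume h: "h \<in> {0<..<d / N}"
      then obtain a b where ab: "0 < a" "a < h" "0 < b" "b < h"
        "f (p + h *\<^sub>R u + h *\<^sub>R v) - f (p + h *\<^sub>R u) - f (p + h *\<^sub>R v) + f p = h\<^sup>2 * Fuv (p + a *\<^sub>R u + b *\<^sub>R v)"
        using mvt[of h] by auto
      have "dist (p + a *\<^sub>R u + b *\<^sub>R v) p = norm (a *\<^sub>R u + b *\<^sub>R v)" by (simp add: dist_norm)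
      also have "\<dots> \<le> a * norm u + b * norm v" using ab norm_triangle_ineq[of "a *\<^sub>R u" "b *\<^sub>R v"] by simp
      also have "\<dots> \<le> h * norm u + h * norm v" using ab by (intro add_mono mult_right_mono) auto
      also have "\<dots> < h * N" using h by (auto simp: N_def algebra_simps)
      also have "\<dots> < d" using h N by (simp add: pos_less_divide_eq)
      finally have "dist (Fuv (p + a *\<^sub>R u + b *\<^sub>R v)) (Fuv p) < e" by (rule d(2))
      then show "dist ((f (p + h *\<^sub>R u + h *\<^sub>R v) - f (p + h *\<^sub>R u) - f (p + h *\<^sub>R v) + f p) / h\<^sup>2) (Fuv p) < e"
        using ab h by simp
    qed
  qed
  then show ?thesis by (simp add: Fuv_def Fu_def)
qed

lemma second_derivative_symmetric_real:
  fixes f :: "'a::euclidean_space \<Rightarrow> real"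
  assumes f: "smooth f"
  shows "frechet_derivative (\<lambda>x. frechet_derivative f (at x) u) (at p) v =
    frechet_derivative (\<lambda>x. frechet_derivative f (at x) v) (at p) u"
proof (rule tendsto_unique[OF trivial_limit_at_right_real second_difference_tendsto[OF f]])
  show "((\<lambda>h. (f (p + h *\<^sub>R u + h *\<^sub>R v) - f (p + h *\<^sub>R u) - f (p + h *\<^sub>R v) + f p) / h\<^sup>2) \<longlongrightarrow>
    frechet_derivative (\<lambda>x. frechet_derivative f (at x) v) (at p) u) (at_right 0)"
    using second_difference_tendsto[OF f, of p v u] by (simp add: add_ac diff_diff_eq)
qed

lemma second_derivative_symmetric:
  fixes f :: "'a::euclidean_space \<Rightarrow> 'b::euclidean_space"
  assumes f: "smooth f"
  shows "frechet_derivative (\<lambda>x. frechet_derivative f (at x) u) (at p) v =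
    frechet_derivative (\<lambda>x. frechet_derivative f (at x) v) (at p) u"
proof (rule euclidean_eqI)
  fix w :: 'b
  have D: "frechet_derivative (\<lambda>x. g x \<bullet> w) (at x) = (\<lambda>v. frechet_derivative g (at x) v \<bullet> w)"
    if "smooth g" for g :: "'a \<Rightarrow> 'b" and x
    by (intro frechet_derivativeI bounded_linear.has_derivative[OF bounded_linear_inner_left]
        smooth_has_derivative that)
  have "smooth (\<lambda>x. f x \<bullet> w)" by (rule smooth_linear[OF bounded_linear_inner_left f])
  from second_derivative_symmetric_real[OF this, of u p v]
  show "frechet_derivative (\<lambda>x. frechet_derivative f (at x) u) (at p) v \<bullet> w =
    frechet_derivative (\<lambda>x. frechet_derivative f (at x) v) (at p) u \<bullet> w"
    by (simp add: D f smooth_frechet_derivative)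
qed

text \<open>Differentiating \<open>D\<^sub>Y Z = DZ(Y)\<close> along \<open>X\<close> gives \<open>DZ(D\<^sub>X Y)\<close> and a second derivative of \<open>Z\<close>
  that is symmetric in \<open>X\<close> and \<open>Y\<close> and cancels in the commutator.\<close>

lemma dir_deriv_commutator:
  fixes Z :: "real^'n::finite \<Rightarrow> 'b::euclidean_space"
  assumes "smooth X" "smooth Y" and Z: "smooth Z"
  shows "dir_deriv X (dir_deriv Y Z) p - dir_deriv Y (dir_deriv X Z) p = dir_deriv (lie_bracket X Y) Z p"
proof -
  define D where "D = (\<lambda>x. frechet_derivative Z (at x))"
  have lin: "linear (D x)" for x unfolding D_def by (rule linear_smooth_derivative[OF Z])
  have expand: "dir_deriv A Z = (\<lambda>p. \<Sum>i\<in>UNIV. (A p $ i) *\<^sub>R D p (axis i 1))" for A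
  proof
    fix x
    have "D x (A x) = D x (\<Sum>i\<in>UNIV. (A x $ i) *\<^sub>R axis i 1)" by (metis vec_expansion)
    also have "\<dots> = (\<Sum>i\<in>UNIV. (A x $ i) *\<^sub>R D x (axis i 1))"
      by (simp add: linear_sum[OF lin] linear_cmul[OF lin])
    finally show "dir_deriv A Z x = (\<Sum>i\<in>UNIV. (A x $ i) *\<^sub>R D x (axis i 1))"
      by (simp add: dir_deriv_def D_def)
  qed
  have second: "dir_deriv A (dir_deriv B Z) p =
     D p (dir_deriv A B p) + frechet_derivative (\<lambda>x. D x (B p)) (at p) (A p)"
    if A: "smooth A" and B: "smooth B" for A B
  proof -
    have sD: "smooth (\<lambda>x. D x v)" for v unfolding D_def by (rule smooth_frechet_derivative[OF Z])
    have Dp: "D p w = (\<Sum>i\<in>UNIV. (w $ i) *\<^sub>R D p (axis i 1))" for p w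
      using expand[of "\<lambda>_. w"] by (auto simp: dir_deriv_def D_def fun_eq_iff)
    have der: "((\<lambda>x. \<Sum>i\<in>UNIV. (B x $ i) *\<^sub>R D x (axis i 1)) has_derivative
       (\<lambda>v. \<Sum>i\<in>UNIV. (B p $ i) *\<^sub>R frechet_derivative (\<lambda>x. D x (axis i 1)) (at p) v +
         (frechet_derivative B (at p) v $ i) *\<^sub>R D p (axis i 1))) (at p)"
      by (intro has_derivative_sum bounded_bilinear.FDERIV[OF bounded_bilinear_scaleR]
          smooth_has_derivative sD bounded_linear.has_derivative[OF bounded_linear_vec_nth] B)
    have der2: "((\<lambda>x. \<Sum>i\<in>UNIV. (B p $ i) *\<^sub>R D x (axis i 1)) has_derivative
       (\<lambda>v. \<Sum>i\<in>UNIV. (B p $ i) *\<^sub>R frechet_derivative (\<lambda>x. D x (axis i 1)) (at p) v)) (at p)"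
      by (intro has_derivative_sum has_derivative_scaleR_right smooth_has_derivative sD)
    show ?thesis
      unfolding expand[of B] dir_deriv_def[of A]
      using frechet_derivativeI[OF der] frechet_derivativeI[OF der2]
      by (simp add: Dp[of _ "B p"] Dp[of _ "frechet_derivative B (at p) (A p)"] sum.distrib)
  qed
  have "dir_deriv X (dir_deriv Y Z) p - dir_deriv Y (dir_deriv X Z) p =
      D p (dir_deriv X Y p) - D p (dir_deriv Y X p)"
    using second_derivative_symmetric[OF Z, of "Y p" p "X p"]
    by (simp add: second assms D_def)
  also have "\<dots> = dir_deriv (lie_bracket X Y) Z p"
    by (simp add: dir_deriv_def lie_bracket_def linear_diff[OF lin, symmetric]) (simp add: D_def)
  finally show ?thesis .
qed

section \<open>Invariant connections and statistical structures\<close>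

definition const_connection :: "(real^'n \<Rightarrow> real^'n \<Rightarrow> real^'n) \<Rightarrow> ('n::finite) connection" where
  "const_connection G = (\<lambda>X Y. if smooth X \<and> smooth Y
     then (\<lambda>p. dir_deriv X Y p + G (X p) (Y p)) else (\<lambda>p. 0))"

definition const_structure ::
    "(real^'n \<Rightarrow> real^'n \<Rightarrow> real) \<Rightarrow> (real^'n \<Rightarrow> real^'n \<Rightarrow> real^'n) \<Rightarrow> ('n::finite) metric \<times> 'n connection" where
  "const_structure b G = ((\<lambda>p. b), const_connection G)"

text \<open>With \<open>C(u, v, w) = -2 b(G(u, v), w)\<close>, symmetry of \<open>G\<close> and self-adjointness of its multiplications are
  total symmetry of \<open>C\<close>.\<close>

definition admissible ::
    "(real^'n \<Rightarrow> real^'n \<Rightarrow> real) \<Rightarrow> (real^('n::finite) \<Rightarrow> real^'n \<Rightarrow> real^'n) \<Rightarrow> bool" where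
  "admissible b G \<longleftrightarrow> inner_product b \<and> bilinear G \<and> (\<forall>u v. G u v = G v u) \<and>
     (\<forall>u v w. b (G u v) w = b v (G u w))"

definition flat_product :: "(real^('n::finite) \<Rightarrow> real^'n \<Rightarrow> real^'n) \<Rightarrow> bool" where
  "flat_product G \<longleftrightarrow> (\<forall>u v w. G u (G v w) = G v (G u w))"

lemma inner_product_simps:
  assumes "inner_product b"
  shows "b (u + v) w = b u w + b v w" "b u (v + w) = b u v + b u w"
    "b (c *\<^sub>R u) v = c * b u v" "b u (c *\<^sub>R v) = c * b u v"
    "b (u - v) w = b u w - b v w" "b u (v - w) = b u v - b u w"
    "b (- u) v = - b u v" "b u (- v) = - b u v" "b 0 v = 0" "b u 0 = 0"
  using assms unfolding inner_product_def
  by (auto simp: bilinear_ladd bilinear_radd bilinear_lmul bilinear_rmul bilinear_lsub bilinear_rsub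
      bilinear_lneg bilinear_rneg bilinear_lzero bilinear_rzero)

lemma inner_product_sum:
  assumes "inner_product b"
  shows "b (\<Sum>i\<in>I. f i) w = (\<Sum>i\<in>I. b (f i) w)" "b w (\<Sum>i\<in>I. f i) = (\<Sum>i\<in>I. b w (f i))"
  using assms unfolding inner_product_def bilinear_def by (auto simp: linear_sum)

lemma inner_product_eqI:
  assumes b: "inner_product b" and "\<And>w. b u w = b v w" shows "u = v"
proof (rule ccontr)
  assume "u \<noteq> v"
  then have "b (u - v) (u - v) > 0" using b by (auto simp: inner_product_def)
  with assms(2)[of "u - v"] show False by (simp add: inner_product_simps[OF b])
qed

lemma bilinear_simps:
  assumes "bilinear G"
  shows "G (u + v) w = G u w + G v w" "G u (v + w) = G u v + G u w"
    "G (c *\<^sub>R u) v = c *\<^sub>R G u v" "G u (c *\<^sub>R v) = c *\<^sub>R G u v"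
    "G (u - v) w = G u w - G v w" "G u (v - w) = G u v - G u w"
    "G (- u) v = - G u v" "G u (- v) = - G u v" "G 0 v = 0" "G u 0 = 0"
  using assms
  by (auto simp: bilinear_ladd bilinear_radd bilinear_lmul bilinear_rmul bilinear_lsub bilinear_rsub
      bilinear_lneg bilinear_rneg bilinear_lzero bilinear_rzero)

lemma bilinear_neg: "bilinear G \<Longrightarrow> bilinear (\<lambda>u v. - G u v)"
  unfolding bilinear_def by (auto simp: linear_compose_neg)

lemma smooth_bilinear_apply:
  fixes h :: "'a::euclidean_space \<Rightarrow> 'b::euclidean_space \<Rightarrow> 'c::real_normed_vector"
  shows "bilinear h \<Longrightarrow> smooth f \<Longrightarrow> smooth g \<Longrightarrow> smooth (\<lambda>p. h (f p) (g p))"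
  by (rule smooth_bilinear[OF bilinear_bounded])

lemma affine_const_connection:
  fixes G :: "real^'n \<Rightarrow> real^'n \<Rightarrow> real^('n::finite)"
  assumes G: "bilinear G" shows "affine_connection (const_connection G)"
  unfolding affine_connection_def
proof (intro conjI allI impI; (elim conjE)?)
  fix X X' Y Y' :: "'n vfield" and f :: "real^'n \<Rightarrow> real"
  assume X: "smooth X" and Y: "smooth Y"
  show "smooth (const_connection G X Y)"
    using X Y by (simp add: const_connection_def smooth_add smooth_dir_deriv smooth_bilinear_apply[OF G])
  show "const_connection G (\<lambda>p. X p + X' p) Y = (\<lambda>p. const_connection G X Y p + const_connection G X' Y p)"
    if "smooth X'"
    using X Y that by (auto simp: const_connection_def smooth_add dir_deriv_add_left bilinear_simps[OF G])
  show "const_connection G X (\<lambda>p. Y p + Y' p) = (\<lambda>p. const_connection G X Y p + const_connection G X Y' p)"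
    if "smooth Y'"
    using X Y that by (auto simp: const_connection_def smooth_add dir_deriv_add bilinear_simps[OF G])
  assume f: "smooth f"
  show "const_connection G (\<lambda>p. f p *\<^sub>R X p) Y = (\<lambda>p. f p *\<^sub>R const_connection G X Y p)"
    using X Y f by (simp add: const_connection_def smooth_scaleR dir_deriv_scale_left bilinear_simps[OF G] scaleR_add_right)
  show "const_connection G X (\<lambda>p. f p *\<^sub>R Y p) =
      (\<lambda>p. dir_deriv X f p *\<^sub>R Y p + f p *\<^sub>R const_connection G X Y p)"
    using X Y f by (simp add: const_connection_def smooth_scaleR dir_deriv_scaleR bilinear_simps[OF G] scaleR_add_right add.assoc)
next
  fix X Y :: "'n vfield"
  assume "\<not> (smooth X \<and> smooth Y)"
  then show "const_connection G X Y = (\<lambda>p. 0)" by (auto simp: const_connection_def)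
qed

lemma torsion_free_const_connection:
  "(\<And>u v. G u v = G v u) \<Longrightarrow> torsion_free (const_connection G)"
  by (auto simp: torsion_free_def const_connection_def lie_bracket_def)

lemma torsion_free_const_connectionD:
  assumes "torsion_free (const_connection G)" shows "G u v = G v u"
proof -
  have "const_connection G (\<lambda>_. u) (\<lambda>_. v) 0 - const_connection G (\<lambda>_. v) (\<lambda>_. u) 0 =
      lie_bracket (\<lambda>_. u) (\<lambda>_. v) 0"
    using assms unfolding torsion_free_def by (metis smooth_const)
  then show ?thesis by (simp add: const_connection_def lie_bracket_def)
qed

lemma cubic_form_const:
  assumes b: "inner_product b" and "smooth X" "smooth Y" "smooth Z"
  shows "cubic_form (\<lambda>p. b) (const_connection G) X Y Z p = - b (G (X p) (Y p)) (Z p) - b (Y p) (G (X p) (Z p))"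
proof -
  have "bounded_bilinear b" using b by (auto simp: inner_product_def bilinear_bounded)
  from dir_deriv_bilinear[OF this, of Y Z X p] show ?thesis
    using assms by (simp add: cubic_form_def metric_apply_def const_connection_def inner_product_simps[OF b])
qed

lemma riemannian_const: "riemannian_metric (\<lambda>p. b) \<longleftrightarrow> inner_product b"
  by (simp add: riemannian_metric_def)

lemma statistical_const_iff:
  fixes G :: "real^'n \<Rightarrow> real^'n \<Rightarrow> real^('n::finite)"
  assumes G: "bilinear G"
  shows "statistical_structure (\<lambda>p. b) (const_connection G) \<longleftrightarrow> admissible b G"
proof
  assume L: "statistical_structure (\<lambda>p. b) (const_connection G)"
  then have b: "inner_product b" and sym: "\<And>u v. G u v = G v u"
    by (auto simp: statistical_structure_def riemannian_const dest: torsion_free_const_connectionD)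
  have bsym: "b u v = b v u" for u v using b by (simp add: inner_product_def)
  have E: "b u (G w v) = b w (G u v)" for u v w
  proof -
    have "cubic_form (\<lambda>p. b) (const_connection G) (\<lambda>_. w) (\<lambda>_. u) (\<lambda>_. v) 0 =
        cubic_form (\<lambda>p. b) (const_connection G) (\<lambda>_. u) (\<lambda>_. w) (\<lambda>_. v) 0"
      using L unfolding statistical_structure_def by (metis smooth_const)
    then show ?thesis using sym[of w u] by (simp add: cubic_form_const[OF b])
  qed
  have "b (G u v) w = b v (G u w)" for u v w
    using E[of v w u] bsym[of "G u v" w] sym[of u v] sym[of u w] by metis
  then show "admissible b G" using b sym G by (simp add: admissible_def)
next
  assume R: "admissible b G"
  then have b: "inner_product b" and sym: "\<And>u v. G u v = G v u"
    and self: "\<And>u v w. b (G u v) w = b v (G u w)" by (auto simp: admissible_def)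
  have bsym: "b u v = b v u" for u v using b by (simp add: inner_product_def)
  show "statistical_structure (\<lambda>p. b) (const_connection G)"
    unfolding statistical_structure_def
  proof (intro conjI allI impI ext; (elim conjE)?)
    show "riemannian_metric (\<lambda>p. b)" using b by (simp add: riemannian_const)
    show "affine_connection (const_connection G)" by (rule affine_const_connection[OF G])
    show "torsion_free (const_connection G)" by (rule torsion_free_const_connection[OF sym])
    fix X Y Z :: "'n vfield" and p assume X: "smooth X" and Y: "smooth Y" and Z: "smooth Z"
    show "cubic_form (\<lambda>p. b) (const_connection G) X Y Z p = cubic_form (\<lambda>p. b) (const_connection G) Y X Z p"
      using sym[of "X p" "Y p"] self[of "X p" "Y p" "Z p"] self[of "Y p" "X p" "Z p"]
      by (simp add: cubic_form_const[OF b] X Y Z)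
    show "cubic_form (\<lambda>p. b) (const_connection G) X Y Z p = cubic_form (\<lambda>p. b) (const_connection G) X Z Y p"
      using bsym by (simp add: cubic_form_const[OF b] X Y Z)
  qed
qed

lemma inv_translation: "inv (\<lambda>p. a + p) = (\<lambda>q::'a::real_normed_vector. q - a)"
  by (rule inv_equality) auto

lemma frechet_derivative_translation:
  "frechet_derivative (\<lambda>p. a + p) (at (x::'a::real_normed_vector)) = (\<lambda>v. v)"
  by (rule frechet_derivativeI) (auto intro!: derivative_eq_intros)

lemma pushforward_translation: "pushforward (\<lambda>p. a + p) X = (\<lambda>q. X (q - a))"
  by (simp add: pushforward_def inv_translation frechet_derivative_translation)

lemma pullback_connection_translation:
  "pullback_connection (\<lambda>p. a + p) nab X Y = (\<lambda>q. nab (\<lambda>q. X (q - a)) (\<lambda>q. Y (q - a)) (q + a))"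
  using pushforward_translation[of "- a"]
  by (simp add: pullback_connection_def pushforward_translation inv_translation)

lemma smooth_translate: "smooth X \<Longrightarrow> smooth (\<lambda>q. X (q - a))"
  using smooth_affine_precompose[of "\<lambda>x. x" X "- a"] by (simp add: linear_id[unfolded id_def])

lemma smooth_translate_iff: "smooth (\<lambda>q. X (q - a)) \<longleftrightarrow> smooth X"
  using smooth_translate[of X a] smooth_translate[of "\<lambda>q. X (q - a)" "- a"] by auto

lemma dir_deriv_translate:
  assumes "smooth Y"
  shows "dir_deriv (\<lambda>q. X (q - a)) (\<lambda>q. Y (q - a)) p = dir_deriv X Y (p - a)"
proof -
  have "((\<lambda>q. Y (q - a)) has_derivative (\<lambda>v. frechet_derivative Y (at (p - a)) v)) (at p)"
    using has_derivative_affine_precompose[of "\<lambda>x. x" Y p "- a"] smooth_differentiable[OF assms]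
    by (simp add: linear_id[unfolded id_def])
  then show ?thesis by (simp add: dir_deriv_def frechet_derivativeI)
qed

lemma left_invariant_const_connection:
  fixes G :: "real^'n \<Rightarrow> real^'n \<Rightarrow> real^('n::finite)"
  shows "left_invariant_connection (const_connection G)"
  unfolding left_invariant_connection_def
proof (intro allI ext)
  fix a :: "real^'n" and X Y :: "'n vfield" and q
  show "pullback_connection (\<lambda>p. a + p) (const_connection G) X Y q = const_connection G X Y q"
    by (simp add: pullback_connection_translation const_connection_def smooth_translate_iff dir_deriv_translate)
qed

lemma left_invariant_metric_iff: "left_invariant_metric g \<longleftrightarrow> (\<exists>b. g = (\<lambda>p. b))"
proof
  assume L: "left_invariant_metric g"
  have "g p = g 0" for p
  proof -
    have "pullback_metric (\<lambda>q. p + q) g 0 = g 0" using L by (simp add: left_invariant_metric_def)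
    then show ?thesis by (simp add: pullback_metric_def frechet_derivative_translation)
  qed
  then show "\<exists>b. g = (\<lambda>p. b)" by (intro exI[of _ "g 0"]) auto
qed (auto simp: left_invariant_metric_def pullback_metric_def frechet_derivative_translation)

lemma affine_connectionD:
  assumes "affine_connection nab"
  shows "smooth X \<Longrightarrow> smooth X' \<Longrightarrow> smooth Y \<Longrightarrow> nab (\<lambda>p. X p + X' p) Y = (\<lambda>p. nab X Y p + nab X' Y p)"
    "smooth f \<Longrightarrow> smooth X \<Longrightarrow> smooth Y \<Longrightarrow> nab (\<lambda>p. f p *\<^sub>R X p) Y = (\<lambda>p. f p *\<^sub>R nab X Y p)"
    "smooth X \<Longrightarrow> smooth Y \<Longrightarrow> smooth Y' \<Longrightarrow> nab X (\<lambda>p. Y p + Y' p) = (\<lambda>p. nab X Y p + nab X Y' p)"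
    "smooth f \<Longrightarrow> smooth X \<Longrightarrow> smooth Y \<Longrightarrow>
       nab X (\<lambda>p. f p *\<^sub>R Y p) = (\<lambda>p. dir_deriv X f p *\<^sub>R Y p + f p *\<^sub>R nab X Y p)"
    "\<not> (smooth X \<and> smooth Y) \<Longrightarrow> nab X Y = (\<lambda>p. 0)"
  using assms unfolding affine_connection_def by blast+

text \<open>By the Leibniz rules a connection is determined by its values on constant fields; an invariant
  one has constant Christoffel symbols.\<close>

lemma left_invariant_affine_connection:
  fixes nab :: "('n::finite) connection"
  assumes A: "affine_connection nab" and inv: "left_invariant_connection nab"
  shows "\<exists>G. bilinear G \<and> nab = const_connection G"
proof -
  note D = affine_connectionD[OF A]
  define G where "G = (\<lambda>u v. nab (\<lambda>_. u) (\<lambda>_. v) 0)"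
  have const: "nab (\<lambda>_. u) (\<lambda>_. v) p = G u v" for u v p
  proof -
    have "pullback_connection (\<lambda>q. p + q) nab (\<lambda>_. u) (\<lambda>_. v) 0 = nab (\<lambda>_. u) (\<lambda>_. v) 0"
      using inv by (simp add: left_invariant_connection_def)
    then show ?thesis by (simp add: pullback_connection_translation G_def)
  qed
  have G: "bilinear G"
    unfolding bilinear_def
  proof (intro conjI allI linearI)
    fix u v w :: "real^'n" and c :: real
    show "G u (v + w) = G u v + G u w" using D(3)[of "\<lambda>_. u" "\<lambda>_. v" "\<lambda>_. w"] by (simp add: G_def)
    show "G u (c *\<^sub>R v) = c *\<^sub>R G u v" using D(4)[of "\<lambda>_. c" "\<lambda>_. u" "\<lambda>_. v"] by (simp add: G_def)
    show "G (v + w) u = G v u + G w u" using D(1)[of "\<lambda>_. v" "\<lambda>_. w" "\<lambda>_. u"] by (simp add: G_def)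
    show "G (c *\<^sub>R v) u = c *\<^sub>R G v u" using D(2)[of "\<lambda>_. c" "\<lambda>_. v" "\<lambda>_. u"] by (simp add: G_def)
  qed
  have zl: "nab (\<lambda>_. 0) Y p = 0" if "smooth Y" for Y p
    using D(2)[of "\<lambda>_. 0" "\<lambda>_. 0" Y] that by simp
  have zr: "nab X (\<lambda>_. 0) p = 0" if "smooth X" for X p
    using D(4)[of "\<lambda>_. 0" X "\<lambda>_. 0"] that by simp
  have suml: "nab (\<lambda>p. \<Sum>i\<in>I. f i p *\<^sub>R e i) Y p = (\<Sum>i\<in>I. f i p *\<^sub>R nab (\<lambda>_. e i) Y p)"
    if Y: "smooth Y" and "finite I" and f: "\<And>i. smooth (f i)" for I :: "'n set" and f :: "'n \<Rightarrow> real^'n \<Rightarrow> real" and e Y p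
    using \<open>finite I\<close>
  proof (induction I)
    case empty
    then show ?case using zl[OF Y] by simp
  next
    case (insert i I)
    have s: "smooth (\<lambda>p. \<Sum>i\<in>I. f i p *\<^sub>R e i)" "smooth (\<lambda>p. f i p *\<^sub>R e i)"
      by (auto intro!: smooth_sum smooth_scaleR f)
    show ?case
      using insert D(1)[OF s(2,1) Y] D(2)[of "f i" "\<lambda>_. e i" Y] f Y by simp
  qed
  have sumr: "nab X (\<lambda>p. \<Sum>i\<in>I. f i p *\<^sub>R e i) p =
      (\<Sum>i\<in>I. dir_deriv X (f i) p *\<^sub>R e i + f i p *\<^sub>R nab X (\<lambda>_. e i) p)"
    if X: "smooth X" and "finite I" and f: "\<And>i. smooth (f i)" for I :: "'n set" and f :: "'n \<Rightarrow> real^'n \<Rightarrow> real" and e X p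
    using \<open>finite I\<close>
  proof (induction I)
    case empty
    then show ?case using zr[OF X] by simp
  next
    case (insert i I)
    have s: "smooth (\<lambda>p. \<Sum>i\<in>I. f i p *\<^sub>R e i)" "smooth (\<lambda>p. f i p *\<^sub>R e i)"
      by (auto intro!: smooth_sum smooth_scaleR f)
    show ?case
      using insert D(3)[OF X s(2,1)] D(4)[of "f i" X "\<lambda>_. e i"] f X by simp
  qed
  have Gexp: "G u v = (\<Sum>i\<in>UNIV. (v $ i) *\<^sub>R (\<Sum>j\<in>UNIV. (u $ j) *\<^sub>R G (axis j 1) (axis i 1)))" for u v
  proof -
    have l: "linear (G u)" "linear (\<lambda>u. G u w)" for u w using G by (auto simp: bilinear_def)
    have r: "G u w = (\<Sum>j\<in>UNIV. (u $ j) *\<^sub>R G (axis j 1) w)" for w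
    proof -
      have "G u w = G (\<Sum>i\<in>UNIV. (u $ i) *\<^sub>R axis i 1) w" by (metis vec_expansion)
      then show ?thesis by (simp add: linear_sum[OF l(2)] linear_cmul[OF l(2)])
    qed
    have "G u v = G u (\<Sum>i\<in>UNIV. (v $ i) *\<^sub>R axis i 1)" by (metis vec_expansion)
    also have "\<dots> = (\<Sum>i\<in>UNIV. (v $ i) *\<^sub>R G u (axis i 1))"
      by (simp add: linear_sum[OF l(1)] linear_cmul[OF l(1)])
    finally show ?thesis by (simp only: r[symmetric])
  qed
  have "nab X Y p = const_connection G X Y p" for X Y p
  proof (cases "smooth X \<and> smooth Y")
    case True
    then have X: "smooth X" and Y: "smooth Y" by auto
    have XE: "X = (\<lambda>p. \<Sum>i\<in>UNIV. (X p $ i) *\<^sub>R axis i 1)" and YE: "Y = (\<lambda>p. \<Sum>i\<in>UNIV. (Y p $ i) *\<^sub>R axis i 1)"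
      using vec_expansion by blast+
    have n1: "nab X (\<lambda>_. w) p = (\<Sum>j\<in>UNIV. (X p $ j) *\<^sub>R G (axis j 1) w)" for w
      by (subst XE, subst suml) (simp_all add: smooth_component X const)
    have dc: "dir_deriv X (\<lambda>p. Y p $ i) p = dir_deriv X Y p $ i" for i
      by (rule dir_deriv_linear[OF bounded_linear_vec_nth Y])
    have "nab X Y p = nab X (\<lambda>p. \<Sum>i\<in>UNIV. (Y p $ i) *\<^sub>R axis i 1) p" using YE by simp
    also have "\<dots> = (\<Sum>i\<in>UNIV. (dir_deriv X Y p $ i) *\<^sub>R axis i 1 + (Y p $ i) *\<^sub>R nab X (\<lambda>_. axis i 1) p)"
      by (subst sumr) (simp_all add: smooth_component X Y dc)
    also have "\<dots> = dir_deriv X Y p + G (X p) (Y p)"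
      by (simp only: sum.distrib n1 Gexp[symmetric] vec_expansion[symmetric])
    finally show ?thesis using X Y by (simp add: const_connection_def)
  next
    case False
    then show ?thesis using D(5) by (auto simp: const_connection_def)
  qed
  with G show ?thesis by blast
qed

lemma LStat_eq: "LStat = {const_structure b G |b G. admissible b G}"
proof (intro equalityI subsetI)
  fix s :: "'a metric \<times> 'a connection" assume "s \<in> LStat"
  then obtain g nab where s: "s = (g, nab)" and st: "statistical_structure g nab"
    and i: "left_invariant_metric g" "left_invariant_connection nab" by (auto simp: LStat_def)
  obtain b where g: "g = (\<lambda>p. b)" using i left_invariant_metric_iff by blast
  obtain G where G: "bilinear G" "nab = const_connection G"
    using left_invariant_affine_connection[OF _ i(2)] st by (auto simp: statistical_structure_def)
  then have "admissible b G" using st g statistical_const_iff by blast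
  then show "s \<in> {const_structure b G |b G. admissible b G}"
    using s g G by (auto simp: const_structure_def)
next
  fix s :: "'a metric \<times> 'a connection" assume "s \<in> {const_structure b G |b G. admissible b G}"
  then obtain b G where s: "s = const_structure b G" and a: "admissible b G" by auto
  have "statistical_structure (\<lambda>p. b) (const_connection G)"
    using a statistical_const_iff[of G b] by (auto simp: admissible_def)
  then show "s \<in> LStat"
    by (auto simp: s const_structure_def LStat_def left_invariant_const_connection left_invariant_metric_iff)
qed

text \<open>The second derivatives of \<open>Z\<close> combine to \<open>D\<close> along the Lie bracket and cancel, and so do the terms linear
  in \<open>G\<close>; only the commutator of multiplications remains.\<close>

lemma curvature_const:
  assumes G: "bilinear G" and X: "smooth X" and Y: "smooth Y" and Z: "smooth Z"
  shows "curvature (const_connection G) X Y Z =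
    (\<lambda>p. G (X p) (G (Y p) (Z p)) - G (Y p) (G (X p) (Z p)))"
proof
  fix p
  note bb = bilinear_bounded[OF G]
  have s: "smooth (lie_bracket X Y)"
    unfolding lie_bracket_def by (intro smooth_diff smooth_dir_deriv X Y)
  have second: "const_connection G A (const_connection G B Z) p =
      dir_deriv A (dir_deriv B Z) p + G (B p) (dir_deriv A Z p) + G (dir_deriv A B p) (Z p)
      + G (A p) (dir_deriv B Z p) + G (A p) (G (B p) (Z p))" if A: "smooth A" and B: "smooth B" for A B
  proof -
    have sm: "smooth (dir_deriv B Z)" "smooth (\<lambda>p. G (B p) (Z p))"
      by (auto intro: smooth_dir_deriv smooth_bilinear_apply[OF G] A B Z)
    then have "smooth (\<lambda>p. dir_deriv B Z p + G (B p) (Z p))" by (rule smooth_add)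
    then show ?thesis
      using A B Z dir_deriv_add[OF sm, of A p] dir_deriv_bilinear[OF bb B Z, of A p]
      by (simp add: const_connection_def bilinear_simps[OF G] add_ac)
  qed
  have "dir_deriv X (dir_deriv Y Z) p - dir_deriv Y (dir_deriv X Z) p = dir_deriv (lie_bracket X Y) Z p"
    by (rule dir_deriv_commutator[OF X Y Z])
  moreover have "G (lie_bracket X Y p) (Z p) = G (dir_deriv X Y p) (Z p) - G (dir_deriv Y X p) (Z p)"
    by (simp add: lie_bracket_def bilinear_simps[OF G])
  moreover have "const_connection G (lie_bracket X Y) Z p = dir_deriv (lie_bracket X Y) Z p + G (lie_bracket X Y p) (Z p)"
    using s Z by (simp add: const_connection_def)
  ultimately show "curvature (const_connection G) X Y Z p = G (X p) (G (Y p) (Z p)) - G (Y p) (G (X p) (Z p))"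
    unfolding curvature_def second[OF X Y] second[OF Y X] by (simp add: algebra_simps)
qed

lemma dually_flat_const:
  assumes G: "bilinear G" shows "dually_flat g (const_connection G) \<longleftrightarrow> flat_product G"
proof
  assume L: "dually_flat g (const_connection G)"
  have "G u (G v w) = G v (G u w)" for u v w
  proof -
    have "curvature (const_connection G) (\<lambda>_. u) (\<lambda>_. v) (\<lambda>_. w) = (\<lambda>p. 0)"
      using L unfolding dually_flat_def by (metis smooth_const)
    then show ?thesis by (simp add: curvature_const[OF G] fun_eq_iff)
  qed
  then show "flat_product G" by (simp add: flat_product_def)
qed (auto simp: dually_flat_def curvature_const[OF G] flat_product_def fun_eq_iff)

lemma LStat_DF_eq:
  "(LStat_DF :: (('n::finite) metric \<times> 'n connection) set) = {const_structure b G |b G. admissible b G \<and> flat_product G}"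
proof -
  have "dually_flat (\<lambda>p. b) (const_connection G) \<longleftrightarrow> flat_product G" if "admissible b G"
    for b and G :: "real^'n \<Rightarrow> real^'n \<Rightarrow> real^'n"
    using that by (simp add: dually_flat_const admissible_def)
  then show ?thesis
    unfolding LStat_DF_def LStat_eq by (auto simp: const_structure_def)
qed

text \<open>Because multiplications are self-adjoint, the contributions of \<open>G\<close> and \<open>-G\<close> to the duality equation
  cancel. The equation determines the dual connection since \<open>b\<close> is nondegenerate and, at each point, every vector
  is the value of a constant field.\<close>

lemma dual_const_connection:
  assumes a: "admissible b G"
  shows "dual_connection (\<lambda>p. b) (const_connection G) = const_connection (\<lambda>u v. - G u v)"
  unfolding dual_connection_def
proof (rule the_equality)
  have b: "inner_product b" and G: "bilinear G" and self: "\<And>u v w. b (G u v) w = b v (G u w)"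
    using a by (auto simp: admissible_def)
  have bb: "bounded_bilinear b" using b by (auto simp: inner_product_def bilinear_bounded)
  let ?D = "const_connection (\<lambda>u v. - G u v)"
  let ?P = "\<lambda>nab'. \<forall>X Y Z. smooth X \<and> smooth Y \<and> smooth Z \<longrightarrow>
        (\<forall>p. dir_deriv X (metric_apply (\<lambda>p. b) Y Z) p =
           metric_apply (\<lambda>p. b) (const_connection G X Y) Z p + metric_apply (\<lambda>p. b) Y (nab' X Z) p)"
  have P: "?P ?D"
    using dir_deriv_bilinear[OF bb]
    by (auto simp: metric_apply_def const_connection_def inner_product_simps[OF b] self add.commute)
  then show "affine_connection ?D \<and> ?P ?D"
    using affine_const_connection[OF bilinear_neg[OF G]] by blast
  fix nab' assume n: "affine_connection nab' \<and> ?P nab'"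
  show "nab' = ?D"
  proof (intro ext)
    fix X Z p
    show "nab' X Z p = ?D X Z p"
    proof (cases "smooth X \<and> smooth Z")
      case True
      show ?thesis
      proof (rule inner_product_eqI[OF b])
        fix w
        have "metric_apply (\<lambda>p. b) (const_connection G X (\<lambda>_. w)) Z p + metric_apply (\<lambda>p. b) (\<lambda>_. w) (nab' X Z) p =
           metric_apply (\<lambda>p. b) (const_connection G X (\<lambda>_. w)) Z p + metric_apply (\<lambda>p. b) (\<lambda>_. w) (?D X Z) p"
          using n P True smooth_const[of w] by metis
        then have "b w (nab' X Z p) = b w (?D X Z p)" by (simp add: metric_apply_def)
        then show "b (nab' X Z p) w = b (?D X Z p) w" using b by (simp add: inner_product_def)
      qed
    next
      case False
      then show ?thesis using affine_connectionD(5)[of nab' X Z] n by (auto simp: const_connection_def)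
    qed
  qed
qed

text \<open>The curvature is quadratic in \<open>G\<close>, so it does not see the sign change that duality makes.\<close>

lemma LStat_conjugate_symmetric:
  assumes "(h, nab) \<in> LStat" shows "conjugate_symmetric h nab"
proof -
  obtain b G where h: "h = (\<lambda>p. b)" "nab = const_connection G" and a: "admissible b G"
    using assms by (auto simp: LStat_eq const_structure_def)
  then have G: "bilinear G" by (simp add: admissible_def)
  show ?thesis
    by (simp add: conjugate_symmetric_def h dual_const_connection[OF a] curvature_const[OF G]
        curvature_const[OF bilinear_neg[OF G]] bilinear_simps[OF G])
qed

lemma lstat_coords_const:
  assumes a: "admissible b G"
  shows "lstat_coords (const_structure b G) = (b, \<lambda>u v w. - 2 * b (G u v) w)"
proof -
  have b: "inner_product b" and self: "\<And>u v w. b (G u v) w = b v (G u w)"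
    using a by (auto simp: admissible_def)
  show ?thesis
    by (simp add: lstat_coords_def const_structure_def cubic_form_const[OF b] self fun_eq_iff)
qed

text \<open>The difference of two torsion-free connections with the same cubic form is symmetric in its
  arguments and skew-adjoint in the second one, and a trilinear expression symmetric in one pair of
  slots and skew in an overlapping pair vanishes.\<close>

lemma connection_of_const:
  fixes G :: "real^'n \<Rightarrow> real^'n \<Rightarrow> real^('n::finite)"
  assumes a: "admissible b G" and C: "\<And>u v w. C u v w = - 2 * b (G u v) w"
  shows "connection_of (\<lambda>p. b) C = const_connection G"
  unfolding connection_of_def
proof (rule the_equality)
  have b: "inner_product b" and G: "bilinear G" and self: "\<And>u v w. b (G u v) w = b v (G u w)"
    using a by (auto simp: admissible_def)
  have bsym: "b u v = b v u" for u v using b by (simp add: inner_product_def)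
  let ?N = "const_connection G"
  let ?P = "\<lambda>nab. \<forall>X Y Z. smooth X \<and> smooth Y \<and> smooth Z \<longrightarrow>
        cubic_form (\<lambda>p. b) nab X Y Z = (\<lambda>p. C (X p) (Y p) (Z p))"
  have N: "statistical_structure (\<lambda>p. b) ?N" using statistical_const_iff[OF G] a by blast
  have P: "?P ?N" by (auto simp: cubic_form_const[OF b] C self fun_eq_iff)
  then show "statistical_structure (\<lambda>p. b) ?N \<and> ?P ?N" using N by blast
  fix nab assume n: "statistical_structure (\<lambda>p. b) nab \<and> ?P nab"
  have aff: "affine_connection nab" and tn: "torsion_free nab" and tN: "torsion_free ?N"
    using n N unfolding statistical_structure_def by blast+
  have cub: "cubic_form (\<lambda>p. b) nab X Y Z = (\<lambda>p. C (X p) (Y p) (Z p))"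
      "cubic_form (\<lambda>p. b) ?N X Y Z = (\<lambda>p. C (X p) (Y p) (Z p))"
    if "smooth X" "smooth Y" "smooth Z" for X Y Z
    using n P that by blast+
  show "nab = ?N"
  proof (intro ext)
    fix X Y p
    show "nab X Y p = ?N X Y p"
    proof (cases "smooth X \<and> smooth Y")
      case True
      show ?thesis
      proof (rule inner_product_eqI[OF b])
        fix w :: "real^'n"
        define B where "B X Y Z = b (nab X Y p - ?N X Y p) (Z p)" for X Y Z
        have tf: "B X Y Z = B Y X Z" if "smooth X" "smooth Y" for X Y Z
        proof -
          have "nab X Y p - nab Y X p = ?N X Y p - ?N Y X p"
            using tn tN that by (simp add: torsion_free_def)
          then have "nab X Y p - ?N X Y p = nab Y X p - ?N Y X p" by (simp add: algebra_simps)
          then show ?thesis by (simp add: B_def)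
        qed
        have skew: "B X Y Z = - B X Z Y" if "smooth X" "smooth Y" "smooth Z" for X Y Z
        proof -
          have "cubic_form (\<lambda>p. b) nab X Y Z p = cubic_form (\<lambda>p. b) ?N X Y Z p"
            by (simp add: cub that)
          then have "b (nab X Y p) (Z p) + b (Y p) (nab X Z p) = b (?N X Y p) (Z p) + b (Y p) (?N X Z p)"
            by (simp add: cubic_form_def metric_apply_def)
          then show ?thesis
            using bsym[of "Y p" "nab X Z p"] bsym[of "Y p" "?N X Z p"]
            by (simp add: B_def inner_product_simps[OF b])
        qed
        define W where "W = (\<lambda>_::real^'n. w)"
        have sm: "smooth X" "smooth Y" "smooth W" using True by (auto simp: W_def)
        have "B X Y W = - B X W Y" using skew sm by blast
        also have "\<dots> = - B W X Y" using tf sm by simp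
        also have "\<dots> = B W Y X" using skew[of W X Y] sm by simp
        also have "\<dots> = B Y W X" using tf sm by simp
        also have "\<dots> = - B Y X W" using skew sm by blast
        also have "\<dots> = - B X Y W" using tf sm by simp
        finally have "B X Y W = 0" by simp
        then show "b (nab X Y p) w = b (?N X Y p) w" by (simp add: B_def W_def inner_product_simps[OF b])
      qed
    next
      case False
      then show ?thesis using affine_connectionD(5)[OF aff, of X Y]
        by (auto simp: const_connection_def)
    qed
  qed
qed

section \<open>The group action on invariant structures\<close>

text \<open>A differentiable additive map has the same derivative everywhere, hence equals that derivative.\<close>

lemma Aut_linear:
  assumes "\<phi> \<in> Aut" shows "linear \<phi>"
proof -
  have add: "\<phi> (p + q) = \<phi> p + \<phi> q" for p q using assms by (simp add: Aut_def)
  define L where "L = frechet_derivative \<phi> (at 0)"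
  have D0: "(\<phi> has_derivative L) (at 0)"
    using assms smooth_has_derivative by (auto simp: Aut_def L_def)
  then have L: "linear L" by (simp add: has_derivative_linear)
  have D: "(\<phi> has_derivative L) (at p)" for p
  proof -
    have "((\<lambda>x. x - p) has_derivative (\<lambda>v. v)) (at p)" by (auto intro!: derivative_eq_intros)
    from has_derivative_compose[OF this, of \<phi> L] D0
    have "((\<lambda>x. \<phi> (x - p)) has_derivative L) (at p)" by simp
    then have "((\<lambda>x. \<phi> (x - p) + \<phi> p) has_derivative L) (at p)" by (auto intro!: derivative_eq_intros)
    then show ?thesis by (simp add: add[symmetric])
  qed
  have "((\<lambda>x. \<phi> x - L x) has_derivative (\<lambda>h. 0)) (at x within UNIV)" for x
    using has_derivative_diff[OF D linear_imp_has_derivative[OF L]] by simp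
  from has_derivative_zero_constant[OF convex_UNIV this]
  obtain c where c: "\<And>x. \<phi> x - L x = c" by auto
  have "\<phi> 0 = 0" using add[of 0 0] by simp
  then have "c = 0" using c[of 0] linear_0[OF L] by simp
  then have "\<phi> = L" using c by auto
  with L show ?thesis by simp
qed

lemma linear_inv:
  fixes \<phi> :: "'a::euclidean_space \<Rightarrow> 'b::euclidean_space"
  assumes "linear \<phi>" "bij \<phi>" shows "linear (inv \<phi>)"
proof -
  have "\<phi> (inv \<phi> x) = x" "inv \<phi> (\<phi> y) = y" for x y
    using assms(2) by (simp_all add: bij_is_surj surj_f_inv_f bij_is_inj)
  then show ?thesis
    by (metis (no_types, lifting) linearI linear_add[OF assms(1)] linear_cmul[OF assms(1)])
qed

lemma Aut_iff: "\<phi> \<in> Aut \<longleftrightarrow> linear \<phi> \<and> bij \<phi>"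
proof
  assume "\<phi> \<in> Aut" then show "linear \<phi> \<and> bij \<phi>" using Aut_linear by (auto simp: Aut_def)
next
  assume R: "linear \<phi> \<and> bij \<phi>"
  then have "linear (inv \<phi>)" by (simp add: linear_inv)
  with R show "\<phi> \<in> Aut" by (simp add: Aut_def smooth_of_linear linear_add)
qed

lemma frechet_derivative_linear:
  "linear L \<Longrightarrow> frechet_derivative (L :: 'a::euclidean_space \<Rightarrow> 'b::euclidean_space) (at x) = L"
  by (rule frechet_derivativeI[OF linear_imp_has_derivative])

lemma act_const:
  assumes "\<phi> \<in> Aut"
  shows "act r \<phi> (const_structure b G) =
    const_structure (\<lambda>u v. r * b (inv \<phi> u) (inv \<phi> v)) (\<lambda>u v. \<phi> (G (inv \<phi> u) (inv \<phi> v)))"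
proof -
  define \<psi> where "\<psi> = inv \<phi>"
  have bij: "bij \<phi>" "bij \<psi>" and lin: "linear \<phi>" "linear \<psi>"
    using assms by (auto simp: Aut_iff \<psi>_def bij_imp_bij_inv linear_inv)
  have inv: "inv \<psi> = \<phi>" using bij by (simp add: \<psi>_def inv_inv_eq)
  have cancel: "\<phi> (\<psi> x) = x" "\<psi> (\<phi> x) = x" for x
    using bij by (simp_all add: \<psi>_def bij_is_surj surj_f_inv_f bij_is_inj)
  have push: "pushforward \<psi> X = (\<lambda>q. \<psi> (X (\<phi> q)))" "pushforward \<phi> X = (\<lambda>q. \<phi> (X (\<psi> q)))" for X
    by (simp_all add: pushforward_def inv \<psi>_def[symmetric] frechet_derivative_linear lin)
  have sm: "smooth (\<lambda>q. \<psi> (X (\<phi> q))) \<longleftrightarrow> smooth X" for X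
  proof
    have bl: "bounded_linear \<phi>" "bounded_linear \<psi>" using lin by (auto simp: linear_conv_bounded_linear)
    show "smooth X" if "smooth (\<lambda>q. \<psi> (X (\<phi> q)))"
      using smooth_linear[OF bl(1) smooth_affine_precompose[OF lin(2) that, of 0]] by (simp add: cancel)
    show "smooth (\<lambda>q. \<psi> (X (\<phi> q)))" if "smooth X"
      using smooth_linear[OF bl(2) smooth_affine_precompose[OF lin(1) that, of 0]] by simp
  qed
  have dd: "\<phi> (dir_deriv (\<lambda>q. \<psi> (X (\<phi> q))) (\<lambda>q. \<psi> (Y (\<phi> q))) (\<psi> p)) = dir_deriv X Y p" if "smooth Y" for X Y p
  proof -
    have "((\<lambda>q. Y (\<phi> q + 0)) has_derivative (\<lambda>v. frechet_derivative Y (at (\<phi> (\<psi> p) + 0)) (\<phi> v))) (at (\<psi> p))"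
      by (rule has_derivative_affine_precompose[OF lin(1) smooth_differentiable[OF that]])
    then have "((\<lambda>q. \<psi> (Y (\<phi> q))) has_derivative (\<lambda>v. \<psi> (frechet_derivative Y (at p) (\<phi> v)))) (at (\<psi> p))"
      using bounded_linear.has_derivative[of \<psi>] lin by (simp add: linear_conv_bounded_linear cancel)
    then show ?thesis by (simp add: dir_deriv_def frechet_derivativeI cancel)
  qed
  have "pullback_connection \<psi> (const_connection G) X Y p = const_connection (\<lambda>u v. \<phi> (G (\<psi> u) (\<psi> v))) X Y p" for X Y p
    by (auto simp: pullback_connection_def push inv const_connection_def sm cancel dd linear_add[OF lin(1)] linear_0[OF lin(1)])
  moreover have "pullback_metric \<psi> (\<lambda>p. b) = (\<lambda>p u v. b (\<psi> u) (\<psi> v))"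
    by (simp add: pullback_metric_def frechet_derivative_linear lin)
  ultimately show ?thesis
    by (simp add: act_def const_structure_def \<psi>_def[symmetric] fun_eq_iff)
qed

section \<open>Normal form of flat structures\<close>

definition diag_product :: "real^'n \<Rightarrow> real^'n \<Rightarrow> real^'n \<Rightarrow> real^('n::finite)" where
  "diag_product l x y = (\<chi> i. l $ i * x $ i * y $ i)"

text \<open>The vectors \<open>l\<close> form a fundamental domain for the signed permutations of the coordinates, which is what
  makes the coefficients in a normal form unique.\<close>

definition chamber :: "(real^('n::{finite,linorder})) set" where
  "chamber = {l. (\<forall>i j. i \<le> j \<longrightarrow> l $ j \<le> l $ i) \<and> (\<forall>i. 0 \<le> l $ i)}"

text \<open>The columns of \<open>\<phi>\<close> are a \<open>b\<close>-orthonormal frame in which the multiplication \<open>H\<close> is diagonal.\<close>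

definition normal_form :: "(real^'n::_ \<Rightarrow> real^'n::_ \<Rightarrow> real) \<Rightarrow> (real^'n::_ \<Rightarrow> real^'n::_ \<Rightarrow> real^'n::_) \<Rightarrow>
    (real^'n::_ \<Rightarrow> real^'n::_) \<Rightarrow> real^'n::{finite,linorder} \<Rightarrow> bool" where
  "normal_form b H \<phi> l \<longleftrightarrow> \<phi> \<in> Aut \<and> l \<in> chamber \<and> (\<forall>x y. b (\<phi> x) (\<phi> y) = x \<bullet> y) \<and>
     (\<forall>x y. H (\<phi> x) (\<phi> y) = \<phi> (diag_product l x y))"

lemma inner_product_lower_bound:
  fixes b :: "real^'n::finite \<Rightarrow> real^'n \<Rightarrow> real"
  assumes b: "inner_product b"
  shows "\<exists>m>0. \<forall>v. m * (norm v)\<^sup>2 \<le> b v v"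
proof -
  have bb: "bounded_bilinear b" using b by (simp add: inner_product_def bilinear_bounded)
  have "continuous_on (sphere 0 1) (\<lambda>v. b v v)"
    by (intro bounded_bilinear.continuous_on[OF bb] continuous_intros)
  moreover have "axis undefined 1 \<in> sphere (0::real^'n) 1" by simp
  then have "sphere (0::real^'n) 1 \<noteq> {}" by blast
  ultimately obtain x where x: "x \<in> sphere 0 1" "\<And>y. y \<in> sphere 0 1 \<Longrightarrow> b x x \<le> b y y"
    using continuous_attains_inf[of "sphere (0::real^'n) 1" "\<lambda>v. b v v"] by auto
  have "b x x * (norm v)\<^sup>2 \<le> b v v" for v
  proof (cases "v = 0")
    case True
    then show ?thesis by (simp add: inner_product_simps[OF b])
  next
    case False
    then have "b x x \<le> b ((1 / norm v) *\<^sub>R v) ((1 / norm v) *\<^sub>R v)" by (intro x(2)) simp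
    also have "\<dots> = b v v / (norm v)\<^sup>2" by (simp add: inner_product_simps[OF b] power2_eq_square)
    finally show ?thesis using False by (simp add: pos_le_divide_eq)
  qed
  moreover have "x \<noteq> 0" using x(1) by auto
  then have "b x x > 0" using b by (auto simp: inner_product_def)
  ultimately show ?thesis by blast
qed

lemma continuous_nonpos_at_right:
  fixes g :: "real \<Rightarrow> real"
  assumes "continuous_on UNIV g" "\<And>t. t > 0 \<Longrightarrow> g t \<le> 0" shows "g 0 \<le> 0"
proof -
  have "(g \<longlongrightarrow> g 0) (at_right 0)"
    using assms(1) by (simp add: continuous_on_def filterlim_at_split)
  moreover have "eventually (\<lambda>t. g t \<le> 0) (at_right 0)"
    using assms(2) by (auto simp: eventually_at_right_less eventually_at_right_field intro: exI[of _ 1])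
  ultimately show ?thesis using tendsto_upperbound trivial_limit_at_right_real by blast
qed

text \<open>The first and second order conditions for the restriction of a cubic form to the unit circle
  in the plane of two orthonormal vectors, with the circle in its rational parametrisation
  \<open>((1 - t\<^sup>2) / (1 + t\<^sup>2), 2 t / (1 + t\<^sup>2))\<close> and the denominators cleared.\<close>

lemma cubic_maximum_conditions:
  fixes l a c d :: real
  assumes le: "\<And>t. l * (1 - t\<^sup>2)^3 + 6 * a * t * (1 - t\<^sup>2)\<^sup>2 + 12 * c * t\<^sup>2 * (1 - t\<^sup>2) + 8 * d * t^3 \<le> l * (1 + t\<^sup>2)^3"
  shows "a = 0" "2 * c \<le> l"
proof -
  have le': "6 * a * t * (1 - t\<^sup>2)\<^sup>2 + 12 * c * t\<^sup>2 * (1 - t\<^sup>2) + 8 * d * t^3 - l * (6 * t\<^sup>2 + 2 * t^6) \<le> 0" for t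
  proof -
    have "l * (1 + t\<^sup>2)^3 - l * (1 - t\<^sup>2)^3 = l * (6 * t\<^sup>2 + 2 * t^6)" by algebra
    then show ?thesis using le[of t] by linarith
  qed
  have sgn: "s * a \<le> 0" if s: "s = 1 \<or> s = -1" for s :: real
  proof -
    let ?g = "\<lambda>t. 6 * (s * a) * (1 - t\<^sup>2)\<^sup>2 + 12 * c * t * (1 - t\<^sup>2) + 8 * (s * d) * t^2 - l * (6 * t + 2 * t^5)"
    have "?g 0 \<le> 0"
    proof (rule continuous_nonpos_at_right)
      show "continuous_on UNIV ?g" by (intro continuous_intros)
      fix t :: real assume t: "t > 0"
      have "t * ?g t = 6 * a * (s * t) * (1 - (s * t)\<^sup>2)\<^sup>2 + 12 * c * (s * t)\<^sup>2 * (1 - (s * t)\<^sup>2) + 8 * d * (s * t)^3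
          - l * (6 * (s * t)\<^sup>2 + 2 * (s * t)^6)"
        using s by (elim disjE) (simp_all add: algebra_simps eval_nat_numeral)
      then have "t * ?g t \<le> 0" using le'[of "s * t"] by linarith
      then show "?g t \<le> 0" using t by (simp add: mult_le_0_iff)
    qed
    then show ?thesis by (simp add: mult.commute)
  qed
  from sgn[of 1] sgn[of "-1"] show a: "a = 0" by simp
  let ?g = "\<lambda>t. 12 * c * (1 - t\<^sup>2) + 8 * d * t - l * (6 + 2 * t^4)"
  have "?g 0 \<le> 0"
  proof (rule continuous_nonpos_at_right)
    show "continuous_on UNIV ?g" by (intro continuous_intros)
    fix t :: real assume t: "t > 0"
    have "t\<^sup>2 * ?g t = 6 * a * t * (1 - t\<^sup>2)\<^sup>2 + 12 * c * t\<^sup>2 * (1 - t\<^sup>2) + 8 * d * t^3 - l * (6 * t\<^sup>2 + 2 * t^6)"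
      using a by (simp add: algebra_simps eval_nat_numeral)
    then have "t\<^sup>2 * ?g t \<le> 0" using le'[of t] by linarith
    then show "?g t \<le> 0" using t by (simp add: mult_le_0_iff)
  qed
  then show "2 * c \<le> l" by simp
qed

lemma critical_point_conditions:
  fixes H :: "real^'n::finite \<Rightarrow> real^'n \<Rightarrow> real^'n"
  assumes adm: "admissible b H" and W: "subspace W" and u: "u \<in> W" "b u u = 1"
    and max: "\<And>v. v \<in> W \<Longrightarrow> b v v = 1 \<Longrightarrow> b (H v v) v \<le> b (H u u) u"
    and w: "w \<in> W" "b u w = 0"
  shows "b (H u u) w = 0 \<and> 2 * b (H u w) w \<le> b (H u u) u * b w w"
proof (cases "w = 0")
  case True
  then show ?thesis using adm by (auto simp: admissible_def inner_product_simps bilinear_simps)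
next
  case False
  have b: "inner_product b" and H: "bilinear H" and sym: "\<And>u v. H u v = H v u"
    and self: "\<And>u v w. b (H u v) w = b v (H u w)" using adm by (auto simp: admissible_def)
  have bsym: "b u v = b v u" for u v using b by (simp add: inner_product_def)
  note [simp] = inner_product_simps[OF b] bilinear_simps[OF H]
  have hom: "b (H x x) x \<le> b (H u u) u * s^3" if "x \<in> W" "b x x = s\<^sup>2" "s > 0" for x s
  proof -
    have "b (H ((1/s) *\<^sub>R x) ((1/s) *\<^sub>R x)) ((1/s) *\<^sub>R x) \<le> b (H u u) u"
      using that by (intro max subspace_scale[OF W]) (simp_all add: power2_eq_square)
    then show ?thesis using that by (simp add: field_simps power3_eq_cube)
  qed
  define r where "r = sqrt (b w w)"
  have bw: "b w w > 0" using b False by (auto simp: inner_product_def)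
  then have r: "r > 0" "r\<^sup>2 = b w w" by (simp_all add: r_def)
  define z where "z = (1 / r) *\<^sub>R w"
  have z: "z \<in> W" "b u z = 0" "b z u = 0" "b z z = 1" "w = r *\<^sub>R z"
    using w r bsym[of z u] by (auto simp: z_def subspace_scale[OF W] power2_eq_square field_simps)
  have zu: "H z u = H u z" by (rule sym)
  have C1: "b (H u z) u = b (H u u) z"
    using self[of u z u] bsym[of z "H u u"] by simp
  have C2: "b (H z z) u = b (H u z) z"
    using self[of z z u] bsym[of z "H u z"] zu by simp
  have "b (H u u) z = 0 \<and> 2 * b (H u z) z \<le> b (H u u) u"
  proof -
    have "b (H u u) u * (1 - t\<^sup>2)^3 + 6 * b (H u u) z * t * (1 - t\<^sup>2)\<^sup>2 + 12 * b (H u z) z * t\<^sup>2 * (1 - t\<^sup>2)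
        + 8 * b (H z z) z * t^3 \<le> b (H u u) u * (1 + t\<^sup>2)^3" for t
    proof -
      define x where "x = (1 - t\<^sup>2) *\<^sub>R u + (2 * t) *\<^sub>R z"
      have "x \<in> W" unfolding x_def using u z by (intro subspace_add[OF W] subspace_scale[OF W])
      moreover have "b x x = (1 + t\<^sup>2)\<^sup>2"
        unfolding x_def by (simp add: u z) algebra
      moreover have "1 + t\<^sup>2 > 0" by (simp add: add_pos_nonneg)
      ultimately have "b (H x x) x \<le> b (H u u) u * (1 + t\<^sup>2)^3" by (rule hom)
      moreover have "b (H x x) x = b (H u u) u * (1 - t\<^sup>2)^3 + 6 * b (H u u) z * t * (1 - t\<^sup>2)\<^sup>2
          + 12 * b (H u z) z * t\<^sup>2 * (1 - t\<^sup>2) + 8 * b (H z z) z * t^3"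
        unfolding x_def by (simp add: zu C1 C2) algebra
      ultimately show ?thesis by simp
    qed
    from cubic_maximum_conditions[OF this] show ?thesis by simp
  qed
  then show ?thesis using r by (simp add: z(5) z(4) power2_eq_square)
qed

text \<open>At a maximum point \<open>u\<close> of the cubic form on the unit sphere of \<open>W\<close>, the first order condition makes \<open>u\<close> an eigenvector of \<open>H u\<close>, with eigenvalue the maximum \<open>\<lambda>\<close>. Flatness turns this
  into \<open>H u \<circ> H u = \<lambda> H u\<close> on \<open>W\<close>, so \<open>H u\<close> has only the eigenvalues \<open>0\<close> and \<open>\<lambda>\<close>; the second order
  condition bounds its eigenvalues orthogonally to \<open>u\<close> by \<open>\<lambda> / 2\<close>, so they vanish.\<close>

lemma maximum_splits_off:
  fixes H :: "real^'n::finite \<Rightarrow> real^'n \<Rightarrow> real^'n"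
  assumes adm: "admissible b H" and flat: "flat_product H" and W: "subspace W"
    and closed: "\<And>v w. v \<in> W \<Longrightarrow> w \<in> W \<Longrightarrow> H v w \<in> W" and u: "u \<in> W" "b u u = 1"
    and max: "\<And>v. v \<in> W \<Longrightarrow> b v v = 1 \<Longrightarrow> b (H v v) v \<le> b (H u u) u"
  shows "0 \<le> b (H u u) u" "H u u = b (H u u) u *\<^sub>R u"
    "\<And>v. v \<in> W \<Longrightarrow> b u v = 0 \<Longrightarrow> H u v = 0"
proof -
  have b: "inner_product b" and H: "bilinear H" and sym: "\<And>u v. H u v = H v u"
    and self: "\<And>u v w. b (H u v) w = b v (H u w)" using adm by (auto simp: admissible_def)
  have bsym: "b u v = b v u" for u v using b by (simp add: inner_product_def)
  have def0: "b v v = 0 \<Longrightarrow> v = 0" for v using b by (auto simp: inner_product_def)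
  note [simp] = inner_product_simps[OF b] bilinear_simps[OF H]
  define l where "l = b (H u u) u"
  have crit: "b (H u u) w = 0 \<and> 2 * b (H u w) w \<le> b (H u u) u * b w w"
    if "w \<in> W" "b u w = 0" for w
    by (rule critical_point_conditions[OF adm W u _ that]) (rule max)
  have "- l \<le> l" unfolding l_def using max[of "- u"] u W by (simp add: subspace_neg)
  then show "0 \<le> b (H u u) u" by (simp add: l_def)
  then have l0: "0 \<le> l" by (simp add: l_def)
  have first: "b (H u u) v = l * b u v" if "v \<in> W" for v
  proof -
    have "v - b u v *\<^sub>R u \<in> W" using that u W by (intro subspace_diff subspace_scale)
    moreover have "b u (v - b u v *\<^sub>R u) = 0" using u by simp
    ultimately have "b (H u u) (v - b u v *\<^sub>R u) = 0" using crit by blast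
    then show ?thesis by (simp add: l_def)
  qed
  have "H u u - l *\<^sub>R u \<in> W" using u W closed by (intro subspace_diff subspace_scale)
  then have "b (H u u - l *\<^sub>R u) (H u u - l *\<^sub>R u) = 0"
    using first[of "H u u - l *\<^sub>R u"] by (simp add: right_diff_distrib)
  then have Huu: "H u u = l *\<^sub>R u" using def0 by fastforce
  then show "H u u = b (H u u) u *\<^sub>R u" by (simp add: l_def)
  fix v assume v: "v \<in> W" "b u v = 0"
  define w where "w = H u v"
  have w: "w \<in> W" unfolding w_def using closed u v by blast
  have "b u w = b (H u u) v" unfolding w_def by (simp add: self)
  then have uw: "b u w = 0" using first v by simp
  have "H u w = H u (H v u)" by (simp add: w_def sym)
  also have "\<dots> = H v (H u u)" using flat by (simp add: flat_product_def)
  also have "\<dots> = l *\<^sub>R w" by (simp add: Huu w_def sym)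
  finally have Huw: "H u w = l *\<^sub>R w" .
  have "2 * b (H u w) w \<le> l * b w w" using crit[OF w uw] by (simp add: l_def)
  then have le: "l * b w w \<le> 0" by (simp add: Huw)
  have "b w w = 0"
  proof (cases "l = 0")
    case True
    have "b w w = b v (H u w)" unfolding w_def using self by simp
    then show ?thesis using Huw True by simp
  next
    case False
    then have "b w w \<le> 0" using le l0 by (simp add: mult_le_0_iff)
    moreover have "b w w \<ge> 0" using b by (cases "w = 0") (auto simp: inner_product_def less_imp_le)
    ultimately show ?thesis by simp
  qed
  then show "H u v = 0" using def0 by (simp add: w_def)
qed

lemma unit_sphere_attains_max:
  fixes H :: "real^'n::finite \<Rightarrow> real^'n \<Rightarrow> real^'n"
  assumes b: "inner_product b" and H: "bilinear H" and W: "subspace W" and x: "x \<in> W" "x \<noteq> 0"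
  shows "\<exists>u\<in>W. b u u = 1 \<and> (\<forall>v\<in>W. b v v = 1 \<longrightarrow> b (H v v) v \<le> b (H u u) u)"
proof -
  note [simp] = inner_product_simps[OF b]
  let ?S = "W \<inter> {v. b v v = 1}"
  have bb: "bounded_bilinear b" using b by (simp add: inner_product_def bilinear_bounded)
  have contH: "continuous_on UNIV (\<lambda>v. H v v)"
    by (intro bounded_bilinear.continuous_on[OF bilinear_bounded[OF H]] continuous_intros)
  have cont: "continuous_on UNIV (\<lambda>v. b (H v v) v)"
    by (intro bounded_bilinear.continuous_on[OF bb] continuous_intros contH)
  have contb: "continuous_on UNIV (\<lambda>v. b v v)"
    by (intro bounded_bilinear.continuous_on[OF bb] continuous_intros)
  have "closed ?S"
    using W contb by (intro closed_Int closed_subspace closed_Collect_eq) (auto intro: continuous_intros)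
  moreover obtain m where m: "m > 0" "\<And>v. m * (norm v)\<^sup>2 \<le> b v v"
    using inner_product_lower_bound[OF b] by blast
  have "norm v \<le> sqrt (1 / m)" if "b v v = 1" for v
    using m(2)[of v] that m(1) by (intro real_le_rsqrt) (simp add: field_simps)
  then have "bounded ?S" by (auto simp: bounded_iff)
  ultimately have "compact ?S" by (simp add: compact_eq_bounded_closed)
  moreover have "b x x > 0" using b x by (auto simp: inner_product_def)
  then have "(1 / sqrt (b x x)) *\<^sub>R x \<in> ?S"
    using x W by (auto simp: subspace_scale field_simps)
  then have "?S \<noteq> {}" by blast
  moreover have "continuous_on ?S (\<lambda>v. b (H v v) v)" using cont continuous_on_subset by blast
  ultimately obtain u where "u \<in> ?S" "\<forall>v\<in>?S. b (H v v) v \<le> b (H u u) u"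
    using continuous_attains_sup by blast
  then show ?thesis by auto
qed

text \<open>Induction on the number of frame vectors. The last clause says that the vectors found so far annihilate their
  orthogonal complement \<open>W\<close>, which makes \<open>W\<close> closed under \<open>H\<close>, and that their eigenvalues bound the cubic form
  on \<open>W\<close>, which makes the next eigenvalue no larger than the previous ones.\<close>

lemma partial_eigenframe_exists:
  fixes H :: "real^'n::finite \<Rightarrow> real^'n \<Rightarrow> real^'n"
  assumes adm: "admissible b H" and flat: "flat_product H" and k: "k \<le> CARD('n)"
  shows "\<exists>f m. (\<forall>i<k. \<forall>j<k. b (f i) (f j) = (if i = j then 1 else 0)) \<and>
    (\<forall>i<k. (0::real) \<le> m i) \<and> (\<forall>j<k. \<forall>i\<le>j. m j \<le> m i) \<and>
    (\<forall>i<k. \<forall>j<k. H (f i) (f j) = (if i = j then m i *\<^sub>R f i else 0)) \<and>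
    (\<forall>v. (\<forall>i<k. b (f i) v = 0) \<longrightarrow> (\<forall>i<k. H (f i) v = 0) \<and> (b v v = 1 \<longrightarrow> (\<forall>i<k. b (H v v) v \<le> m i)))"
  using k
proof (induction k)
  case 0
  then show ?case by simp
next
  case (Suc k)
  have b: "inner_product b" and H: "bilinear H" and sym: "\<And>u v. H u v = H v u"
    and self: "\<And>u v w. b (H u v) w = b v (H u w)" using adm by (auto simp: admissible_def)
  have bsym: "b u v = b v u" for u v using b by (simp add: inner_product_def)
  note [simp] = inner_product_simps[OF b] bilinear_simps[OF H]
  obtain f m where IH: "\<forall>i<k. \<forall>j<k. b (f i) (f j) = (if i = j then 1 else 0)"
    "\<forall>i<k. (0::real) \<le> m i" "\<forall>j<k. \<forall>i\<le>j. m j \<le> m i"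
    "\<forall>i<k. \<forall>j<k. H (f i) (f j) = (if i = j then m i *\<^sub>R f i else 0)"
    "\<forall>v. (\<forall>i<k. b (f i) v = 0) \<longrightarrow> (\<forall>i<k. H (f i) v = 0) \<and> (b v v = 1 \<longrightarrow> (\<forall>i<k. b (H v v) v \<le> m i))"
    using Suc.IH[OF Suc_leD[OF Suc.prems]] by blast
  have orth: "b (f i) (f j) = (if i = j then 1 else 0)" if "i < k" "j < k" for i j
    using IH(1) that by blast
  have m0: "0 \<le> m i" if "i < k" for i using IH(2) that by blast
  have dec: "m j \<le> m i" if "j < k" "i \<le> j" for i j using IH(3) that by blast
  have eig: "H (f i) (f j) = (if i = j then m i *\<^sub>R f i else 0)" if "i < k" "j < k" for i j
    using IH(4) that by blast
  have ann: "H (f i) v = 0" if "\<And>i. i < k \<Longrightarrow> b (f i) v = 0" "i < k" for v i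
    using IH(5) that by blast
  have bnd: "b (H v v) v \<le> m i" if "\<And>i. i < k \<Longrightarrow> b (f i) v = 0" "b v v = 1" "i < k" for v i
    using IH(5) that by blast
  define W where "W = {v. \<forall>i<k. b (f i) v = 0}"
  have W: "subspace W" by (auto simp: W_def subspace_def)
  have closed: "H v w \<in> W" if "v \<in> W" "w \<in> W" for v w
  proof -
    have "b (f i) (H v w) = b (H (f i) v) w" if "i < k" for i by (simp add: self[symmetric] sym)
    then show ?thesis using that ann[of v] by (simp add: W_def)
  qed
  have "dim (span (f ` {..<k})) \<le> card (f ` {..<k})" by (simp add: dim_le_card')
  also have "\<dots> \<le> k" using card_image_le[of "{..<k}" f] by simp
  also have "\<dots> < DIM(real^'n)" using Suc.prems by simp
  finally have "span (f ` {..<k}) \<noteq> UNIV" by (metis dim_UNIV less_irrefl)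
  then obtain y where y: "y \<notin> span (f ` {..<k})" by blast
  \<comment> \<open>The Gram-Schmidt step: there are too few frame vectors to span, so \<open>W\<close> is nonzero.\<close>
  define x where "x = y - (\<Sum>i<k. b (f i) y *\<^sub>R f i)"
  have "(\<Sum>i<k. b (f i) y *\<^sub>R f i) \<in> span (f ` {..<k})"
    by (intro span_sum span_scale span_base) auto
  then have "x \<noteq> 0" using y by (auto simp: x_def)
  moreover have "x \<in> W"
  proof -
    have "b (f j) x = 0" if "j < k" for j
    proof -
      have "b (f j) (\<Sum>i<k. b (f i) y *\<^sub>R f i) = (\<Sum>i<k. b (f i) y * (if j = i then 1 else 0))"
        using that by (simp add: inner_product_sum[OF b] orth del: mult_delta_right)
      then show ?thesis using that by (simp add: x_def if_distrib[of "\<lambda>x. _ * x"] cong: if_cong)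
    qed
    then show ?thesis by (simp add: W_def)
  qed
  ultimately obtain u where u: "u \<in> W" "b u u = 1"
    and max: "\<And>v. v \<in> W \<Longrightarrow> b v v = 1 \<Longrightarrow> b (H v v) v \<le> b (H u u) u"
    using unit_sphere_attains_max[OF b H W] by blast
  have split: "0 \<le> b (H u u) u" "H u u = b (H u u) u *\<^sub>R u" "\<And>v. v \<in> W \<Longrightarrow> b u v = 0 \<Longrightarrow> H u v = 0"
    using maximum_splits_off[OF adm flat W _ u] closed max by blast+
  define f' where "f' = f(k := u)"
  define m' where "m' = m(k := b (H u u) u)"
  have fu: "b (f i) u = 0" "b u (f i) = 0" "H (f i) u = 0" "H u (f i) = 0" if "i < k" for i
    using u(1) that bsym[of u] ann[of u i] sym[of u] by (auto simp: W_def)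
  have mu: "b (H u u) u \<le> m i" if "i < k" for i
    using bnd[of u i] u that by (auto simp: W_def)
  show ?case
  proof (intro exI[of _ f'] exI[of _ m'] conjI allI impI)
    fix i j assume i: "i < Suc k" and j: "j < Suc k"
    show "b (f' i) (f' j) = (if i = j then 1 else 0)"
      using i j by (auto simp: f'_def less_Suc_eq orth fu u)
    show "H (f' i) (f' j) = (if i = j then m' i *\<^sub>R f' i else 0)"
      using i j split(2) by (auto simp: f'_def m'_def less_Suc_eq eig fu)
  next
    fix i assume "i < Suc k" then show "0 \<le> m' i"
      using m0 split(1) by (auto simp: m'_def less_Suc_eq)
  next
    fix j i assume "j < Suc k" "i \<le> j" then show "m' j \<le> m' i"
      using dec mu by (auto simp: m'_def less_Suc_eq le_less)
  next
    fix v i assume v: "\<forall>i<Suc k. b (f' i) v = 0" and i: "i < Suc k"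
    have vk: "b (f i) v = 0" if "i < k" for i using v that by (auto simp: f'_def less_Suc_eq split: if_splits)
    then have vW: "v \<in> W" by (simp add: W_def)
    have "b (f' k) v = 0" using v by blast
    then have uv: "b u v = 0" by (simp add: f'_def)
    show "H (f' i) v = 0" using i ann[of v, OF vk] split(3)[OF vW uv] by (auto simp: f'_def less_Suc_eq)
    show "b (H v v) v \<le> m' i" if "b v v = 1"
      using i bnd[of v, OF vk] max[OF vW] that by (auto simp: m'_def less_Suc_eq)
  qed
qed

definition position :: "'n::{finite,linorder} \<Rightarrow> nat" where
  "position i = card {j. j < i}"

lemma position_less: "i < j \<Longrightarrow> position i < position j"
  unfolding position_def by (rule psubset_card_mono) (auto dest: less_trans)

lemma position_mono: "i \<le> j \<Longrightarrow> position i \<le> position j"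
  using position_less[of i j] by (auto simp: le_less)

lemma position_bound: "position (i::'n::{finite,linorder}) < CARD('n)"
  unfolding position_def by (rule psubset_card_mono) auto

lemma position_eq_iff [simp]: "position i = position j \<longleftrightarrow> i = j"
  using position_less[of i j] position_less[of j i] by (cases i j rule: linorder_cases) auto

lemma bij_position: "bij_betw position (UNIV :: 'n::{finite,linorder} set) {..<CARD('n)}"
proof -
  have inj: "inj (position :: 'n \<Rightarrow> nat)" by (simp add: inj_def)
  have "range (position :: 'n \<Rightarrow> nat) \<subseteq> {..<CARD('n)}" using position_bound by auto
  then have "range (position :: 'n \<Rightarrow> nat) = {..<CARD('n)}"
    by (intro card_subset_eq) (simp_all add: card_image inj)
  with inj show ?thesis by (simp add: bij_betw_def)
qed

theorem normal_form_exists: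
  fixes H :: "real^'n::{finite,linorder} \<Rightarrow> real^'n::_ \<Rightarrow> real^'n::_"
  assumes adm: "admissible b H" and flat: "flat_product H"
  shows "\<exists>\<phi> l. normal_form b H \<phi> l"
proof -
  have b: "inner_product b" and H: "bilinear H" using adm by (auto simp: admissible_def)
  note [simp] = inner_product_simps[OF b] bilinear_simps[OF H]
  obtain f m where fm: "\<forall>i<CARD('n). \<forall>j<CARD('n). b (f i) (f j) = (if i = j then 1 else 0)"
    "\<forall>i<CARD('n). (0::real) \<le> m i" "\<forall>j<CARD('n). \<forall>i\<le>j. m j \<le> m i"
    "\<forall>i<CARD('n). \<forall>j<CARD('n). H (f i) (f j) = (if i = j then m i *\<^sub>R f i else 0)"
    using partial_eigenframe_exists[OF adm flat order_refl] by blast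
  have orth: "b (f i) (f j) = (if i = j then 1 else 0)" if "i < CARD('n)" "j < CARD('n)" for i j
    using fm(1) that by blast
  have m0: "0 \<le> m i" if "i < CARD('n)" for i using fm(2) that by blast
  have dec: "m j \<le> m i" if "j < CARD('n)" "i \<le> j" for i j using fm(3) that by blast
  have eig: "H (f i) (f j) = (if i = j then m i *\<^sub>R f i else 0)" if "i < CARD('n)" "j < CARD('n)" for i j
    using fm(4) that by blast
  define F where "F i = f (position i)" for i :: 'n
  define l :: "real^'n::_" where "l = (\<chi> i. m (position i))"
  define \<phi> where "\<phi> x = (\<Sum>i\<in>UNIV. x $ i *\<^sub>R F i)" for x :: "real^'n::_"
  have lin: "linear \<phi>"
    by (auto intro!: linearI simp: \<phi>_def scaleR_add_left sum.distrib scaleR_sum_right)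
  have orthF: "b (F i) (F j) = (if i = j then 1 else 0)" for i j
    by (simp add: F_def orth position_bound)
  have eigF: "H (F i) (F j) = (if i = j then l $ i *\<^sub>R F i else 0)" for i j
    by (simp add: F_def l_def eig position_bound)
  have iso: "b (\<phi> x) (\<phi> y) = x \<bullet> y" for x y
    by (simp add: \<phi>_def inner_product_sum[OF b] orthF inner_vec_def if_distrib mult.commute cong: if_cong)
  have "inj \<phi>"
  proof (subst linear_injective_0[OF lin], intro allI impI)
    fix x assume "\<phi> x = 0"
    then have "x \<bullet> x = 0" using iso[of x x] by simp
    then show "x = 0" by simp
  qed
  then have "bij \<phi>" using lin by (simp add: bij_def linear_injective_imp_surjective)
  moreover have "H (\<phi> x) (\<phi> y) = \<phi> (diag_product l x y)" for x y
  proof -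
    have lH: "linear (H z)" "linear (\<lambda>z. H z w)" for z w using H by (auto simp: bilinear_def)
    have "H (\<phi> x) (\<phi> y) = (\<Sum>i\<in>UNIV. \<Sum>j\<in>UNIV. (x $ i * y $ j) *\<^sub>R H (F i) (F j))"
      by (simp add: \<phi>_def linear_sum[OF lH(1)] linear_sum[OF lH(2)] scaleR_sum_right, subst sum.swap)
        (simp add: mult.commute)
    also have "\<dots> = (\<Sum>i\<in>UNIV. \<Sum>j\<in>UNIV. if i = j then (l $ i * x $ i * y $ i) *\<^sub>R F i else 0)"
      by (intro sum.cong refl) (simp add: eigF mult_ac)
    also have "\<dots> = \<phi> (diag_product l x y)" by (simp add: \<phi>_def diag_product_def)
    finally show ?thesis .
  qed
  moreover have "l \<in> chamber"
    by (auto simp: chamber_def l_def m0 position_bound intro: dec position_mono)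
  ultimately have "normal_form b H \<phi> l" using lin iso by (simp add: normal_form_def Aut_iff)
  then show ?thesis by blast
qed

text \<open>Weighting the sets \<open>{i. t \<le> l i}\<close> and \<open>{j. t \<le> l' j}\<close> by \<open>P\<close> shows that they have the same
  cardinality for each \<open>t\<close>, and an antitone sequence is determined by these cardinalities.\<close>

lemma antimono_unique:
  fixes l l' :: "'n::{finite,linorder} \<Rightarrow> real" and P :: "'n \<Rightarrow> 'n \<Rightarrow> real"
  assumes anti: "\<And>i j. i \<le> j \<Longrightarrow> l j \<le> l i" "\<And>i j. i \<le> j \<Longrightarrow> l' j \<le> l' i"
    and row: "\<And>i. (\<Sum>j\<in>UNIV. P i j) = 1" and col: "\<And>j. (\<Sum>i\<in>UNIV. P i j) = 1"
    and eq: "\<And>i j. P i j \<noteq> 0 \<Longrightarrow> l i = l' j"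
  shows "l = l'"
proof -
  have card_eq: "card {i. t \<le> l i} = card {j. t \<le> l' j}" for t
  proof -
    have "real (card {i. t \<le> l i}) = (\<Sum>i\<in>UNIV. if t \<le> l i then 1 else 0)" by (simp add: sum.If_cases)
    also have "\<dots> = (\<Sum>i\<in>UNIV. \<Sum>j\<in>UNIV. if t \<le> l i then P i j else 0)"
      by (intro sum.cong refl) (simp add: row)
    also have "\<dots> = (\<Sum>i\<in>UNIV. \<Sum>j\<in>UNIV. if t \<le> l' j then P i j else 0)"
      by (intro sum.cong refl) (metis eq)
    also have "\<dots> = (\<Sum>j\<in>UNIV. \<Sum>i\<in>UNIV. if t \<le> l' j then P i j else 0)" by (rule sum.swap)
    also have "\<dots> = (\<Sum>j\<in>UNIV. if t \<le> l' j then 1 else 0)"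
      by (intro sum.cong refl) (simp add: col)
    also have "\<dots> = real (card {j. t \<le> l' j})" by (simp add: sum.If_cases)
    finally show ?thesis by simp
  qed
  have le: "a m \<le> a' m" if a: "\<And>i j. i \<le> j \<Longrightarrow> a j \<le> a i" "\<And>i j. i \<le> j \<Longrightarrow> a' j \<le> a' i"
    and c: "\<And>t. card {i. t \<le> a i} = card {j. t \<le> a' j}" for a a' :: "'n \<Rightarrow> real" and m
  proof (rule ccontr)
    assume n: "\<not> a m \<le> a' m"
    have "{j. a m \<le> a' j} \<subseteq> {j. j < m}" using a(2) n by (force simp: not_le)
    then have "card {j. a m \<le> a' j} \<le> card {j. j < m}" by (intro card_mono) auto
    also have "\<dots> < card {j. j \<le> m}" by (intro psubset_card_mono) auto
    also have "\<dots> \<le> card {i. a m \<le> a i}" using a(1) by (intro card_mono) auto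
    finally show False using c[of "a m"] by simp
  qed
  show ?thesis
    using le[of l l', OF anti card_eq] le[of l' l, OF anti(2,1) card_eq[symmetric]] by (auto intro: antisym)
qed

text \<open>Two normalising frames differ by an orthogonal matrix, and \<open>H\<close> is diagonal in both frames. So a
  nonzero entry \<open>z\<close> of that matrix satisfies \<open>l' = l z\<close>, where \<open>z \<le> 1\<close>, hence \<open>l' \<le> l\<close>; by symmetry a nonzero
  entry links equal coefficients. The squared entries have row and column sums \<open>1\<close>.\<close>

theorem normal_form_unique:
  fixes H :: "real^'n::{finite,linorder} \<Rightarrow> real^'n::_ \<Rightarrow> real^'n::_"
  assumes 1: "normal_form b H \<phi> l" and 2: "normal_form b H \<psi> l'"
  shows "l = l'"
proof -
  define e where "e i = (axis i 1 :: real^'n::_)" for i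
  have diag_e: "diag_product k (e i) (e i) = k $ i *\<^sub>R e i" for k i
    by (simp add: diag_product_def e_def axis_def vec_eq_iff)
  define Q where "Q i j = b (\<phi> (e i)) (\<psi> (e j))" for i j
  have transition: "(\<Sum>i\<in>UNIV. (b (\<alpha> (e i)) (\<beta> (e j)))\<^sup>2) = 1 \<and>
      (\<forall>i. b (\<alpha> (e i)) (\<beta> (e j)) \<noteq> 0 \<longrightarrow> k' $ j \<le> k $ i)"
    if a: "normal_form b H \<alpha> k" and c: "normal_form b H \<beta> k'" for \<alpha> \<beta> k k' j
  proof -
    have ai: "b (\<alpha> x) (\<alpha> y) = x \<bullet> y" "H (\<alpha> x) (\<alpha> y) = \<alpha> (diag_product k x y)" for x y
      using a by (auto simp: normal_form_def)
    have ci: "b (\<beta> x) (\<beta> y) = x \<bullet> y" "H (\<beta> x) (\<beta> y) = \<beta> (diag_product k' x y)" for x y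
      using c by (auto simp: normal_form_def)
    have lin: "linear \<alpha>" "linear \<beta>" "bij \<alpha>" using a c by (auto simp: normal_form_def Aut_iff)
    obtain z where z: "\<alpha> z = \<beta> (e j)" using lin(3) bij_pointE by metis
    have comp: "b (\<alpha> (e i)) (\<beta> (e j)) = z $ i" for i
      unfolding z[symmetric] ai(1) by (simp add: e_def inner_axis')
    have one: "(\<Sum>i\<in>UNIV. (z $ i)\<^sup>2) = 1"
    proof -
      have "z \<bullet> z = e j \<bullet> e j" using z ai(1) ci(1) by metis
      then show ?thesis by (simp add: inner_vec_def e_def power2_eq_square axis_def if_distrib cong: if_cong)
    qed
    have "\<alpha> (k' $ j *\<^sub>R z) = \<beta> (k' $ j *\<^sub>R e j)" by (simp add: linear_cmul[OF lin(1)] linear_cmul[OF lin(2)] z)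
    also have "\<dots> = \<alpha> (diag_product k z z)" using ai(2)[of z z] ci(2)[of "e j" "e j"] by (simp add: z diag_e)
    finally have "k' $ j *\<^sub>R z = diag_product k z z" using lin(3) by (simp add: bij_is_inj inj_eq)
    then have zi: "k' $ j * z $ i = k $ i * z $ i * z $ i" for i by (simp add: diag_product_def vec_eq_iff)
    have "k' $ j \<le> k $ i" if "z $ i \<noteq> 0" for i
    proof -
      have "(z $ i)\<^sup>2 \<le> (\<Sum>i\<in>UNIV. (z $ i)\<^sup>2)" by (rule member_le_sum) auto
      then have "z $ i \<le> 1" using one power2_le_imp_le[of "z $ i" 1] by simp
      moreover have "k' $ j = k $ i * z $ i" using zi[of i] that by simp
      moreover have "0 \<le> k $ i" using a by (simp add: normal_form_def chamber_def)
      ultimately show ?thesis using mult_left_le by simp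
    qed
    then show ?thesis by (simp add: comp one)
  qed
  have bsym: "b (\<psi> (e j)) (\<phi> (e i)) = Q i j" for i j
  proof -
    obtain z where z: "\<phi> z = \<psi> (e j)" using 1 bij_pointE unfolding normal_form_def Aut_iff by metis
    have iso: "b (\<phi> x) (\<phi> y) = x \<bullet> y" for x y using 1 by (simp add: normal_form_def)
    show ?thesis unfolding Q_def z[symmetric] iso by (rule inner_commute)
  qed
  have "(\<lambda>i. l $ i) = (\<lambda>i. l' $ i)"
  proof (rule antimono_unique[where P = "\<lambda>i j. (Q i j)\<^sup>2"])
    show "l $ j \<le> l $ i" "l' $ j \<le> l' $ i" if "i \<le> j" for i j
      using 1 2 that by (auto simp: normal_form_def chamber_def)
    show "(\<Sum>j\<in>UNIV. (Q i j)\<^sup>2) = 1" for i using transition[OF 2 1, of i] by (simp add: bsym)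
    show "(\<Sum>i\<in>UNIV. (Q i j)\<^sup>2) = 1" for j using transition[OF 1 2, of j] by (simp add: Q_def)
    show "l $ i = l' $ j" if "(Q i j)\<^sup>2 \<noteq> 0" for i j
      using that transition[OF 1 2, of j] transition[OF 2 1, of i] bsym[of j i]
      by (auto simp: Q_def intro: antisym)
  qed
  then show ?thesis by (simp add: vec_eq_iff fun_eq_iff)
qed

section \<open>The coefficients of a flat structure and their continuity\<close>

definition diag_tensor :: "real^'n \<Rightarrow> ('n::finite) tensor3" where
  "diag_tensor l = (\<lambda>u v w. diag_product l u v \<bullet> w)"

definition tensor_normal_form :: "'n tensor2 \<Rightarrow> 'n tensor3 \<Rightarrow> 'n vfield \<Rightarrow> real^'n::{finite,linorder} \<Rightarrow> bool" where
  "tensor_normal_form b C \<phi> l \<longleftrightarrow> \<phi> \<in> Aut \<and> l \<in> chamber \<and> (\<forall>x y. b (\<phi> x) (\<phi> y) = x \<bullet> y) \<and>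
     (\<forall>x y z. C (\<phi> x) (\<phi> y) (\<phi> z) = diag_tensor l x y z)"

text \<open>Expressed by the coordinates of the structure, because these define the topology.\<close>

definition cubic_coeffs :: "('n::{finite,linorder}) metric \<times> 'n connection \<Rightarrow> real^'n::{finite,linorder}" where
  "cubic_coeffs s = (THE l. \<exists>\<phi>. tensor_normal_form (fst (lstat_coords s)) (snd (lstat_coords s)) \<phi> l)"

lemma tensor_normal_form_iff:
  fixes G :: "real^'n::{finite,linorder} \<Rightarrow> real^'n::_ \<Rightarrow> real^'n::_"
  assumes b: "inner_product b"
  shows "tensor_normal_form b (\<lambda>u v w. - 2 * b (G u v) w) \<phi> l \<longleftrightarrow> normal_form b (\<lambda>u v. - 2 *\<^sub>R G u v) \<phi> l"
proof -
  have "(\<forall>x y z. - 2 * b (G (\<phi> x) (\<phi> y)) (\<phi> z) = diag_tensor l x y z) \<longleftrightarrow>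
      (\<forall>x y. - 2 *\<^sub>R G (\<phi> x) (\<phi> y) = \<phi> (diag_product l x y))"
    if a: "\<phi> \<in> Aut" and iso: "\<forall>x y. b (\<phi> x) (\<phi> y) = x \<bullet> y"
  proof (intro iffI allI)
    fix x y
    assume L: "\<forall>x y z. - 2 * b (G (\<phi> x) (\<phi> y)) (\<phi> z) = diag_tensor l x y z"
    show "- 2 *\<^sub>R G (\<phi> x) (\<phi> y) = \<phi> (diag_product l x y)"
    proof (rule inner_product_eqI[OF b])
      fix w obtain z where z: "w = \<phi> z" using a bij_pointE unfolding Aut_iff by metis
      have "b (- 2 *\<^sub>R G (\<phi> x) (\<phi> y)) w = - 2 * b (G (\<phi> x) (\<phi> y)) (\<phi> z)"
        by (simp only: z inner_product_simps(3)[OF b])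
      also have "\<dots> = diag_product l x y \<bullet> z" using L by (simp add: diag_tensor_def)
      also have "\<dots> = b (\<phi> (diag_product l x y)) w" using iso by (simp add: z)
      finally show "b (- 2 *\<^sub>R G (\<phi> x) (\<phi> y)) w = b (\<phi> (diag_product l x y)) w" .
    qed
  next
    fix x y z
    assume R: "\<forall>x y. - 2 *\<^sub>R G (\<phi> x) (\<phi> y) = \<phi> (diag_product l x y)"
    have "- 2 * b (G (\<phi> x) (\<phi> y)) (\<phi> z) = b (- 2 *\<^sub>R G (\<phi> x) (\<phi> y)) (\<phi> z)"
      by (simp only: inner_product_simps(3)[OF b])
    also have "\<dots> = b (\<phi> (diag_product l x y)) (\<phi> z)" using R by metis
    finally show "- 2 * b (G (\<phi> x) (\<phi> y)) (\<phi> z) = diag_tensor l x y z"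
      using iso by (simp add: diag_tensor_def)
  qed
  then show ?thesis unfolding tensor_normal_form_def normal_form_def by blast
qed

lemma admissible_scale: "admissible b G \<Longrightarrow> admissible b (\<lambda>u v. c *\<^sub>R G u v)"
  by (auto simp: admissible_def inner_product_simps bilinear_def linear_compose_scale_right)

lemma flat_product_scale:
  assumes "bilinear G" "flat_product G" shows "flat_product (\<lambda>u v. c *\<^sub>R G u v)"
  using assms(2) by (simp add: flat_product_def bilinear_simps[OF assms(1)])

lemma normal_form_coeffs:
  assumes adm: "admissible b G"
  shows "normal_form b (\<lambda>u v. - 2 *\<^sub>R G u v) \<phi> l \<Longrightarrow> cubic_coeffs (const_structure b G) = l"
    "flat_product G \<Longrightarrow> \<exists>\<phi>. normal_form b (\<lambda>u v. - 2 *\<^sub>R G u v) \<phi> (cubic_coeffs (const_structure b G))"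
proof -
  have b: "inner_product b" and G: "bilinear G" using adm by (auto simp: admissible_def)
  have c: "cubic_coeffs (const_structure b G) = (THE l. \<exists>\<phi>. normal_form b (\<lambda>u v. - 2 *\<^sub>R G u v) \<phi> l)"
    by (simp add: cubic_coeffs_def lstat_coords_const[OF adm] tensor_normal_form_iff[OF b, simplified])
  show 1: "cubic_coeffs (const_structure b G) = l" if "normal_form b (\<lambda>u v. - 2 *\<^sub>R G u v) \<phi> l" for \<phi> l
    unfolding c using that normal_form_unique by (intro the_equality) blast+
  show "\<exists>\<phi>. normal_form b (\<lambda>u v. - 2 *\<^sub>R G u v) \<phi> (cubic_coeffs (const_structure b G))" if "flat_product G"
    using normal_form_exists[OF admissible_scale[OF adm] flat_product_scale[OF G that]] 1 by metis
qed

definition bform :: "real^'n^'n \<Rightarrow> ('n::finite) tensor2" where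
  "bform B u v = (\<Sum>i\<in>UNIV. \<Sum>j\<in>UNIV. B $ i $ j * (u $ i * v $ j))"

definition tform :: "real^'n^'n^'n \<Rightarrow> ('n::finite) tensor3" where
  "tform T u v w = (\<Sum>i\<in>UNIV. \<Sum>j\<in>UNIV. \<Sum>k\<in>UNIV. T $ i $ j $ k * (u $ i * v $ j * w $ k))"

text \<open>Passing to the components on the standard basis replaces the topology of pointwise convergence by a metric one, in
  which continuity can be tested on sequences.\<close>

definition entries :: "('n::finite) tensor2 \<times> 'n tensor3 \<Rightarrow> (real^'n^'n) \<times> (real^'n^'n^'n)" where
  "entries = (\<lambda>(b, C). (\<chi> i j. b (axis i 1) (axis j 1), \<chi> i j k. C (axis i 1) (axis j 1) (axis k 1)))"

lemma bilinear_entries: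
  fixes b :: "real^'n::finite \<Rightarrow> real^'n \<Rightarrow> 'b::real_vector"
  assumes "bilinear b"
  shows "b u v = (\<Sum>i\<in>UNIV. \<Sum>j\<in>UNIV. (u $ i * v $ j) *\<^sub>R b (axis i 1) (axis j 1))"
proof -
  have l: "linear (b u)" "linear (\<lambda>u. b u w)" for u w using assms by (auto simp: bilinear_def)
  have "b u v = b (\<Sum>i\<in>UNIV. (u $ i) *\<^sub>R axis i 1) (\<Sum>j\<in>UNIV. (v $ j) *\<^sub>R axis j 1)"
    by (rule arg_cong2[OF vec_expansion vec_expansion])
  then show ?thesis
    by (simp add: linear_sum[OF l(2)] linear_cmul[OF l(2)] linear_sum[OF l(1)] linear_cmul[OF l(1)]
        scaleR_sum_right mult.commute, subst sum.swap) (simp add: mult.commute)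
qed

lemma bform_entries:
  assumes "bilinear b" shows "bform (fst (entries (b, C))) = b"
proof (intro ext)
  fix u v show "bform (fst (entries (b, C))) u v = b u v"
    using bilinear_entries[OF assms, of u v] by (simp add: bform_def entries_def mult_ac)
qed

lemma tform_entries:
  assumes b: "inner_product b" and G: "bilinear G"
  shows "tform (snd (entries (b, \<lambda>u v w. c * b (G u v) w))) = (\<lambda>u v w. c * b (G u v) w)"
proof (intro ext)
  fix u v w
  have "b (G u v) w = (\<Sum>i\<in>UNIV. \<Sum>j\<in>UNIV. u $ i * v $ j * b (G (axis i 1) (axis j 1)) w)"
    by (subst bilinear_entries[OF G]) (simp add: inner_product_sum[OF b] inner_product_simps[OF b])
  moreover have "b x w = (\<Sum>k\<in>UNIV. w $ k * b x (axis k 1))" for x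
  proof -
    have "b x w = b x (\<Sum>k\<in>UNIV. w $ k *\<^sub>R axis k 1)" by (metis vec_expansion)
    then show ?thesis by (simp add: inner_product_sum[OF b] inner_product_simps[OF b])
  qed
  ultimately have "b (G u v) w = (\<Sum>i\<in>UNIV. \<Sum>j\<in>UNIV. u $ i * v $ j * (\<Sum>k\<in>UNIV. w $ k * b (G (axis i 1) (axis j 1)) (axis k 1)))"
    by simp
  then show "tform (snd (entries (b, \<lambda>u v w. c * b (G u v) w))) u v w = c * b (G u v) w"
    by (simp add: tform_def entries_def sum_distrib_left mult_ac)
qed

definition matrix_normal_form :: "(real^'n::_^'n::_) \<times> (real^'n::_^'n::_^'n::_) \<Rightarrow> real^'n::_^'n::_ \<Rightarrow> real^'n::{finite,linorder} \<Rightarrow> bool" where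
  "matrix_normal_form X A l \<longleftrightarrow> l \<in> chamber \<and> (\<forall>x y. bform (fst X) (A *v x) (A *v y) = x \<bullet> y) \<and>
     (\<forall>x y z. tform (snd X) (A *v x) (A *v y) (A *v z) = diag_tensor l x y z)"

text \<open>Invertibility of the frame is a consequence of orthonormality, so the matrix version
  consists of closed conditions only and passes to limits.\<close>

lemma matrix_normal_form_iff:
  fixes X :: "(real^'n::{finite,linorder}^'n::_) \<times> (real^'n::_^'n::_^'n::_)"
  shows "(\<exists>A. matrix_normal_form X A l) \<longleftrightarrow> (\<exists>\<phi>. tensor_normal_form (bform (fst X)) (tform (snd X)) \<phi> l)"
proof
  assume "\<exists>A. matrix_normal_form X A l"
  then obtain A where A: "matrix_normal_form X A l" by blast
  have "inj ((*v) A)"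
  proof (subst linear_injective_0[OF matrix_vector_mul_linear], intro allI impI)
    fix x :: "real^'n::_" assume "A *v x = 0"
    moreover have "x \<bullet> x = bform (fst X) (A *v x) (A *v x)" using A by (simp add: matrix_normal_form_def)
    ultimately have "x \<bullet> x = bform (fst X) 0 0" by simp
    then show "x = 0" by (simp add: bform_def)
  qed
  then have "(*v) A \<in> Aut"
    by (simp add: Aut_iff bij_def linear_injective_imp_surjective)
  then show "\<exists>\<phi>. tensor_normal_form (bform (fst X)) (tform (snd X)) \<phi> l"
    using A by (intro exI[of _ "(*v) A"]) (simp add: tensor_normal_form_def matrix_normal_form_def)
next
  assume "\<exists>\<phi>. tensor_normal_form (bform (fst X)) (tform (snd X)) \<phi> l"
  then obtain \<phi> where t: "tensor_normal_form (bform (fst X)) (tform (snd X)) \<phi> l" by blast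
  then have "linear \<phi>" by (simp add: tensor_normal_form_def Aut_iff)
  then have "matrix \<phi> *v x = \<phi> x" for x by (simp add: matrix_works)
  then show "\<exists>A. matrix_normal_form X A l"
    using t by (intro exI[of _ "matrix \<phi>"]) (simp add: tensor_normal_form_def matrix_normal_form_def)
qed

lemma tendsto_bform:
  assumes "(B \<longlongrightarrow> B') F" "(u \<longlongrightarrow> u') F" "(v \<longlongrightarrow> v') F"
  shows "((\<lambda>n. bform (B n) (u n) (v n)) \<longlongrightarrow> bform B' u' v') F"
  unfolding bform_def by (intro tendsto_intros assms)

lemma tendsto_tform:
  assumes "(T \<longlongrightarrow> T') F" "(u \<longlongrightarrow> u') F" "(v \<longlongrightarrow> v') F" "(w \<longlongrightarrow> w') F"
  shows "((\<lambda>n. tform (T n) (u n) (v n) (w n)) \<longlongrightarrow> tform T' u' v' w') F"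
  unfolding tform_def by (intro tendsto_intros assms)

lemma tendsto_matrix_vector:
  fixes A :: "'b \<Rightarrow> real^'n::finite^'m::finite"
  assumes "(A \<longlongrightarrow> A') F" shows "((\<lambda>n. A n *v x) \<longlongrightarrow> A' *v x) F"
  unfolding matrix_vector_mult_def
  by (intro vec_tendstoI) (simp, intro tendsto_intros assms)

lemma bform_le:
  fixes B :: "real^'n::finite^'n"
  shows "\<bar>bform B v v\<bar> \<le> (\<Sum>i\<in>UNIV. \<Sum>j\<in>UNIV. \<bar>B $ i $ j\<bar>) * (norm v)\<^sup>2"
proof -
  have "\<bar>bform B v v\<bar> \<le> (\<Sum>i\<in>UNIV. \<bar>\<Sum>j\<in>UNIV. B $ i $ j * (v $ i * v $ j)\<bar>)"
    unfolding bform_def by (rule sum_abs)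
  also have "\<dots> \<le> (\<Sum>i\<in>UNIV. \<Sum>j\<in>UNIV. \<bar>B $ i $ j * (v $ i * v $ j)\<bar>)"
    by (intro sum_mono sum_abs)
  also have "\<dots> \<le> (\<Sum>i\<in>UNIV. \<Sum>j\<in>UNIV. \<bar>B $ i $ j\<bar> * (norm v)\<^sup>2)"
  proof (intro sum_mono)
    fix i j :: 'n
    have "\<bar>v $ i\<bar> * \<bar>v $ j\<bar> \<le> norm v * norm v"
      by (intro mult_mono component_le_norm_cart) auto
    then show "\<bar>B $ i $ j * (v $ i * v $ j)\<bar> \<le> \<bar>B $ i $ j\<bar> * (norm v)\<^sup>2"
      by (simp add: abs_mult power2_eq_square mult_left_mono)
  qed
  finally show ?thesis by (simp add: sum_distrib_right)
qed

lemma eventually_bform_lower_bound: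
  fixes B :: "nat \<Rightarrow> real^'n::finite^'n"
  assumes lim: "B \<longlonglongrightarrow> B'" and pos: "inner_product (bform B')"
  shows "\<exists>m>0. eventually (\<lambda>n. \<forall>v. m * (norm v)\<^sup>2 \<le> bform (B n) v v) sequentially"
proof -
  obtain m where m: "m > 0" "\<And>v. m * (norm v)\<^sup>2 \<le> bform B' v v"
    using inner_product_lower_bound[OF pos] by blast
  have "(\<lambda>n. \<Sum>i\<in>UNIV. \<Sum>j\<in>UNIV. \<bar>(B n - B') $ i $ j\<bar>) \<longlonglongrightarrow> (\<Sum>i\<in>UNIV. \<Sum>j\<in>UNIV. \<bar>(B' - B') $ i $ j\<bar>)"
    by (intro tendsto_intros lim)
  then have "(\<lambda>n. \<Sum>i\<in>UNIV. \<Sum>j\<in>UNIV. \<bar>(B n - B') $ i $ j\<bar>) \<longlonglongrightarrow> 0" by simp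
  then have "eventually (\<lambda>n. (\<Sum>i\<in>UNIV. \<Sum>j\<in>UNIV. \<bar>(B n - B') $ i $ j\<bar>) < m / 2) sequentially"
    by (rule order_tendstoD) (use m in simp)
  then have "eventually (\<lambda>n. \<forall>v. m / 2 * (norm v)\<^sup>2 \<le> bform (B n) v v) sequentially"
  proof (rule eventually_mono, intro allI)
    fix n v assume d: "(\<Sum>i\<in>UNIV. \<Sum>j\<in>UNIV. \<bar>(B n - B') $ i $ j\<bar>) < m / 2"
    have "bform (B n) v v = bform B' v v + bform (B n - B') v v"
      by (simp add: bform_def sum.distrib[symmetric] left_diff_distrib)
    moreover have "\<bar>bform (B n - B') v v\<bar> \<le> m / 2 * (norm v)\<^sup>2"
      using bform_le[of "B n - B'" v] mult_right_mono[OF less_imp_le[OF d], of "(norm v)\<^sup>2"] by simp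
    moreover have "m * (norm v)\<^sup>2 \<le> bform B' v v" by (rule m(2))
    ultimately show "m / 2 * (norm v)\<^sup>2 \<le> bform (B n) v v" by (simp add: field_simps)
  qed
  then show ?thesis using m(1) by (intro exI[of _ "m / 2"]) auto
qed

lemma norm_matrix_le:
  fixes A :: "real^'n::finite^'m::finite"
  assumes "\<And>j. norm (A *v axis j 1) \<le> K" shows "norm A \<le> real CARD('m) * (real CARD('n) * K)"
proof -
  have "norm A \<le> (\<Sum>i\<in>UNIV. norm (A $ i))" unfolding norm_vec_def by (rule L2_set_le_sum) simp
  also have "\<dots> \<le> (\<Sum>i\<in>(UNIV::'m set). \<Sum>j\<in>(UNIV::'n set). \<bar>A $ i $ j\<bar>)"
    by (intro sum_mono norm_le_l1_cart)
  also have "\<dots> \<le> (\<Sum>i\<in>(UNIV::'m set). \<Sum>j\<in>(UNIV::'n set). K)"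
  proof (intro sum_mono)
    fix i j
    have "\<bar>A $ i $ j\<bar> = \<bar>(A *v axis j 1) $ i\<bar>" by (simp add: matrix_vector_mult_basis column_def)
    also have "\<dots> \<le> K" using component_le_norm_cart assms order_trans by blast
    finally show "\<bar>A $ i $ j\<bar> \<le> K" .
  qed
  finally show ?thesis by simp
qed

lemma tendsto_by_subsequences:
  fixes x :: "nat \<Rightarrow> 'a::metric_space"
  assumes "\<And>r :: nat \<Rightarrow> nat. strict_mono r \<Longrightarrow> \<exists>s :: nat \<Rightarrow> nat. (\<lambda>n. x (r (s n))) \<longlonglongrightarrow> L"
  shows "x \<longlonglongrightarrow> L"
proof (rule ccontr)
  assume "\<not> x \<longlonglongrightarrow> L"
  then obtain e where e: "e > 0" "\<not> eventually (\<lambda>n. dist (x n) L < e) sequentially"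
    by (auto simp: tendsto_iff)
  then have "infinite {n. \<not> dist (x n) L < e}"
    by (simp add: not_eventually cofinite_eq_sequentially[symmetric] frequently_cofinite)
  then obtain r :: "nat \<Rightarrow> nat" where r: "strict_mono r" "\<And>n. r n \<in> {n. \<not> dist (x n) L < e}"
    using infinite_enumerate by blast
  obtain s where "(\<lambda>n. x (r (s n))) \<longlonglongrightarrow> L" using assms[OF r(1)] by blast
  then have "eventually (\<lambda>n. dist (x (r (s n))) L < e) sequentially" using e(1) by (rule tendstoD)
  then show False using r(2) by (auto simp: eventually_sequentially)
qed

text \<open>The normalising frames of a convergent sequence of structures are bounded, because the metrics
  are bounded below. Along a subsequence on which the frames converge, the coefficients, which are the
  values of the cubic form on the frame vectors, converge to the coefficients of a normal form
  of the limit; those are unique.\<close>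

lemma matrix_coeffs_continuous:
  fixes S :: "((real^'n::{finite,linorder}^'n::_) \<times> (real^'n::_^'n::_^'n::_)) set"
  assumes pos: "\<And>X. X \<in> S \<Longrightarrow> inner_product (bform (fst X))"
    and ex: "\<And>X. X \<in> S \<Longrightarrow> \<exists>A. matrix_normal_form X A (k X)"
    and un: "\<And>X A l. X \<in> S \<Longrightarrow> matrix_normal_form X A l \<Longrightarrow> l = k X"
  shows "continuous_on S k"
proof (rule continuous_on_sequentiallyI)
  fix X :: "nat \<Rightarrow> (real^'n::_^'n::_) \<times> (real^'n::_^'n::_^'n::_)" and Y
  assume X: "\<forall>n. X n \<in> S" and Y: "Y \<in> S" and lim: "X \<longlonglongrightarrow> Y"
  have "\<forall>n. \<exists>A. matrix_normal_form (X n) A (k (X n))" using ex X by blast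
  then have "\<exists>A. \<forall>n. matrix_normal_form (X n) (A n) (k (X n))" by (rule choice)
  then obtain A where A: "\<And>n. matrix_normal_form (X n) (A n) (k (X n))" by blast
  obtain m where m: "m > 0" "eventually (\<lambda>n. \<forall>v. m * (norm v)\<^sup>2 \<le> bform (fst (X n)) v v) sequentially"
    using eventually_bform_lower_bound[OF tendsto_fst[OF lim] pos[OF Y]] by blast
  then obtain N where N: "\<And>n v. n \<ge> N \<Longrightarrow> m * (norm v)\<^sup>2 \<le> bform (fst (X n)) v v"
    by (auto simp: eventually_sequentially)
  have bound: "norm (A n) \<le> real CARD('n) * (real CARD('n) * sqrt (1 / m))" if n: "n \<ge> N" for n
  proof (rule norm_matrix_le)
    fix j
    have "m * (norm (A n *v axis j 1))\<^sup>2 \<le> 1"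
      using N[OF n, of "A n *v axis j 1"] A[of n] by (simp add: matrix_normal_form_def inner_axis_axis)
    then show "norm (A n *v axis j 1) \<le> sqrt (1 / m)"
      using m(1) by (intro real_le_rsqrt) (simp add: field_simps)
  qed
  show "(\<lambda>n. k (X n)) \<longlonglongrightarrow> k Y"
  proof (rule tendsto_by_subsequences)
    fix r :: "nat \<Rightarrow> nat" assume r: "strict_mono r"
    have "r (n + N) \<ge> N" for n using seq_suble[OF r, of "n + N"] by simp
    then have "bounded (range (\<lambda>n. A (r (n + N))))"
      using bound by (auto simp: bounded_iff)
    then obtain A' s where s: "strict_mono s" and A': "(\<lambda>n. A (r (s n + N))) \<longlonglongrightarrow> A'"
      using bounded_imp_convergent_subsequence[of "\<lambda>n. A (r (n + N))"] by (auto simp: o_def)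
    define q where "q = (\<lambda>n. r (s n + N))"
    have "strict_mono q" using r s by (simp add: q_def strict_mono_def)
    then have Xq: "(\<lambda>n. X (q n)) \<longlonglongrightarrow> Y" using LIMSEQ_subseq_LIMSEQ[OF lim] by (simp add: o_def)
    have Aq: "(\<lambda>n. A (q n) *v x) \<longlonglongrightarrow> A' *v x" for x
      using A' by (intro tendsto_matrix_vector) (simp add: q_def)
    define l where "l = (\<chi> i. tform (snd Y) (A' *v axis i 1) (A' *v axis i 1) (A' *v axis i 1))"
    have kq: "k (X (q n)) $ i = tform (snd (X (q n))) (A (q n) *v axis i 1) (A (q n) *v axis i 1) (A (q n) *v axis i 1)" for n i
      using A[of "q n"] by (simp add: matrix_normal_form_def diag_tensor_def diag_product_def inner_axis)
    have lim_l: "(\<lambda>n. k (X (q n))) \<longlonglongrightarrow> l"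
    proof (rule vec_tendstoI)
      fix i show "(\<lambda>n. k (X (q n)) $ i) \<longlonglongrightarrow> l $ i"
        unfolding kq l_def vec_lambda_beta by (intro tendsto_tform tendsto_snd[OF Xq] Aq)
    qed
    have comp: "(\<lambda>n. k (X (q n)) $ i) \<longlonglongrightarrow> l $ i" for i by (intro tendsto_vec_nth lim_l)
    have mono: "k (X (q n)) $ j \<le> k (X (q n)) $ i" if "i \<le> j" for i j n
      using A[of "q n"] that by (simp add: matrix_normal_form_def chamber_def)
    have nonneg: "0 \<le> k (X (q n)) $ i" for i n
      using A[of "q n"] by (simp add: matrix_normal_form_def chamber_def)
    have "l \<in> chamber"
      unfolding chamber_def
      using LIMSEQ_le[OF comp comp] LIMSEQ_le_const[OF comp] mono nonneg by blast
    moreover have "bform (fst Y) (A' *v x) (A' *v y) = x \<bullet> y" for x y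
    proof (rule LIMSEQ_unique)
      show "(\<lambda>n. bform (fst (X (q n))) (A (q n) *v x) (A (q n) *v y)) \<longlonglongrightarrow> bform (fst Y) (A' *v x) (A' *v y)"
        by (intro tendsto_bform tendsto_fst[OF Xq] Aq)
      show "(\<lambda>n. bform (fst (X (q n))) (A (q n) *v x) (A (q n) *v y)) \<longlonglongrightarrow> x \<bullet> y"
        using A by (simp add: matrix_normal_form_def)
    qed
    moreover have "tform (snd Y) (A' *v x) (A' *v y) (A' *v z) = diag_tensor l x y z" for x y z
    proof (rule LIMSEQ_unique)
      show "(\<lambda>n. tform (snd (X (q n))) (A (q n) *v x) (A (q n) *v y) (A (q n) *v z)) \<longlonglongrightarrow> tform (snd Y) (A' *v x) (A' *v y) (A' *v z)"
        by (intro tendsto_tform tendsto_snd[OF Xq] Aq)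
      have "(\<lambda>n. diag_tensor (k (X (q n))) x y z) \<longlonglongrightarrow> diag_tensor l x y z"
        unfolding diag_tensor_def diag_product_def inner_vec_def
        by (simp, intro tendsto_intros comp)
      then show "(\<lambda>n. tform (snd (X (q n))) (A (q n) *v x) (A (q n) *v y) (A (q n) *v z)) \<longlonglongrightarrow> diag_tensor l x y z"
        using A by (simp add: matrix_normal_form_def)
    qed
    ultimately have "matrix_normal_form Y A' l" by (simp add: matrix_normal_form_def)
    then have "l = k Y" by (rule un[OF Y])
    with lim_l have "(\<lambda>n. k (X (r (s n + N)))) \<longlonglongrightarrow> k Y" by (simp add: q_def)
    then show "\<exists>s. (\<lambda>n. k (X (r (s n)))) \<longlonglongrightarrow> k Y" by (intro exI[of _ "\<lambda>n. s n + N"])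
  qed
qed

lemma topspace_LStat_DF: "topspace LStat_DF_topology = LStat_DF"
  by (auto simp: LStat_DF_topology_def LStat_topology_def topspace_pullback_topology LStat_DF_def)

lemma continuous_map_from_LStat_DF:
  "continuous_on UNIV f \<Longrightarrow> continuous_map LStat_DF_topology euclidean (\<lambda>s. f (lstat_coords s))"
  unfolding LStat_DF_topology_def LStat_topology_def
  using continuous_map_pullback[of euclidean euclidean f LStat lstat_coords]
  by (intro continuous_map_from_subtopology) (simp add: o_def)

lemma continuous_on_evaluation:
  "continuous_on UNIV (\<lambda>x. f x) \<Longrightarrow> continuous_on UNIV (\<lambda>x. f x i)"
  using continuous_on_compose2[OF continuous_on_product_coordinates, of UNIV f i] by simp

lemma continuous_entries: "continuous_on UNIV (entries :: ('n::finite) tensor2 \<times> 'n tensor3 \<Rightarrow> _)"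
proof -
  have "continuous_on UNIV (\<lambda>p :: 'n tensor2 \<times> 'n tensor3. fst p u v)" for u v
    by (rule continuous_on_evaluation, rule continuous_on_evaluation, rule continuous_on_fst, rule continuous_on_id)
  moreover have "continuous_on UNIV (\<lambda>p :: 'n tensor2 \<times> 'n tensor3. snd p u v w)" for u v w
    by (rule continuous_on_evaluation, rule continuous_on_evaluation, rule continuous_on_evaluation,
        rule continuous_on_snd, rule continuous_on_id)
  ultimately show ?thesis
    unfolding entries_def case_prod_beta
    by (intro continuous_on_Pair continuous_on_vec_lambda)
qed

theorem cubic_coeffs_continuous:
  "continuous_map (LStat_DF_topology :: (('n::{finite,linorder}) metric \<times> 'n connection) topology) euclidean cubic_coeffs"
proof -
  define E where "E = (\<lambda>s :: 'n metric \<times> 'n connection. entries (lstat_coords s))"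
  define k where "k = (\<lambda>X :: (real^'n::_^'n::_) \<times> (real^'n::_^'n::_^'n::_). THE l. \<exists>A. matrix_normal_form X A l)"
  let ?S = "E ` (LStat_DF :: ('n metric \<times> 'n connection) set)"
  have key: "bform (fst (E s)) = b \<and> cubic_coeffs s = k (E s) \<and> (\<exists>A. matrix_normal_form (E s) A (cubic_coeffs s)) \<and>
      (\<forall>A l. matrix_normal_form (E s) A l \<longrightarrow> l = cubic_coeffs s)"
    if s: "s = const_structure b G" and adm: "admissible b G" and flat: "flat_product G" for s b G
  proof -
    have b: "inner_product b" and G: "bilinear G" using adm by (auto simp: admissible_def)
    have E: "E s = entries (b, \<lambda>u v w. - 2 * b (G u v) w)" by (simp add: E_def s lstat_coords_const[OF adm])
    have f: "bform (fst (E s)) = b" unfolding E using b by (simp add: bform_entries inner_product_def)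
    have t: "tform (snd (E s)) = (\<lambda>u v w. - 2 * b (G u v) w)" unfolding E by (rule tform_entries[OF b G])
    have iff: "(\<exists>A. matrix_normal_form (E s) A l) \<longleftrightarrow> (\<exists>\<phi>. normal_form b (\<lambda>u v. - 2 *\<^sub>R G u v) \<phi> l)" for l
      by (simp only: matrix_normal_form_iff f t tensor_normal_form_iff[OF b])
    have ex: "\<exists>A. matrix_normal_form (E s) A (cubic_coeffs s)"
      using iff[of "cubic_coeffs s"] normal_form_coeffs(2)[OF adm flat] unfolding s[symmetric] by blast
    have un: "l = cubic_coeffs s" if m: "matrix_normal_form (E s) A l" for A l
    proof -
      obtain \<phi> where "normal_form b (\<lambda>u v. - 2 *\<^sub>R G u v) \<phi> l" using m iff[of l] by blast
      then show ?thesis unfolding s by (rule normal_form_coeffs(1)[OF adm, symmetric])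
    qed
    have "k (E s) = cubic_coeffs s" unfolding k_def using ex un by (intro the_equality) blast+
    with f ex un show ?thesis by auto
  qed
  have "continuous_on ?S k"
  proof (rule matrix_coeffs_continuous)
    fix X assume "X \<in> ?S"
    then obtain b G where X: "X = E (const_structure b G)" and adm: "admissible b G" and flat: "flat_product G"
      by (auto simp: LStat_DF_eq)
    note K = key[OF refl adm flat]
    show "inner_product (bform (fst X))" using K adm by (simp add: X admissible_def)
    show "\<exists>A. matrix_normal_form X A (k X)" using K unfolding X by metis
    show "l = k X" if "matrix_normal_form X A l" for A l using K that unfolding X by metis
  qed
  then have "continuous_map (top_of_set ?S) euclidean k" by simp
  moreover have "continuous_map LStat_DF_topology (top_of_set ?S) E"
    unfolding continuous_map_in_subtopology E_def
    by (auto simp: continuous_map_from_LStat_DF[OF continuous_entries] topspace_LStat_DF)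
  ultimately have "continuous_map LStat_DF_topology euclidean (k \<circ> E)" by (rule continuous_map_compose[rotated])
  then show ?thesis
  proof (rule continuous_map_eq)
    fix s :: "'n metric \<times> 'n connection" assume "s \<in> topspace LStat_DF_topology"
    then obtain b G where s: "s = const_structure b G" and adm: "admissible b G" and flat: "flat_product G"
      by (auto simp: topspace_LStat_DF LStat_DF_eq)
    show "(k \<circ> E) s = cubic_coeffs s" using key[OF s adm flat] by simp
  qed
qed

section \<open>Orbits and coefficients\<close>

lemma Aut_comp: "\<phi> \<in> Aut \<Longrightarrow> \<psi> \<in> Aut \<Longrightarrow> \<phi> \<circ> \<psi> \<in> Aut"
  by (simp add: Aut_iff linear_compose bij_comp)

lemma Aut_inv: "\<phi> \<in> Aut \<Longrightarrow> inv \<phi> \<in> Aut"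
  by (simp add: Aut_iff linear_inv bij_imp_bij_inv)

lemma Aut_id: "id \<in> Aut"
  by (simp add: Aut_iff linear_id)

lemma Aut_cancel:
  assumes "\<phi> \<in> Aut" shows "\<phi> (inv \<phi> x) = x" "inv \<phi> (\<phi> x) = x"
  using assms by (simp_all add: Aut_iff bij_is_surj surj_f_inv_f bij_is_inj)

lemma act_act:
  assumes "\<phi> \<in> Aut" "\<psi> \<in> Aut"
  shows "act r \<phi> (act q \<psi> (const_structure b G)) = act (r * q) (\<phi> \<circ> \<psi>) (const_structure b G)"
proof -
  have "inv (\<phi> \<circ> \<psi>) = inv \<psi> \<circ> inv \<phi>" using assms by (intro o_inv_distrib) (auto simp: Aut_iff)
  then show ?thesis using assms by (simp add: act_const Aut_comp mult.assoc)
qed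

lemma act_id: "act 1 id (const_structure b G) = const_structure b G"
  by (simp add: act_const Aut_id)

lemma admissible_act:
  assumes a: "admissible b G" and \<phi>: "\<phi> \<in> Aut" and r: "r > 0"
  shows "admissible (\<lambda>u v. r * b (inv \<phi> u) (inv \<phi> v)) (\<lambda>u v. \<phi> (G (inv \<phi> u) (inv \<phi> v)))"
proof -
  have b: "inner_product b" and G: "bilinear G" and sym: "\<And>u v. G u v = G v u"
    and self: "\<And>u v w. b (G u v) w = b v (G u w)" using a by (auto simp: admissible_def)
  have l: "linear \<phi>" "linear (inv \<phi>)" using \<phi> Aut_inv by (auto intro: Aut_linear)
  note [simp] = inner_product_simps[OF b] bilinear_simps[OF G] linear_add[OF l(1)] linear_add[OF l(2)]
    linear_cmul[OF l(1)] linear_cmul[OF l(2)] Aut_cancel[OF \<phi>]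
  have "inner_product (\<lambda>u v. r * b (inv \<phi> u) (inv \<phi> v))"
    unfolding inner_product_def bilinear_def
  proof (intro conjI allI impI linearI)
    fix u v :: "real^'a"
    show "r * b (inv \<phi> u) (inv \<phi> v) = r * b (inv \<phi> v) (inv \<phi> u)" using b by (simp add: inner_product_def)
    assume "u \<noteq> 0"
    then have "inv \<phi> u \<noteq> 0" using Aut_cancel(1)[OF \<phi>, of u] linear_0[OF l(1)] by metis
    then show "r * b (inv \<phi> u) (inv \<phi> u) > 0" using b r by (simp add: inner_product_def)
  qed (simp_all add: algebra_simps)
  moreover have "bilinear (\<lambda>u v. \<phi> (G (inv \<phi> u) (inv \<phi> v)))"
    unfolding bilinear_def by (intro conjI allI linearI) simp_all
  ultimately show ?thesis using sym self by (simp add: admissible_def)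
qed

lemma lstat_orbit_act:
  assumes s: "s \<in> LStat_DF" and \<phi>: "\<phi> \<in> Aut" and r: "r > 0"
  shows "lstat_orbit (act r \<phi> s) = lstat_orbit s"
proof -
  obtain b G where b: "s = const_structure b G" using s by (auto simp: LStat_DF_eq)
  have "act q \<psi> (act r \<phi> s) = act (q * r) (\<psi> \<circ> \<phi>) s" if "\<psi> \<in> Aut" for q \<psi>
    using \<phi> that by (simp add: b act_act)
  then have "lstat_orbit (act r \<phi> s) \<subseteq> lstat_orbit s"
    using r Aut_comp[OF _ \<phi>] by (fastforce simp: lstat_orbit_def)
  moreover have "act q \<psi> s = act (q / r) (\<psi> \<circ> inv \<phi>) (act r \<phi> s)" if "\<psi> \<in> Aut" for q \<psi>
  proof -
    have "(\<psi> \<circ> inv \<phi>) \<circ> \<phi> = \<psi>" by (simp add: fun_eq_iff Aut_cancel[OF \<phi>])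
    then show ?thesis
      using r act_act[OF Aut_comp[OF that Aut_inv[OF \<phi>]] \<phi>, of "q / r" r b G] by (simp add: b)
  qed
  then have "lstat_orbit s \<subseteq> lstat_orbit (act r \<phi> s)"
    using r Aut_comp[OF _ Aut_inv[OF \<phi>]] unfolding lstat_orbit_def by (blast intro: divide_pos_pos)
  ultimately show ?thesis by blast
qed

lemma self_mem_lstat_orbit: "s \<in> LStat_DF \<Longrightarrow> s \<in> lstat_orbit s"
  unfolding lstat_orbit_def LStat_DF_eq using act_id Aut_id zero_less_one by (smt (verit) mem_Collect_eq)

lemma diag_product_simps:
  "diag_product l (u + v) w = diag_product l u w + diag_product l v w"
  "diag_product l u (v + w) = diag_product l u v + diag_product l u w"
  "diag_product l (c *\<^sub>R u) v = c *\<^sub>R diag_product l u v"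
  "diag_product l u (c *\<^sub>R v) = c *\<^sub>R diag_product l u v"
  "diag_product (c *\<^sub>R l) u v = c *\<^sub>R diag_product l u v"
  by (simp_all add: diag_product_def vec_eq_iff algebra_simps)

text \<open>Replacing \<open>g\<close> by \<open>r g\<close> shrinks the orthonormal frames by \<open>1 / sqrt r\<close>, and the cubic form,
  which scales with \<open>g\<close>, is homogeneous of degree 3 in the frame.\<close>

lemma normal_form_act:
  fixes G :: "real^'n::{finite,linorder} \<Rightarrow> real^'n::_ \<Rightarrow> real^'n::_"
  assumes a: "admissible b G" and \<phi>: "\<phi> \<in> Aut" and r: "r > 0"
    and nf: "normal_form b (\<lambda>u v. - 2 *\<^sub>R G u v) \<psi> l"
  shows "normal_form (\<lambda>u v. r * b (inv \<phi> u) (inv \<phi> v)) (\<lambda>u v. - 2 *\<^sub>R \<phi> (G (inv \<phi> u) (inv \<phi> v)))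
    (\<lambda>x. (1 / sqrt r) *\<^sub>R \<phi> (\<psi> x)) ((1 / sqrt r) *\<^sub>R l)"
proof -
  have b: "inner_product b" and G: "bilinear G" using a by (auto simp: admissible_def)
  define c where "c = 1 / sqrt r"
  have c: "c > 0" "r * (c * c) = 1" using r by (auto simp: c_def)
  have \<psi>: "\<psi> \<in> Aut" "l \<in> chamber" and iso: "\<And>x y. b (\<psi> x) (\<psi> y) = x \<bullet> y"
    and diag: "\<And>x y. - 2 *\<^sub>R G (\<psi> x) (\<psi> y) = \<psi> (diag_product l x y)"
    using nf by (auto simp: normal_form_def)
  have l: "linear \<phi>" "linear (inv \<phi>)" "linear \<psi>" using \<phi> \<psi> Aut_inv by (auto intro: Aut_linear)
  have "(\<lambda>x. c *\<^sub>R \<phi> (\<psi> x)) \<in> Aut"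
  proof -
    have "bij (\<lambda>x::real^'n::_. c *\<^sub>R x)"
      by (rule o_bij[of "\<lambda>x. (1 / c) *\<^sub>R x"]) (use c in \<open>auto simp: fun_eq_iff\<close>)
    then have "(\<lambda>x::real^'n::_. c *\<^sub>R x) \<in> Aut" by (auto simp: Aut_iff intro!: linearI simp: algebra_simps)
    from Aut_comp[OF this Aut_comp[OF \<phi> \<psi>(1)]] show ?thesis by (simp add: o_def)
  qed
  moreover have "c *\<^sub>R l \<in> chamber" using \<psi>(2) c by (auto simp: chamber_def)
  moreover have "r * b (inv \<phi> (c *\<^sub>R \<phi> (\<psi> x))) (inv \<phi> (c *\<^sub>R \<phi> (\<psi> y))) = x \<bullet> y" for x y
  proof -
    have "r * b (inv \<phi> (c *\<^sub>R \<phi> (\<psi> x))) (inv \<phi> (c *\<^sub>R \<phi> (\<psi> y))) = r * (c * c) * b (\<psi> x) (\<psi> y)"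
      by (simp add: linear_cmul[OF l(2)] Aut_cancel[OF \<phi>] inner_product_simps[OF b])
    then show ?thesis by (simp add: c iso)
  qed
  moreover have "- 2 *\<^sub>R \<phi> (G (inv \<phi> (c *\<^sub>R \<phi> (\<psi> x))) (inv \<phi> (c *\<^sub>R \<phi> (\<psi> y)))) =
      c *\<^sub>R \<phi> (\<psi> (diag_product (c *\<^sub>R l) x y))" for x y
  proof -
    have "- 2 *\<^sub>R \<phi> (G (inv \<phi> (c *\<^sub>R \<phi> (\<psi> x))) (inv \<phi> (c *\<^sub>R \<phi> (\<psi> y)))) =
        (c * c) *\<^sub>R \<phi> (- 2 *\<^sub>R G (\<psi> x) (\<psi> y))"
      by (simp only: linear_cmul[OF l(2)] linear_cmul[OF l(1)] Aut_cancel[OF \<phi>] bilinear_simps[OF G])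
        (simp add: linear_neg[OF l(1)] linear_cmul[OF l(1)] mult_ac)
    then show ?thesis by (simp only: diag diag_product_simps linear_cmul[OF l(3)] linear_cmul[OF l(1)]) simp
  qed
  ultimately show ?thesis unfolding normal_form_def c_def by blast
qed

lemma cubic_coeffs_act:
  assumes s: "s \<in> LStat_DF" and \<phi>: "\<phi> \<in> Aut" and r: "r > 0"
  shows "cubic_coeffs (act r \<phi> s) = (1 / sqrt r) *\<^sub>R cubic_coeffs s"
proof -
  obtain b G where b: "s = const_structure b G" "admissible b G" "flat_product G"
    using s by (auto simp: LStat_DF_eq)
  obtain \<psi> where "normal_form b (\<lambda>u v. - 2 *\<^sub>R G u v) \<psi> (cubic_coeffs s)"
    using normal_form_coeffs(2)[OF b(2,3)] b(1) by blast
  from normal_form_coeffs(1)[OF admissible_act[OF b(2) \<phi> r] normal_form_act[OF b(2) \<phi> r this]]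
  show ?thesis by (simp add: b(1) act_const[OF \<phi>])
qed

lemma inner_product_inner: "inner_product (\<bullet>)"
  by (auto simp: inner_product_def inner_commute bilinear_conv_bounded_bilinear bounded_bilinear_inner)

definition std_structure :: "real^'n \<Rightarrow> ('n::finite) metric \<times> 'n connection" where
  "std_structure l = const_structure (\<bullet>) (\<lambda>u v. (- 1 / 2) *\<^sub>R diag_product l u v)"

lemma admissible_std: "admissible (\<bullet>) (\<lambda>u v. (- 1 / 2) *\<^sub>R diag_product l u v)"
  unfolding admissible_def bilinear_def
  by (auto intro!: linearI simp: inner_product_inner diag_product_simps scaleR_add_right)
    (auto simp: diag_product_def inner_vec_def mult_ac)

lemma flat_product_std: "flat_product (\<lambda>u v. (- 1 / 2) *\<^sub>R diag_product l u v)"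
  unfolding flat_product_def by (simp add: diag_product_simps) (simp add: diag_product_def mult_ac)

lemma std_structure_LStat_DF: "std_structure l \<in> LStat_DF"
  using admissible_std flat_product_std unfolding LStat_DF_eq std_structure_def by blast

lemma lstat_coords_std: "lstat_coords (std_structure l) = ((\<bullet>), diag_tensor l)"
  unfolding std_structure_def lstat_coords_const[OF admissible_std]
  by (simp add: diag_tensor_def fun_eq_iff)

lemma cubic_coeffs_std: "l \<in> chamber \<Longrightarrow> cubic_coeffs (std_structure l) = l"
  unfolding std_structure_def
  by (rule normal_form_coeffs(1)[OF admissible_std, where \<phi> = id]) (simp add: normal_form_def Aut_id)

lemma connection_of_diag:
  "((\<lambda>p. (\<bullet>)), connection_of (\<lambda>p. (\<bullet>)) (diag_tensor l)) = std_structure l"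
  by (subst connection_of_const[OF admissible_std[of l]])
    (simp_all add: diag_tensor_def std_structure_def const_structure_def)

lemma cubic_coeffs_chamber:
  assumes "s \<in> LStat_DF" shows "cubic_coeffs s \<in> chamber"
proof -
  obtain b G where b: "s = const_structure b G" "admissible b G" "flat_product G"
    using assms by (auto simp: LStat_DF_eq)
  show ?thesis using normal_form_coeffs(2)[OF b(2,3)] by (auto simp: b(1) normal_form_def)
qed

text \<open>A normalising frame \<open>\<phi>\<close> of \<open>s\<close> is itself an automorphism, and it carries the standard structure to \<open>s\<close>.\<close>

lemma lstat_orbit_std:
  assumes "s \<in> LStat_DF" shows "lstat_orbit s = lstat_orbit (std_structure (cubic_coeffs s))"
proof -
  obtain b G where b: "s = const_structure b G" "admissible b G" "flat_product G"
    using assms by (auto simp: LStat_DF_eq)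
  define l where "l = cubic_coeffs s"
  obtain \<phi> where "normal_form b (\<lambda>u v. - 2 *\<^sub>R G u v) \<phi> l"
    using normal_form_coeffs(2)[OF b(2,3)] b(1) l_def by blast
  then have \<phi>: "\<phi> \<in> Aut" and iso: "\<And>x y. b (\<phi> x) (\<phi> y) = x \<bullet> y"
    and diag: "\<And>x y. - 2 *\<^sub>R G (\<phi> x) (\<phi> y) = \<phi> (diag_product l x y)"
    by (auto simp: normal_form_def)
  have "b = (\<lambda>u v. 1 * (inv \<phi> u \<bullet> inv \<phi> v))"
    using iso[of "inv \<phi> u" "inv \<phi> v" for u v] by (simp add: Aut_cancel[OF \<phi>] fun_eq_iff)
  moreover have "G = (\<lambda>u v. \<phi> ((- 1 / 2) *\<^sub>R diag_product l (inv \<phi> u) (inv \<phi> v)))"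
  proof (intro ext)
    fix u v
    have "\<phi> ((- 1 / 2) *\<^sub>R diag_product l (inv \<phi> u) (inv \<phi> v)) = (- 1 / 2) *\<^sub>R (- 2 *\<^sub>R G u v)"
      using diag[of "inv \<phi> u" "inv \<phi> v"] by (simp only: linear_cmul[OF Aut_linear[OF \<phi>]] Aut_cancel[OF \<phi>])
    then show "G u v = \<phi> ((- 1 / 2) *\<^sub>R diag_product l (inv \<phi> u) (inv \<phi> v))" by simp
  qed
  ultimately have "s = act 1 \<phi> (std_structure l)"
    unfolding b(1) std_structure_def act_const[OF \<phi>] by metis
  then show ?thesis using lstat_orbit_act[OF std_structure_LStat_DF \<phi>, of 1 l] by (simp add: l_def)
qed

lemma lstat_orbit_std_scale:
  assumes c: "c > 0" shows "lstat_orbit (std_structure (c *\<^sub>R l)) = lstat_orbit (std_structure l)"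
proof -
  define \<phi> where "\<phi> = (\<lambda>x::real^'a. (1 / c) *\<^sub>R x)"
  have inv: "inv \<phi> = (\<lambda>x. c *\<^sub>R x)" unfolding \<phi>_def by (rule inv_equality) (use c in auto)
  have "bij \<phi>" unfolding \<phi>_def by (rule o_bij[of "\<lambda>x. c *\<^sub>R x"]) (use c in \<open>auto simp: fun_eq_iff\<close>)
  then have \<phi>: "\<phi> \<in> Aut" by (auto simp: Aut_iff \<phi>_def intro!: linearI simp: algebra_simps)
  have "act (1 / c\<^sup>2) \<phi> (std_structure l) = std_structure (c *\<^sub>R l)"
    using c unfolding std_structure_def act_const[OF \<phi>] inv
    by (simp add: \<phi>_def diag_product_simps power2_eq_square)
  then show ?thesis using lstat_orbit_act[OF std_structure_LStat_DF \<phi>, of "1 / c\<^sup>2" l] c by simp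
qed

theorem lstat_orbit_eq_iff:
  assumes s: "s \<in> LStat_DF" and t: "t \<in> LStat_DF"
  shows "lstat_orbit s = lstat_orbit t \<longleftrightarrow> (\<exists>c>0. cubic_coeffs t = c *\<^sub>R cubic_coeffs s)"
proof
  assume "lstat_orbit s = lstat_orbit t"
  then have "t \<in> lstat_orbit s" using self_mem_lstat_orbit[OF t] by simp
  then obtain r \<phi> where "t = act r \<phi> s" "r > 0" "\<phi> \<in> Aut" by (auto simp: lstat_orbit_def)
  then show "\<exists>c>0. cubic_coeffs t = c *\<^sub>R cubic_coeffs s"
    using cubic_coeffs_act[OF s] by (intro exI[of _ "1 / sqrt r"]) auto
next
  assume "\<exists>c>0. cubic_coeffs t = c *\<^sub>R cubic_coeffs s"
  then show "lstat_orbit s = lstat_orbit t"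
    using lstat_orbit_std[OF s] lstat_orbit_std[OF t] lstat_orbit_std_scale by fastforce
qed

section \<open>The set of representatives and the moduli space\<close>

lemma cube_dual_basis: "cube (dual_basis i) u v w = u $ i * v $ i * w $ i"
proof -
  let ?x = "dual_basis i"
  have "(\<Prod>k<3. ([?x, ?x, ?x] ! \<sigma> k) ([u, v, w] ! k)) = u $ i * v $ i * w $ i"
    if "\<sigma> permutes {..<3}" for \<sigma> :: "nat \<Rightarrow> nat"
  proof -
    have "([?x, ?x, ?x] ! \<sigma> k) = ?x" if "k < 3" for k
    proof -
      have "\<sigma> k < 3" using permutes_in_image[OF \<open>\<sigma> permutes {..<3}\<close>, of k] that by simp
      then have "\<sigma> k = 0 \<or> \<sigma> k = 1 \<or> \<sigma> k = 2" by linarith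
      then show ?thesis by auto
    qed
    then have "(\<Prod>k<3. ([?x, ?x, ?x] ! \<sigma> k) ([u, v, w] ! k)) = (\<Prod>k<3. ?x ([u, v, w] ! k))"
      by (intro prod.cong) auto
    then show ?thesis by (simp add: eval_nat_numeral dual_basis_def)
  qed
  then have "(\<Sum>\<sigma> | \<sigma> permutes {..<3}. \<Prod>k<3. ([?x, ?x, ?x] ! \<sigma> k) ([u, v, w] ! k)) =
      (\<Sum>\<sigma> | \<sigma> permutes {..<3::nat}. u $ i * v $ i * w $ i)"
    by (intro sum.cong) auto
  also have "\<dots> = fact 3 * (u $ i * v $ i * w $ i)"
    using card_permutations[of "{..<3::nat}" 3] by simp
  finally show ?thesis by (simp add: cube_def sym_product_def numeral_3_eq_3[symmetric])
qed

lemma diag_tensor_sum: "diag_tensor l = (\<lambda>u v w. \<Sum>i\<in>UNIV. l $ i * cube (dual_basis i) u v w)"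
  by (simp add: diag_tensor_def diag_product_def inner_vec_def cube_dual_basis mult.assoc fun_eq_iff)

lemma V_plus_eq: "V_plus = diag_tensor ` chamber"
proof (intro equalityI subsetI)
  fix C :: "'a tensor3" assume "C \<in> V_plus"
  then obtain l where C: "C = (\<lambda>u v w. \<Sum>i\<in>UNIV. l i * cube (dual_basis i) u v w)"
    and l: "\<forall>i j. i \<le> j \<longrightarrow> l i \<ge> l j" "\<forall>i. l i \<ge> 0" by (auto simp: V_plus_def)
  have "C = diag_tensor (\<chi> i. l i)" by (simp add: C diag_tensor_sum)
  moreover have "(\<chi> i. l i) \<in> chamber" using l by (simp add: chamber_def)
  ultimately show "C \<in> diag_tensor ` chamber" by blast
next
  fix C :: "'a tensor3" assume "C \<in> diag_tensor ` chamber"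
  then obtain l where "C = diag_tensor l" "l \<in> chamber" by blast
  then show "C \<in> V_plus" unfolding V_plus_def by (auto simp: chamber_def diag_tensor_sum intro!: exI[of _ "\<lambda>i. l $ i"])
qed

lemma diag_tensor_Sym3: "diag_tensor l \<in> Sym3"
  by (auto simp: Sym3_def diag_tensor_def diag_product_def inner_vec_def algebra_simps sum.distrib sum_distrib_left
      intro!: linearI)

lemma inner_product_orthonormal:
  assumes b: "inner_product b" and "\<And>i j. b (axis i 1) (axis j 1) = (if i = j then 1 else 0)"
  shows "b = (\<bullet>)"
proof (intro ext)
  fix u v
  show "b u v = u \<bullet> v"
    using bilinear_entries[of b u v] b assms(2)
    by (simp add: inner_product_def inner_vec_def if_distrib cong: if_cong)
qed

lemma representatives:
  "set_of_representatives_DF (\<lambda>p. (\<bullet>)) (V_plus :: ('n::{finite,linorder}) tensor3 set)"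
proof -
  have "lstat_orbit ` LStat_DF = (\<lambda>l :: real^'n::_. lstat_orbit (std_structure l)) ` chamber"
  proof (intro equalityI subsetI)
    fix A :: "('n metric \<times> 'n connection) set" assume "A \<in> lstat_orbit ` LStat_DF"
    then show "A \<in> (\<lambda>l. lstat_orbit (std_structure l)) ` chamber"
      using lstat_orbit_std cubic_coeffs_chamber by blast
  qed (auto simp: std_structure_LStat_DF)
  then show ?thesis
    by (simp add: set_of_representatives_DF_def V_plus_eq image_image connection_of_diag image_subset_iff
        diag_tensor_Sym3)
qed

lemma quotient_topology_lift:
  assumes "continuous_map X Z h"
    and "\<And>x y. x \<in> topspace X \<Longrightarrow> y \<in> topspace X \<Longrightarrow> f x = f y \<Longrightarrow> h x = h y"
  shows "\<exists>g. continuous_map (quotient_topology X f) Z g \<and> (\<forall>x\<in>topspace X. g (f x) = h x)"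
proof (rule quotient_map_lift_exists[OF quotient_map_quotient_topology[of X f] assms(1)])
  show "h x = h y" if "x \<in> topspace X" "y \<in> topspace X" "f x = f y" for x y
    using assms(2) that .
qed blast

text \<open>The maps \<open>e\<close> and \<open>s\<close> have to be mutually inverse only up to the identifications made by \<open>f\<close> and \<open>h\<close>.\<close>

lemma quotient_topologies_homeomorphic:
  assumes e: "continuous_map X Y e" and s: "continuous_map Y X s"
    and fh: "\<And>x x'. x \<in> topspace X \<Longrightarrow> x' \<in> topspace X \<Longrightarrow> f x = f x' \<Longrightarrow> h (e x) = h (e x')"
    and hf: "\<And>y y'. y \<in> topspace Y \<Longrightarrow> y' \<in> topspace Y \<Longrightarrow> h y = h y' \<Longrightarrow> f (s y) = f (s y')"
    and se: "\<And>x. x \<in> topspace X \<Longrightarrow> f (s (e x)) = f x"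
    and es: "\<And>y. y \<in> topspace Y \<Longrightarrow> h (e (s y)) = h y"
  shows "quotient_topology X f homeomorphic_space quotient_topology Y h"
proof -
  note qf = quotient_map_quotient_topology[of X f] and qh = quotient_map_quotient_topology[of Y h]
  have ex: "e x \<in> topspace Y" if "x \<in> topspace X" for x
    using e that by (auto simp: continuous_map_def)
  have sy: "s y \<in> topspace X" if "y \<in> topspace Y" for y
    using s that by (auto simp: continuous_map_def)
  have "continuous_map X (quotient_topology Y h) (h \<circ> e)"
    using continuous_map_compose[OF e quotient_imp_continuous_map[OF qh]] .
  from quotient_topology_lift[OF this, of f] fh
  obtain E where E: "continuous_map (quotient_topology X f) (quotient_topology Y h) E"
      "\<forall>x\<in>topspace X. E (f x) = h (e x)"
    unfolding o_def by blast
  have "continuous_map Y (quotient_topology X f) (f \<circ> s)"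
    using continuous_map_compose[OF s quotient_imp_continuous_map[OF qf]] .
  from quotient_topology_lift[OF this, of h] hf
  obtain S where S: "continuous_map (quotient_topology Y h) (quotient_topology X f) S"
      "\<forall>y\<in>topspace Y. S (h y) = f (s y)"
    unfolding o_def by blast
  have "homeomorphic_maps (quotient_topology X f) (quotient_topology Y h) E S"
    unfolding homeomorphic_maps_def topspace_quotient_topology
    using E S by (simp add: ex sy se es)
  then show ?thesis by (auto simp: homeomorphic_space_def)
qed

lemma continuous_diag_tensor: "continuous_on UNIV (diag_tensor :: real^'n::finite \<Rightarrow> 'n tensor3)"
  unfolding diag_tensor_def diag_product_def inner_vec_def
  by (intro continuous_on_coordinatewise_then_product) (simp, intro continuous_intros)

definition diag_entries :: "('n::finite) tensor3 \<Rightarrow> real^'n" where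
  "diag_entries C = (\<chi> i. C (axis i 1) (axis i 1) (axis i 1))"

lemma diag_entries_tensor: "diag_entries (diag_tensor l) = l"
  by (simp add: diag_entries_def diag_tensor_def diag_product_def inner_axis vec_eq_iff)

lemma continuous_diag_entries: "continuous_on UNIV (diag_entries :: ('n::finite) tensor3 \<Rightarrow> _)"
proof -
  have "continuous_on UNIV (\<lambda>C :: 'n tensor3. C u v w)" for u v w
    by (rule continuous_on_evaluation, rule continuous_on_evaluation, rule continuous_on_product_coordinates)
  then show ?thesis unfolding diag_entries_def by (intro continuous_on_vec_lambda)
qed

lemma continuous_std_structure: "continuous_map euclidean LStat_DF_topology std_structure"
  unfolding LStat_DF_topology_def LStat_topology_def continuous_map_in_subtopology
proof
  have "continuous_on UNIV (\<lambda>l :: real^'a. (((\<bullet>) :: 'a tensor2), diag_tensor l))"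
    by (intro continuous_on_Pair continuous_on_const continuous_diag_tensor)
  then have "continuous_map euclidean euclidean (lstat_coords \<circ> (std_structure :: real^'a \<Rightarrow> _))"
    by (simp add: o_def lstat_coords_std)
  then show "continuous_map euclidean (pullback_topology LStat lstat_coords euclidean) (std_structure :: real^'a \<Rightarrow> _)"
    using std_structure_LStat_DF by (intro continuous_map_pullback') (auto simp: LStat_DF_def)
qed (auto simp: std_structure_LStat_DF)

lemma scaling_orbit_diag: "scaling_orbit (diag_tensor l) = {diag_tensor (r *\<^sub>R l) |r. r > 0}"
  by (simp add: scaling_orbit_def diag_tensor_def diag_product_simps)

lemma scaling_orbit_diag_eq_iff:
  "scaling_orbit (diag_tensor l) = scaling_orbit (diag_tensor l') \<longleftrightarrow> (\<exists>c>0. l' = c *\<^sub>R l)"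
proof
  assume "scaling_orbit (diag_tensor l) = scaling_orbit (diag_tensor l')"
  moreover have "diag_tensor l' \<in> scaling_orbit (diag_tensor l')"
    unfolding scaling_orbit_diag by (auto intro!: exI[of _ 1])
  ultimately obtain r where "r > 0" "diag_tensor l' = diag_tensor (r *\<^sub>R l)"
    by (auto simp: scaling_orbit_diag)
  then show "\<exists>c>0. l' = c *\<^sub>R l" using diag_entries_tensor by metis
next
  assume "\<exists>c>0. l' = c *\<^sub>R l"
  then obtain c where c: "c > 0" "l' = c *\<^sub>R l" by blast
  have "\<exists>q>0. diag_tensor (r *\<^sub>R l) = diag_tensor (q *\<^sub>R l')" if "r > 0" for r
    using c that by (intro exI[of _ "r / c"]) simp
  moreover have "\<exists>q>0. diag_tensor (r *\<^sub>R l') = diag_tensor (q *\<^sub>R l)" if "r > 0" for r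
    using c that by (intro exI[of _ "r * c"]) simp
  ultimately show "scaling_orbit (diag_tensor l) = scaling_orbit (diag_tensor l')"
    unfolding scaling_orbit_diag by blast
qed

theorem moduli_space_homeomorphic:
  "(MLStat_DF :: (('n::{finite,linorder}) metric \<times> 'n connection) set topology) homeomorphic_space
    quotient_topology (top_of_set (V_plus :: 'n tensor3 set)) scaling_orbit"
  unfolding MLStat_DF_def
proof (rule quotient_topologies_homeomorphic)
  show "continuous_map LStat_DF_topology (top_of_set (V_plus :: 'n tensor3 set)) (\<lambda>s. diag_tensor (cubic_coeffs s))"
    unfolding continuous_map_in_subtopology V_plus_eq
    using continuous_map_compose[OF cubic_coeffs_continuous, of euclidean diag_tensor] continuous_diag_tensor
    by (auto simp: o_def topspace_LStat_DF cubic_coeffs_chamber)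
  show "continuous_map (top_of_set (V_plus :: 'n tensor3 set)) LStat_DF_topology (\<lambda>C. std_structure (diag_entries C))"
  proof -
    have "continuous_map euclidean euclidean (diag_entries :: 'n tensor3 \<Rightarrow> _)"
      using continuous_diag_entries by simp
    from continuous_map_compose[OF this continuous_std_structure]
    show ?thesis by (simp add: o_def continuous_map_from_subtopology)
  qed
  show "scaling_orbit (diag_tensor (cubic_coeffs s)) = scaling_orbit (diag_tensor (cubic_coeffs t))"
    if "s \<in> topspace LStat_DF_topology" "t \<in> topspace LStat_DF_topology" "lstat_orbit s = lstat_orbit t"
    for s t :: "'n metric \<times> 'n connection"
    using that lstat_orbit_eq_iff[of s t] by (simp add: topspace_LStat_DF scaling_orbit_diag_eq_iff)
  show "lstat_orbit (std_structure (diag_entries C)) = lstat_orbit (std_structure (diag_entries D))"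
    if "C \<in> topspace (top_of_set V_plus)" "D \<in> topspace (top_of_set V_plus)" "scaling_orbit C = scaling_orbit D"
    for C D :: "'n tensor3"
    using that lstat_orbit_std_scale by (fastforce simp: V_plus_eq scaling_orbit_diag_eq_iff diag_entries_tensor)
  show "lstat_orbit (std_structure (diag_entries (diag_tensor (cubic_coeffs s)))) = lstat_orbit s"
    if "s \<in> topspace LStat_DF_topology" for s :: "'n metric \<times> 'n connection"
    using that lstat_orbit_std[of s] by (simp add: topspace_LStat_DF diag_entries_tensor)
  show "scaling_orbit (diag_tensor (cubic_coeffs (std_structure (diag_entries C)))) = scaling_orbit C"
    if "C \<in> topspace (top_of_set V_plus)" for C :: "'n tensor3"
    using that by (auto simp: V_plus_eq diag_entries_tensor cubic_coeffs_std)
qed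

section \<open>An embedded family of maximal dimension\<close>

definition index_at :: "nat \<Rightarrow> 'n::{finite,linorder}" where
  "index_at = inv_into UNIV position"

lemma position_index_at: "m < CARD('n) \<Longrightarrow> position (index_at m :: 'n::{finite,linorder}) = m"
  unfolding index_at_def using bij_position by (intro f_inv_into_f) (auto simp: bij_betw_def)

text \<open>The largest coefficient is fixed to remove the scaling. The others are perturbations of \<open>n - 1, \<dots>, 1\<close>; perturbations below
  \<open>1 / 2\<close> keep them decreasing and positive.\<close>

definition family_coeffs :: "(nat \<Rightarrow> real) \<Rightarrow> real^'n::{finite,linorder}" where
  "family_coeffs x = (\<chi> i. if position i = 0 then real CARD('n)
     else real CARD('n) - real (position i) + x (position i - 1))"

lemma family_coeffs_chamber:
  assumes x: "\<And>i. \<bar>x i\<bar> < 1 / 2" shows "(family_coeffs x :: real^'n::{finite,linorder}) \<in> chamber"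
proof -
  define l :: "real^'n::_" where "l = family_coeffs x"
  have val: "l $ i = real CARD('n) - real (position i) + (if position i = 0 then 0 else x (position i - 1))" for i
    by (simp add: l_def family_coeffs_def)
  have b: "\<bar>if position i = 0 then 0 else x (position i - 1)\<bar> < 1 / 2" for i :: 'n using x by simp
  have "l $ j \<le> l $ i" if "i \<le> j" for i j
  proof (cases "i = j")
    case False
    then have "position i < position j" using that position_less[of i j] by simp
    then have "real (position i) + 1 \<le> real (position j)" by linarith
    then show ?thesis using b[of i] b[of j] unfolding val by linarith
  qed simp
  moreover have "0 \<le> l $ i" for i
  proof -
    have "real (position i) + 1 \<le> real CARD('n)" using position_bound[of i] by linarith
    then show ?thesis using b[of i] unfolding val by linarith
  qed
  ultimately show ?thesis by (simp add: chamber_def l_def)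
qed

lemma Euclidean_space_top_of_set: "Euclidean_space m = top_of_set {x. \<forall>i\<ge>m. x i = 0}"
  by (simp add: Euclidean_space_def euclidean_product_topology)

text \<open>On the open set of orbits with nonzero cubic form the ratios of the coefficients to the largest
  one are continuous invariants, and they recover the parameters of the family.\<close>

theorem embedded_family:
  "\<exists>T (F :: (nat \<Rightarrow> real) \<Rightarrow> ('n::{finite,linorder}) metric \<times> 'n connection).
    openin (Euclidean_space (CARD('n) - 1)) T \<and> T \<noteq> {} \<and>
    continuous_map (subtopology (Euclidean_space (CARD('n) - 1)) T) LStat_DF_topology F \<and>
    embedding_map (subtopology (Euclidean_space (CARD('n) - 1)) T) MLStat_DF (lstat_orbit \<circ> F)"
proof -
  define n where "n = CARD('n)"
  have n: "n > 0" by (simp add: n_def)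
  define E where "E = Euclidean_space (n - 1)"
  define T where "T = {x \<in> topspace E. (\<Sum>i<n-1. (x i)\<^sup>2) < 1 / 4}"
  define F :: "(nat \<Rightarrow> real) \<Rightarrow> 'n metric \<times> 'n connection" where "F = (\<lambda>x. std_structure (family_coeffs x))"
  let ?X = "subtopology E T"
  let ?M = "MLStat_DF :: ('n metric \<times> 'n connection) set topology"
  have topE: "topspace E = {x. \<forall>i\<ge>n-1. x i = 0}" by (simp add: E_def topspace_Euclidean_space)
  have topX: "topspace ?X = T" by (auto simp: T_def)
  have "open {x :: nat \<Rightarrow> real. (\<Sum>i<n-1. (x i)\<^sup>2) < 1 / 4}"
    by (intro open_Collect_less continuous_intros continuous_on_product_coordinates)
  moreover have "T = topspace E \<inter> {x. (\<Sum>i<n-1. (x i)\<^sup>2) < 1 / 4}" by (auto simp: T_def)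
  ultimately have openT: "openin E T"
    unfolding E_def Euclidean_space_top_of_set by (simp add: openin_open_Int)
  have "(\<lambda>_. 0) \<in> T" by (simp add: T_def topE)
  then have T0: "T \<noteq> {}" by blast
  have small: "\<bar>x i\<bar> < 1 / 2" if x: "x \<in> T" for x i
  proof (cases "i < n - 1")
    case True
    have "(x i)\<^sup>2 \<le> (\<Sum>i<n-1. (x i)\<^sup>2)" using True by (intro member_le_sum) auto
    also have "\<dots> < (1 / 2)\<^sup>2" using x by (simp add: T_def power2_eq_square)
    finally show ?thesis using power2_less_imp_less[of "\<bar>x i\<bar>" "1 / 2"] by simp
  next
    case False
    then show ?thesis using x by (simp add: T_def topE)
  qed
  have coeffs: "cubic_coeffs (F x) = family_coeffs x" if "x \<in> T" for x
    unfolding F_def by (intro cubic_coeffs_std family_coeffs_chamber small that)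
  have "continuous_on UNIV (\<lambda>x. if position i = 0 then real CARD('n)
      else real CARD('n) - real (position i) + x (position i - 1))" for i :: 'n
    by (cases "position i = 0") (auto intro!: continuous_intros continuous_on_product_coordinates)
  then have "continuous_on UNIV (family_coeffs :: _ \<Rightarrow> real^'n::_)"
    unfolding family_coeffs_def by (intro continuous_on_vec_lambda)
  then have "continuous_map ?X euclidean (family_coeffs :: _ \<Rightarrow> real^'n::_)"
    unfolding E_def Euclidean_space_top_of_set subtopology_subtopology
    by (intro continuous_map_from_subtopology) simp
  from continuous_map_compose[OF this continuous_std_structure]
  have contF: "continuous_map ?X LStat_DF_topology F" by (simp add: F_def o_def)
  have quot: "quotient_map LStat_DF_topology ?M lstat_orbit"
    unfolding MLStat_DF_def by (rule quotient_map_quotient_topology)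
  from continuous_map_compose[OF contF quotient_imp_continuous_map[OF this]]
  have contG: "continuous_map ?X ?M (lstat_orbit \<circ> F)" .
  define i0 :: 'n where "i0 = index_at 0"
  have r0: "position i0 = 0" unfolding i0_def using n by (intro position_index_at) (simp add: n_def)
  define U where "U = {s \<in> (LStat_DF :: ('n metric \<times> 'n connection) set). 0 < cubic_coeffs s $ i0}"
  define V where "V = lstat_orbit ` U"
  have contc: "continuous_map LStat_DF_topology euclideanreal (\<lambda>s :: 'n metric \<times> 'n connection. cubic_coeffs s $ i)" for i
    using continuous_map_compose[OF cubic_coeffs_continuous, of euclideanreal "\<lambda>v. v $ i"]
    by (simp add: o_def continuous_on_component)
  have openU: "openin LStat_DF_topology U"
    using openin_continuous_map_preimage[OF contc, of "{0<..}" i0] by (simp add: U_def topspace_LStat_DF)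
  \<comment> \<open>\<open>U\<close> is a union of orbits, so \<open>V\<close> is open and the orbit map restricts to a quotient map from \<open>U\<close> to \<open>V\<close>.\<close>
  have sat: "{s \<in> topspace LStat_DF_topology. lstat_orbit s \<in> V} = U"
  proof (intro equalityI subsetI)
    fix s assume "s \<in> {s \<in> topspace LStat_DF_topology. lstat_orbit s \<in> V}"
    then obtain t where s: "s \<in> LStat_DF" and t: "t \<in> LStat_DF" "0 < cubic_coeffs t $ i0" "lstat_orbit t = lstat_orbit s"
      by (auto simp: V_def U_def topspace_LStat_DF)
    then obtain c where "c > 0" "cubic_coeffs s = c *\<^sub>R cubic_coeffs t" using lstat_orbit_eq_iff by blast
    then show "s \<in> U" using s t by (simp add: U_def)
  qed (auto simp: V_def U_def topspace_LStat_DF)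
  have openV: "openin ?M V"
    unfolding MLStat_DF_def openin_quotient_topology sat
    using openU by (auto simp: V_def U_def topspace_LStat_DF)
  have quotU: "quotient_map (subtopology LStat_DF_topology U) (subtopology ?M V) lstat_orbit"
    by (rule quotient_map_restriction[OF quot sat]) (use openV in simp)
  \<comment> \<open>The parameters of the family as functions of the coefficients, made invariant under scaling by dividing by the
    largest coefficient.\<close>
  define k :: "'n metric \<times> 'n connection \<Rightarrow> nat \<Rightarrow> real" where
    "k = (\<lambda>s j. if j < n - 1 then real n * (cubic_coeffs s $ index_at (Suc j) / cubic_coeffs s $ i0) - (real n - real (Suc j)) else 0)"
  have topU: "topspace (subtopology LStat_DF_topology U) = U" by (auto simp: U_def topspace_LStat_DF)
  have contk: "continuous_map (subtopology LStat_DF_topology U) E k"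
    unfolding E_def Euclidean_space_def continuous_map_in_subtopology continuous_map_componentwise_UNIV
  proof (intro conjI allI)
    fix j
    have "continuous_map (subtopology LStat_DF_topology U) euclideanreal
        (\<lambda>s. real n * (cubic_coeffs s $ index_at (Suc j) / cubic_coeffs s $ i0) - (real n - real (Suc j)))"
      by (intro continuous_map_diff continuous_map_real_mult continuous_map_real_divide
          continuous_map_from_subtopology contc continuous_map_const[THEN iffD2]) (auto simp: U_def)
    then show "continuous_map (subtopology LStat_DF_topology U) euclideanreal (\<lambda>s. k s j)"
      by (cases "j < n - 1") (simp_all add: k_def)
  qed (auto simp: k_def)
  have "k s = k t" if st: "s \<in> U" "t \<in> U" "lstat_orbit s = lstat_orbit t" for s t
  proof -
    obtain c where "c > 0" "cubic_coeffs t = c *\<^sub>R cubic_coeffs s"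
      using st lstat_orbit_eq_iff[of s t] by (auto simp: U_def)
    then show ?thesis by (simp add: k_def fun_eq_iff)
  qed
  then obtain g where g: "continuous_map (subtopology ?M V) E g" "\<And>s. s \<in> U \<Longrightarrow> g (lstat_orbit s) = k s"
    using quotient_map_lift_exists[OF quotU contk] unfolding topU by metis
  have FU: "F x \<in> U" if "x \<in> T" for x
    using that n std_structure_LStat_DF coeffs[OF that] r0
    by (auto simp: U_def F_def family_coeffs_def)
  have gF: "g (lstat_orbit (F x)) = x" if x: "x \<in> T" for x
  proof -
    have "k (F x) j = x j" for j
    proof (cases "j < n - 1")
      case True
      then have "position (index_at (Suc j) :: 'n) = Suc j" by (intro position_index_at) (simp add: n_def)
      then show ?thesis using True n by (simp add: k_def coeffs[OF x] family_coeffs_def r0 n_def)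
    next
      case False
      then show ?thesis using x by (simp add: k_def T_def topE)
    qed
    then show ?thesis using g(2)[OF FU[OF x]] by auto
  qed
  let ?Z = "subtopology ?M ((lstat_orbit \<circ> F) ` topspace ?X)"
  have sub: "(lstat_orbit \<circ> F) ` topspace ?X \<subseteq> V" using FU by (auto simp: V_def topX simp del: topspace_subtopology)
  have "continuous_map ?Z E g"
    using continuous_map_from_subtopology_mono[OF g(1) sub] .
  then have "continuous_map ?Z ?X g"
    using gF by (auto simp: continuous_map_in_subtopology topX simp del: topspace_subtopology)
      (auto simp: topX T_def)
  moreover have "continuous_map ?X ?Z (lstat_orbit \<circ> F)"
    using contG by (simp add: continuous_map_in_subtopology)
  ultimately have "homeomorphic_maps ?X ?Z (lstat_orbit \<circ> F) g"
    unfolding homeomorphic_maps_def using gF by (auto simp: T_def)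
  then have "embedding_map ?X ?M (lstat_orbit \<circ> F)"
    unfolding embedding_map_def using homeomorphic_maps_imp_map by blast
  with openT T0 contF show ?thesis unfolding E_def n_def by blast
qed

theorem theorem1p1:
  fixes g :: "('n::{finite,linorder}) metric"
  assumes "riemannian_metric g"
    and "left_invariant_metric g"
    and "\<forall>i j. g 0 (std_basis i) (std_basis j) = (if i = j then 1 else 0)"
  shows "(\<forall>(h, nab) \<in> (LStat :: ('n metric \<times> 'n connection) set). conjugate_symmetric h nab) \<and>
    set_of_representatives_DF g V_plus \<and>
    (MLStat_DF :: ('n metric \<times> 'n connection) set topology) homeomorphic_space
      quotient_topology (top_of_set (V_plus :: 'n tensor3 set)) scaling_orbit \<and>
    (\<exists>T (F :: (nat \<Rightarrow> real) \<Rightarrow> 'n metric \<times> 'n connection).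
      openin (Euclidean_space (CARD('n) - 1)) T \<and> T \<noteq> {} \<and>
      continuous_map (subtopology (Euclidean_space (CARD('n) - 1)) T) LStat_DF_topology F \<and>
      embedding_map (subtopology (Euclidean_space (CARD('n) - 1)) T) MLStat_DF (lstat_orbit \<circ> F))"
proof -
  obtain b where g: "g = (\<lambda>p. b)" using assms(2) left_invariant_metric_iff by blast
  have "inner_product b" using assms(1) by (simp add: g riemannian_const)
  then have "b = (\<bullet>)" using assms(3) by (intro inner_product_orthonormal) (simp_all add: g std_basis_def)
  then have "set_of_representatives_DF g V_plus" using representatives by (simp add: g)
  then show ?thesis using LStat_conjugate_symmetric moduli_space_homeomorphic embedded_family by blast
qed

end
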